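(* Let $\mathcal{V}_1,\dots,\mathcal{V}_k\subseteq\mathcal{B}(H_1,H_2)$ be $\mathfrak{I}$-decomposable masa-bimodules and $\mathcal{U}\subseteq\mathcal{B}(H_1,H_2)$ be a weak* closed masa-bimodule. Then $$\overline{\mathcal{U}+\bigcap_{j=1}^k\mathcal{V}_j}^{w^*}=\bigcap_{j=1}^k\overline{\mathcal{U}+\mathcal{V}_j}^{w^*}.$$ Moreover, if $\mathcal{U}$ is reflexive then $\overline{\mathcal{U}+\bigcap_{j=1}^k\mathcal{V}_j}^{w^*}$ is a reflexive masa-bimodule. In particular, if $\mathcal{U}$ is reflexive then $\overline{\mathcal{U}+\mathcal{V}_1}^{w^*}$ is reflexive.
   Context: $(X,m)$ and $(Y,n)$ are standard measure spaces ($\sigma$-finite regular Borel measures for Borel structures arising from complete separable metrizable topologies), $H_1=L^2(X,m)$, $H_2=L^2(Y,n)$; $\mathcal{D}_1\subseteq\mathcal{B}(H_1)$ and $\mathcal{D}_2\subseteq\mathcal{B}(H_2)$ are the maximal abelian selfadjoint algebras (masas) of multiplication operators by functions in $L^\infty(X,m)$ and $L^\infty(Y,n)$. $\mathcal{B}(H_1,H_2)$ carries the weak* topology as the dual of the trace class operators from $H_2$ to $H_1$. A masa-bimodule is a subspace $\mathcal{U}\subseteq\mathcal{B}(H_1,H_2)$ with $BTA\in\mathcal{U}$ for all $A\in\mathcal{D}_1$, $B\in\mathcal{D}_2$, $T\in\mathcal{U}$. The reflexive hull of a subspace $\mathcal{S}$ is $\mathrm{Ref}\,\mathcal{S}=\{T\in\mathcal{B}(H_1,H_2):Tx\in\overline{\mathcal{S}x}\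 \forall x\in H_1\}$; $\mathcal{S}$ is reflexive if $\mathrm{Ref}\,\mathcal{S}=\mathcal{S}$. Schur maps: let $\Gamma(X,Y)=L^2(X,m)\hat\otimes L^2(Y,n)$ (projective tensor product), identified with the predual of $\mathcal{B}(H_1,H_2)$ via $\langle T,f\otimes g\rangle=(Tf,\overline{g})$, and its elements with functions $h(x,y)=\sum_i f_i(x)g_i(y)$, $\sum\|f_i\|_2^2<\infty$, $\sum\|g_i\|_2^2<\infty$. A Schur multiplier is $\varphi\in L^\infty(X\times Y,m\times n)$ such that $\varphi h$ is equivalent with respect to $m\times n$ to a function in $\Gamma(X,Y)$ for every $h\in\Gamma(X,Y)$; the dual of the map $h\mapsto\varphi h$ is the Schur map $S_\varphi$ on $\mathcal{B}(H_1,H_2)$. (The Schur maps are exactly the bounded weak* continuous masa-bimodule maps, i.e. those with $\Phi(BTA)=B\Phi(T)A$ for $A\in\mathcal{D}_1,B\in\mathcal{D}_2$.) $\mathfrak{I}$ denotes the set of all idempotent Schur maps (Schur idempotents). A subspace is $\mathfrak{I}$-injective if it is the range $\mathrm{Ran}\,\phi$ of some $\phi\in\mathfrak{I}$. For weak* closed sets $\mathcal{M}_n$, $\limsup_n\mathcal{M}_n$ is the set of all weak* cluster points of sequences $(x_n)$ with $x_n\in\mathcal{M}_n$. A weak* closed subspace $\mathcal{V}\subseteq\mathcal{B}(H_1,H_2)$ is $\mathfrak{I}$-decomposable if there are $(\phi_n)_{n=1}^\infty\subseteq\mathfrak{I}$ and $\mathfrak{I}$-injective subspaces $(\mathcal{W}_n)_{n=1}^\infty$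 such that (a) $\sup_n\|\phi_n\|<\infty$; (b) $\mathcal{V}\subseteq\mathrm{Ran}\,\phi_n+\mathcal{W}_n$ for each $n$; (c) $\mathcal{W}_n\subseteq\mathcal{V}$ for each $n$; (d) $\limsup_n\mathrm{Ran}\,\phi_n\subseteq\mathcal{V}$. *)

theory Defs
  imports "HOL-Analysis.Analysis" "HOL-Library.Set_Algebras"
begin

section \<open>Complex inner product spaces and bounded operators\<close>

class complex_vector = real_vector +
  fixes scaleC :: "complex \<Rightarrow> 'a \<Rightarrow> 'a"  (infixr \<open>*\<^sub>C\<close> 75)
  assumes scaleR_scaleC: "scaleR r x = complex_of_real r *\<^sub>C x"
    and scaleC_add_right: "a *\<^sub>C (x + y) = a *\<^sub>C x + a *\<^sub>C y"
    and scaleC_add_left: "(a + b) *\<^sub>C x = a *\<^sub>C x + b *\<^sub>C x"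
    and scaleC_scaleC: "a *\<^sub>C b *\<^sub>C x = (a * b) *\<^sub>C x"

definition complex_subspace :: "'a::complex_vector set \<Rightarrow> bool" where
  "complex_subspace S \<longleftrightarrow>
     0 \<in> S \<and> (\<forall>x\<in>S. \<forall>y\<in>S. x + y \<in> S) \<and> (\<forall>c. \<forall>x\<in>S. c *\<^sub>C x \<in> S)"

text \<open>The inner product is linear in its first argument. Axioms such as positivity are inherited
  from \<^class>\<open>real_inner\<close>, whose inner product is the real part of the complex one.\<close>

class complex_inner = complex_vector + real_inner +
  fixes cinner :: "'a \<Rightarrow> 'a \<Rightarrow> complex"
  assumes cinner_commute: "cinner x y = cnj (cinner y x)"
    and cinner_add_left: "cinner (x + y) z = cinner x z + cinner y z"
    and cinner_scaleC_left: "cinner (c *\<^sub>C x) y = c * cinner x y"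
    and inner_eq_Re_cinner: "inner x y = Re (cinner x y)"

lemma cinner_scaleC_right: "cinner x (c *\<^sub>C y) = cnj c * cinner x (y::'a::complex_inner)"
  by (metis cinner_commute cinner_scaleC_left complex_cnj_mult)

lemma norm_scaleC: "norm (c *\<^sub>C x) = cmod c * norm (x::'a::complex_inner)"
proof -
  have "cinner (c *\<^sub>C x) (c *\<^sub>C x) = complex_of_real ((cmod c)\<^sup>2) * cinner x x"
    by (simp only: cinner_scaleC_left cinner_scaleC_right complex_norm_square mult_ac)
  then have "inner (c *\<^sub>C x) (c *\<^sub>C x) = (cmod c)\<^sup>2 * inner x x"
    by (simp only: inner_eq_Re_cinner times_complex.sel Re_complex_of_real
        Im_complex_of_real mult_zero_left diff_zero)
  then show ?thesis
    by (simp add: norm_eq_sqrt_inner real_sqrt_mult)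
qed

lemma bounded_linear_scaleC: "bounded_linear (\<lambda>x::'a::complex_inner. c *\<^sub>C x)"
proof (rule bounded_linear_intro)
  fix x y :: 'a and r :: real
  show "c *\<^sub>C (x + y) = c *\<^sub>C x + c *\<^sub>C y" by (rule scaleC_add_right)
  show "c *\<^sub>C (r *\<^sub>R x) = r *\<^sub>R (c *\<^sub>C x)"
    by (simp add: scaleR_scaleC scaleC_scaleC mult.commute)
  show "norm (c *\<^sub>C x) \<le> norm x * cmod c" by (simp add: norm_scaleC)
qed

typedef (overloaded) ('a, 'b) cblinfun (\<open>(_ \<Rightarrow>\<^sub>C\<^sub>L /_)\<close> [22, 21] 21) =
  "{f :: 'a::complex_inner \<Rightarrow> 'b::complex_inner.
      bounded_linear f \<and> (\<forall>c x. f (c *\<^sub>C x) = c *\<^sub>C f x)}"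
  morphisms cblinfun_apply CBlinfun
proof (rule exI[of _ "\<lambda>x. 0"], intro CollectI conjI allI)
  fix c and x :: 'a
  show "0 = c *\<^sub>C (0::'b)"
    using norm_scaleC[of c "0::'b"] by simp
qed (rule bounded_linear_zero)

declare [[coercion "cblinfun_apply :: ('a::complex_inner \<Rightarrow>\<^sub>C\<^sub>L 'b::complex_inner) \<Rightarrow> 'a \<Rightarrow> 'b"]]

setup_lifting type_definition_cblinfun

lemma cblinfun_eqI: "(\<And>x. cblinfun_apply S x = cblinfun_apply T x) \<Longrightarrow> S = T"
  by transfer auto

instantiation cblinfun :: (complex_inner, complex_inner) real_normed_vector
begin

lift_definition norm_cblinfun :: "'a \<Rightarrow>\<^sub>C\<^sub>L 'b \<Rightarrow> real" is onorm .

lift_definition zero_cblinfun :: "'a \<Rightarrow>\<^sub>C\<^sub>L 'b" is "\<lambda>x. 0"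
  by (metis bounded_linear_zero mult_eq_0_iff norm_eq_zero norm_scaleC)

lift_definition plus_cblinfun :: "'a \<Rightarrow>\<^sub>C\<^sub>L 'b \<Rightarrow> 'a \<Rightarrow>\<^sub>C\<^sub>L 'b \<Rightarrow> 'a \<Rightarrow>\<^sub>C\<^sub>L 'b" is "\<lambda>f g x. f x + g x"
  by (auto simp: scaleC_add_right intro: bounded_linear_add)

lift_definition scaleR_cblinfun :: "real \<Rightarrow> 'a \<Rightarrow>\<^sub>C\<^sub>L 'b \<Rightarrow> 'a \<Rightarrow>\<^sub>C\<^sub>L 'b" is "\<lambda>r f x. r *\<^sub>R f x"
  by (auto simp: scaleR_scaleC scaleC_scaleC mult.commute
      intro: bounded_linear_compose[OF bounded_linear_scaleC])

lift_definition uminus_cblinfun :: "'a \<Rightarrow>\<^sub>C\<^sub>L 'b \<Rightarrow> 'a \<Rightarrow>\<^sub>C\<^sub>L 'b" is "\<lambda>f x. - f x"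
proof (intro conjI allI)
  fix f :: "'a \<Rightarrow> 'b" and c x
  assume f: "bounded_linear f \<and> (\<forall>c x. f (c *\<^sub>C x) = c *\<^sub>C f x)"
  then show "bounded_linear (\<lambda>x. - f x)" by (simp add: bounded_linear_minus)
  show "- f (c *\<^sub>C x) = c *\<^sub>C (- f x)"
    using f by (simp add: bounded_linear.linear[OF bounded_linear_scaleC] linear_neg)
qed

definition minus_cblinfun :: "'a \<Rightarrow>\<^sub>C\<^sub>L 'b \<Rightarrow> 'a \<Rightarrow>\<^sub>C\<^sub>L 'b \<Rightarrow> 'a \<Rightarrow>\<^sub>C\<^sub>L 'b"
  where "minus_cblinfun S T = S + (- T)"

definition dist_cblinfun :: "'a \<Rightarrow>\<^sub>C\<^sub>L 'b \<Rightarrow> 'a \<Rightarrow>\<^sub>C\<^sub>L 'b \<Rightarrow> real"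
  where "dist_cblinfun S T = norm (S - T)"

definition uniformity_cblinfun :: "(('a \<Rightarrow>\<^sub>C\<^sub>L 'b) \<times> ('a \<Rightarrow>\<^sub>C\<^sub>L 'b)) filter"
  where "uniformity_cblinfun = (INF e\<in>{0 <..}. principal {(x, y). dist x y < e})"

definition open_cblinfun :: "('a \<Rightarrow>\<^sub>C\<^sub>L 'b) set \<Rightarrow> bool"
  where "open_cblinfun S = (\<forall>x\<in>S. \<forall>\<^sub>F (x', y) in uniformity. x' = x \<longrightarrow> y \<in> S)"

definition sgn_cblinfun :: "'a \<Rightarrow>\<^sub>C\<^sub>L 'b \<Rightarrow> 'a \<Rightarrow>\<^sub>C\<^sub>L 'b"
  where "sgn_cblinfun T = inverse (norm T) *\<^sub>R T"

instance
  apply standard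
  unfolding dist_cblinfun_def open_cblinfun_def sgn_cblinfun_def uniformity_cblinfun_def
    minus_cblinfun_def
  apply (rule refl | (transfer, force simp: onorm_triangle onorm_scaleR onorm_eq_0 algebra_simps))+
  done

end

instantiation cblinfun :: (complex_inner, complex_inner) complex_vector
begin

lift_definition scaleC_cblinfun :: "complex \<Rightarrow> 'a \<Rightarrow>\<^sub>C\<^sub>L 'b \<Rightarrow> 'a \<Rightarrow>\<^sub>C\<^sub>L 'b" is "\<lambda>c f x. c *\<^sub>C f x"
  by (auto simp: scaleC_scaleC mult.commute
      intro: bounded_linear_compose[OF bounded_linear_scaleC])

instance
  by standard (transfer; simp add: fun_eq_iff scaleR_scaleC scaleC_add_right scaleC_add_left
      scaleC_scaleC)+

end

lift_definition cblinfun_compose ::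
  "('b::complex_inner \<Rightarrow>\<^sub>C\<^sub>L 'c::complex_inner) \<Rightarrow> ('a::complex_inner \<Rightarrow>\<^sub>C\<^sub>L 'b) \<Rightarrow> ('a \<Rightarrow>\<^sub>C\<^sub>L 'c)"
  (infixl \<open>o\<^sub>C\<^sub>L\<close> 67) is "\<lambda>f g. f \<circ> g"
  by (auto simp: o_def intro: bounded_linear_compose)


section \<open>Weak* topology and reflexivity\<close>

definition square_summable :: "(nat \<Rightarrow> 'a::real_normed_vector) \<Rightarrow> bool" where
  "square_summable f \<longleftrightarrow> summable (\<lambda>i. (norm (f i))\<^sup>2)"

text \<open>The trace class operators from \<open>K\<close> to \<open>H\<close> are the sums \<open>C = (\<Sum>i. \<langle>\<cdot>, v i\<rangle> u i)\<close> with \<open>u\<close> and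
  \<open>v\<close> square summable, and the duality between the operator \<open>T\<close> from \<open>H\<close> to \<open>K\<close> and \<open>C\<close> is
  \<open>trace (T C) = (\<Sum>i. \<langle>T (u i), v i\<rangle>)\<close>. The weak* topology is the coarsest one making all these
  functionals of \<open>T\<close> continuous.\<close>

definition trace_pairing ::
  "('h::complex_inner \<Rightarrow>\<^sub>C\<^sub>L 'k::complex_inner) \<Rightarrow> (nat \<Rightarrow> 'h) \<Rightarrow> (nat \<Rightarrow> 'k) \<Rightarrow> complex" where
  "trace_pairing T u v = (\<Sum>i. cinner (cblinfun_apply T (u i)) (v i))"

definition weak_star_topology :: "('h::complex_inner \<Rightarrow>\<^sub>C\<^sub>L 'k::complex_inner) topology" where
  "weak_star_topology = topology_generated_by
     {{T. trace_pairing T u v \<in> G} | u v G. square_summable u \<and> square_summable v \<and> open G}"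

definition reflexive_hull ::
  "('h::complex_inner \<Rightarrow>\<^sub>C\<^sub>L 'k::complex_inner) set \<Rightarrow> ('h \<Rightarrow>\<^sub>C\<^sub>L 'k) set" where
  "reflexive_hull \<S> =
     {T. \<forall>x. cblinfun_apply T x \<in> closure ((\<lambda>S. cblinfun_apply S x) ` \<S>)}"

definition reflexive :: "('h::complex_inner \<Rightarrow>\<^sub>C\<^sub>L 'k::complex_inner) set \<Rightarrow> bool" where
  "reflexive \<S> \<longleftrightarrow> complex_subspace \<S> \<and> reflexive_hull \<S> = \<S>"

text \<open>A cluster point of a sequence is a point each of whose neighbourhoods contains infinitely
  many terms; it need not be the limit of a subsequence.\<close>

definition weak_star_limsup ::
  "(nat \<Rightarrow> ('h::complex_inner \<Rightarrow>\<^sub>C\<^sub>L 'k::complex_inner) set) \<Rightarrow> ('h \<Rightarrow>\<^sub>C\<^sub>L 'k) set" where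
  "weak_star_limsup \<M> =
     {T. \<exists>s. (\<forall>n. s n \<in> \<M> n) \<and>
         (\<forall>G. openin weak_star_topology G \<and> T \<in> G \<longrightarrow> (\<exists>\<^sub>F n in sequentially. s n \<in> G))}"


section \<open>Standard measure spaces\<close>

definition standard_measure :: "'a measure \<Rightarrow> bool" where
  "standard_measure M \<longleftrightarrow> sigma_finite_measure M \<and>
     (\<exists>\<T>. completely_metrizable_space \<T> \<and> separable_space \<T> \<and>
        space M = topspace \<T> \<and> sets M = sigma_sets (topspace \<T>) {G. openin \<T> G} \<and>
        (\<forall>E\<in>sets M.
           emeasure M E = (SUP K\<in>{K. compactin \<T> K \<and> K \<subseteq> E}. emeasure M K) \<and>
           emeasure M E = (INF G\<in>{G. openin \<T> G \<and> E \<subseteq> G}. emeasure M G)))"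

text \<open>A type of this class carries an arbitrary standard measure space, so that \<open>L\<^sup>2\<close> of it can be a
  type. The space may be a proper subset of the type, and no topology is fixed.\<close>

class standard_measure_space =
  fixes std_measure :: "'a measure"
  assumes standard_measure: "standard_measure std_measure"

definition L_infinity :: "'a measure \<Rightarrow> ('a \<Rightarrow> complex) set" where
  "L_infinity M = {a \<in> borel_measurable M. \<exists>C. AE x in M. cmod (a x) \<le> C}"


section \<open>The Hilbert space \<open>L\<^sup>2\<close>\<close>

definition square_integrable :: "('a::standard_measure_space \<Rightarrow> complex) \<Rightarrow> bool" where
  "square_integrable f \<longleftrightarrow>
     f \<in> borel_measurable std_measure \<and> integrable std_measure (\<lambda>x. (cmod (f x))\<^sup>2)"

lemma square_integrable_mult:
  assumes "square_integrable f" "square_integrable g"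
  shows "integrable std_measure (\<lambda>x. f x * g x)"
proof (rule Bochner_Integration.integrable_bound)
  show "integrable std_measure (\<lambda>x. (cmod (f x))\<^sup>2 + (cmod (g x))\<^sup>2)"
    using assms by (simp add: square_integrable_def)
  show "(\<lambda>x. f x * g x) \<in> borel_measurable std_measure"
    using assms by (auto simp: square_integrable_def)
  have "cmod (f x * g x) \<le> norm ((cmod (f x))\<^sup>2 + (cmod (g x))\<^sup>2)" for x
    using sum_squares_bound[of "cmod (f x)" "cmod (g x)"]
      mult_nonneg_nonneg[of "cmod (f x)" "cmod (g x)"]
    unfolding norm_mult real_norm_def by linarith
  then show "AE x in std_measure. cmod (f x * g x) \<le> norm ((cmod (f x))\<^sup>2 + (cmod (g x))\<^sup>2)"
    by simp
qed

lemma square_integrable_cnj: "square_integrable f \<Longrightarrow> square_integrable (\<lambda>x. cnj (f x))"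
  by (auto simp: square_integrable_def
      intro: borel_measurable_continuous_onI[THEN measurable_compose_rev] continuous_intros)

lemma square_integrable_scale: "square_integrable f \<Longrightarrow> square_integrable (\<lambda>x. c * f x)"
  by (auto simp: square_integrable_def norm_mult power_mult_distrib)

lemma square_integrable_add:
  assumes "square_integrable f" "square_integrable g"
  shows "square_integrable (\<lambda>x. f x + g x)"
proof -
  have "integrable std_measure (\<lambda>x. (cmod (f x + g x))\<^sup>2)"
  proof (rule Bochner_Integration.integrable_bound)
    show "integrable std_measure (\<lambda>x. 2 * (cmod (f x))\<^sup>2 + 2 * (cmod (g x))\<^sup>2)"
      using assms by (simp add: square_integrable_def)
    show "(\<lambda>x. (cmod (f x + g x))\<^sup>2) \<in> borel_measurable std_measure"
      using assms by (auto simp: square_integrable_def)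
    have "(cmod (f x + g x))\<^sup>2 \<le> 2 * (cmod (f x))\<^sup>2 + 2 * (cmod (g x))\<^sup>2" for x
    proof -
      have "(cmod (f x + g x))\<^sup>2 \<le> (cmod (f x) + cmod (g x))\<^sup>2"
        by (intro power_mono norm_triangle_ineq norm_ge_zero)
      also have "\<dots> \<le> 2 * (cmod (f x))\<^sup>2 + 2 * (cmod (g x))\<^sup>2"
        using sum_squares_bound[of "cmod (f x)" "cmod (g x)"] by (simp add: power2_sum)
      finally show ?thesis .
    qed
    then show "AE x in std_measure. norm ((cmod (f x + g x))\<^sup>2)
        \<le> norm (2 * (cmod (f x))\<^sup>2 + 2 * (cmod (g x))\<^sup>2)"
      by simp
  qed
  then show ?thesis using assms by (auto simp: square_integrable_def)
qed

quotient_type (overloaded) 'a l2 = "'a::standard_measure_space \<Rightarrow> complex" /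
  partial: "\<lambda>f g. square_integrable f \<and> square_integrable g \<and> (AE x in std_measure. f x = g x)"
proof (rule part_equivpI)
  have "square_integrable (\<lambda>x::'a. 0)" by (simp add: square_integrable_def)
  then show "\<exists>f::'a \<Rightarrow> complex. square_integrable f \<and> square_integrable f \<and>
      (AE x in std_measure. f x = f x)" by auto
  show "symp (\<lambda>f g. square_integrable f \<and> square_integrable g \<and> (AE x in std_measure. f x = g x))"
    by (auto simp: symp_def elim!: eventually_mono)
  show "transp (\<lambda>f g. square_integrable f \<and> square_integrable g \<and> (AE x in std_measure. f x = g x))"
    by (auto simp: transp_def elim: eventually_elim2)
qed

instantiation l2 :: (standard_measure_space) complex_inner
begin

lift_definition zero_l2 :: "'a l2" is "\<lambda>x. 0"
  by (simp add: square_integrable_def)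

lift_definition plus_l2 :: "'a l2 \<Rightarrow> 'a l2 \<Rightarrow> 'a l2" is "\<lambda>f g x. f x + g x"
  by (auto intro: square_integrable_add elim: eventually_elim2)

lift_definition scaleC_l2 :: "complex \<Rightarrow> 'a l2 \<Rightarrow> 'a l2" is "\<lambda>c f x. c * f x"
  by (auto intro: square_integrable_scale elim: eventually_mono)

lift_definition cinner_l2 :: "'a l2 \<Rightarrow> 'a l2 \<Rightarrow> complex"
  is "\<lambda>f g. \<integral>x. f x * cnj (g x) \<partial>std_measure"
proof -
  fix f f' g g' :: "'a \<Rightarrow> complex"
  assume f: "square_integrable f \<and> square_integrable f' \<and> (AE x in std_measure. f x = f' x)"
    and g: "square_integrable g \<and> square_integrable g' \<and> (AE x in std_measure. g x = g' x)"
  have "AE x in std_measure. f x * cnj (g x) = f' x * cnj (g' x)"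
    using f g by (auto elim: eventually_elim2)
  then show "(\<integral>x. f x * cnj (g x) \<partial>std_measure) = (\<integral>x. f' x * cnj (g' x) \<partial>std_measure)"
    by (intro integral_cong_AE)
      (use f g square_integrable_mult square_integrable_cnj in \<open>blast dest: borel_measurable_integrable\<close>)+
qed

definition scaleR_l2 :: "real \<Rightarrow> 'a l2 \<Rightarrow> 'a l2"
  where "scaleR_l2 r f = complex_of_real r *\<^sub>C f"

definition uminus_l2 :: "'a l2 \<Rightarrow> 'a l2"
  where "uminus_l2 f = (-1) *\<^sub>C f"

definition minus_l2 :: "'a l2 \<Rightarrow> 'a l2 \<Rightarrow> 'a l2"
  where "minus_l2 f g = f + (- g)"

definition inner_l2 :: "'a l2 \<Rightarrow> 'a l2 \<Rightarrow> real"
  where "inner_l2 f g = Re (cinner f g)"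

definition norm_l2 :: "'a l2 \<Rightarrow> real"
  where "norm_l2 f = sqrt (inner f f)"

definition sgn_l2 :: "'a l2 \<Rightarrow> 'a l2"
  where "sgn_l2 f = inverse (norm f) *\<^sub>R f"

definition dist_l2 :: "'a l2 \<Rightarrow> 'a l2 \<Rightarrow> real"
  where "dist_l2 f g = norm (f - g)"

definition uniformity_l2 :: "('a l2 \<times> 'a l2) filter"
  where "uniformity_l2 = (INF e\<in>{0 <..}. principal {(x, y). dist x y < e})"

definition open_l2 :: "'a l2 set \<Rightarrow> bool"
  where "open_l2 S = (\<forall>x\<in>S. \<forall>\<^sub>F (x', y) in uniformity. x' = x \<longrightarrow> y \<in> S)"

instance
proof
  fix f g h :: "'a l2" and a b :: complex and r s :: real
  show add_assoc: "f + g + h = f + (g + h)"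
    by transfer (auto simp: add.assoc intro!: square_integrable_add)
  show "f + g = g + f"
    by transfer (auto simp: add.commute intro!: square_integrable_add)
  show "0 + f = f" by transfer auto
  show "- f + f = 0"
    unfolding uminus_l2_def
    by transfer (auto simp: square_integrable_def intro!: square_integrable_add square_integrable_scale)
  show "f - g = f + - g" by (simp add: minus_l2_def)
  show C1: "a *\<^sub>C (f + g) = a *\<^sub>C f + a *\<^sub>C g" for a and f g :: "'a l2"
    by transfer (auto simp: distrib_left intro!: square_integrable_add square_integrable_scale)
  show C2: "(a + b) *\<^sub>C f = a *\<^sub>C f + b *\<^sub>C f" for a b and f :: "'a l2"
    by transfer (auto simp: distrib_right intro!: square_integrable_add square_integrable_scale)
  show C3: "a *\<^sub>C b *\<^sub>C f = (a * b) *\<^sub>C f" for a b and f :: "'a l2"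
    by transfer (auto simp: mult.assoc intro!: square_integrable_scale)
  show "r *\<^sub>R f = complex_of_real r *\<^sub>C f" by (simp add: scaleR_l2_def)
  show "r *\<^sub>R (f + g) = r *\<^sub>R f + r *\<^sub>R g" by (simp add: scaleR_l2_def C1)
  show "(r + s) *\<^sub>R f = r *\<^sub>R f + s *\<^sub>R f" by (simp add: scaleR_l2_def C2)
  show "r *\<^sub>R s *\<^sub>R f = (r * s) *\<^sub>R f" by (simp add: scaleR_l2_def C3)
  show "1 *\<^sub>R f = f" unfolding scaleR_l2_def by transfer auto
  show "dist f g = norm (f - g)" by (simp add: dist_l2_def)
  show "sgn f = inverse (norm f) *\<^sub>R f" by (simp add: sgn_l2_def)
  show "uniformity = (INF e\<in>{0 <..}. principal {(x, y :: 'a l2). dist x y < e})"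
    by (rule uniformity_l2_def)
  show "open S = (\<forall>x\<in>S. \<forall>\<^sub>F (x', y) in uniformity. x' = x \<longrightarrow> y \<in> S)" for S :: "'a l2 set"
    by (rule open_l2_def)
  show commute: "cinner f g = cnj (cinner g f)"
    by transfer (simp add: Bochner_Integration.integral_cnj[symmetric] mult.commute del: Bochner_Integration.integral_cnj)
  show add: "cinner (f + g) h = cinner f h + cinner g h"
    by transfer (auto simp: distrib_right square_integrable_mult square_integrable_cnj)
  show scale: "cinner (c *\<^sub>C f) g = c * cinner f g" for c
    by transfer (simp add: mult.assoc)
  show "inner f g = Re (cinner f g)" by (rule inner_l2_def)
  show "inner f g = inner g f" unfolding inner_l2_def by (subst commute) simp
  show "inner (f + g) h = inner f h + inner g h" by (simp add: inner_l2_def add)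
  show "inner (r *\<^sub>R f) g = r * inner f g" by (simp add: inner_l2_def scaleR_l2_def scale)
  have sq: "(\<integral>x. u x * cnj (u x) \<partial>std_measure) = complex_of_real (\<integral>x. (cmod (u x))\<^sup>2 \<partial>std_measure)"
    for u :: "'a \<Rightarrow> complex"
    by (simp only: complex_norm_square[symmetric] integral_complex_of_real)
  show "0 \<le> inner f f"
    unfolding inner_l2_def by transfer (simp add: sq)
  show "inner f f = 0 \<longleftrightarrow> f = 0"
    unfolding inner_l2_def
    by transfer (auto simp: sq square_integrable_def integral_nonneg_eq_0_iff_AE)
  show "norm f = sqrt (inner f f)" by (rule norm_l2_def)
qed

end

lift_definition l2_cnj :: "'a::standard_measure_space l2 \<Rightarrow> 'a l2" is "\<lambda>f x. cnj (f x)"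
  by (auto intro: square_integrable_cnj elim: eventually_mono)


section \<open>Masa-bimodules\<close>

definition multiplication_masa :: "('a::standard_measure_space l2 \<Rightarrow>\<^sub>C\<^sub>L 'a l2) set" where
  "multiplication_masa = {A. \<exists>a\<in>L_infinity std_measure. \<forall>f.
     AE x in std_measure. rep_l2 (cblinfun_apply A f) x = a x * rep_l2 f x}"

definition masa_bimodule ::
  "('a::standard_measure_space l2 \<Rightarrow>\<^sub>C\<^sub>L 'b::standard_measure_space l2) set \<Rightarrow> bool" where
  "masa_bimodule \<U> \<longleftrightarrow> complex_subspace \<U> \<and>
     (\<forall>A\<in>multiplication_masa. \<forall>B\<in>multiplication_masa. \<forall>T\<in>\<U>. B o\<^sub>C\<^sub>L T o\<^sub>C\<^sub>L A \<in> \<U>)"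


section \<open>Schur maps\<close>

text \<open>\<open>Gamma_expansion f g h\<close> says that \<open>h\<close> is almost everywhere the function
  \<open>\<Sum>i. f i \<otimes> g i\<close> in the projective tensor product of the two \<open>L\<^sup>2\<close> spaces. Hence \<open>Gamma\<close> is closed
  under equality almost everywhere with respect to the product measure.\<close>

definition Gamma_expansion :: "(nat \<Rightarrow> 'a::standard_measure_space l2) \<Rightarrow>
    (nat \<Rightarrow> 'b::standard_measure_space l2) \<Rightarrow> ('a \<times> 'b \<Rightarrow> complex) \<Rightarrow> bool" where
  "Gamma_expansion f g h \<longleftrightarrow> square_summable f \<and> square_summable g \<and>
     (AE z in std_measure \<Otimes>\<^sub>M std_measure.
        (\<lambda>i. rep_l2 (f i) (fst z) * rep_l2 (g i) (snd z)) sums h z)"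

definition Gamma ::
  "('a::standard_measure_space \<times> 'b::standard_measure_space \<Rightarrow> complex) set" where
  "Gamma = {h. \<exists>f g. Gamma_expansion f g h}"

definition schur_multiplier ::
  "('a::standard_measure_space \<times> 'b::standard_measure_space \<Rightarrow> complex) \<Rightarrow> bool" where
  "schur_multiplier \<phi> \<longleftrightarrow> \<phi> \<in> L_infinity (std_measure \<Otimes>\<^sub>M std_measure) \<and>
     (\<forall>h\<in>Gamma. (\<lambda>z. \<phi> z * h z) \<in> Gamma)"

text \<open>The duality between an operator \<open>T\<close> and \<open>h = (\<Sum>i. f i \<otimes> g i)\<close> is
  \<open>\<langle>T, h\<rangle> = (\<Sum>i. \<langle>T (f i), cnj (g i)\<rangle>)\<close>, independently of the expansion of \<open>h\<close>. The map
  \<open>\<Phi>\<close> is the dual of \<open>h \<mapsto> \<phi> h\<close> if \<open>\<langle>\<Phi> T, h\<rangle> = \<langle>T, \<phi> h\<rangle>\<close>; the condition below states this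
  for all expansions \<open>f, g\<close> of \<open>h\<close> and \<open>f', g'\<close> of \<open>\<phi> h\<close>.\<close>

definition is_schur_map_of ::
  "('a::standard_measure_space \<times> 'b::standard_measure_space \<Rightarrow> complex) \<Rightarrow>
   (('a l2 \<Rightarrow>\<^sub>C\<^sub>L 'b l2) \<Rightarrow> ('a l2 \<Rightarrow>\<^sub>C\<^sub>L 'b l2)) \<Rightarrow> bool" where
  "is_schur_map_of \<phi> \<Phi> \<longleftrightarrow> (\<forall>T h f g f' g'.
     Gamma_expansion f g h \<and> Gamma_expansion f' g' (\<lambda>z. \<phi> z * h z) \<longrightarrow>
     trace_pairing (\<Phi> T) f (\<lambda>i. l2_cnj (g i)) = trace_pairing T f' (\<lambda>i. l2_cnj (g' i)))"

definition schur_idempotent ::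
  "(('a::standard_measure_space l2 \<Rightarrow>\<^sub>C\<^sub>L 'b::standard_measure_space l2) \<Rightarrow> ('a l2 \<Rightarrow>\<^sub>C\<^sub>L 'b l2)) \<Rightarrow> bool"
  where "schur_idempotent \<Phi> \<longleftrightarrow>
     (\<exists>\<phi>. schur_multiplier \<phi> \<and> is_schur_map_of \<phi> \<Phi>) \<and> \<Phi> \<circ> \<Phi> = \<Phi>"

definition I_injective ::
  "('a::standard_measure_space l2 \<Rightarrow>\<^sub>C\<^sub>L 'b::standard_measure_space l2) set \<Rightarrow> bool" where
  "I_injective \<W> \<longleftrightarrow> (\<exists>\<Phi>. schur_idempotent \<Phi> \<and> \<W> = range \<Phi>)"

definition I_decomposable ::
  "('a::standard_measure_space l2 \<Rightarrow>\<^sub>C\<^sub>L 'b::standard_measure_space l2) set \<Rightarrow> bool" where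
  "I_decomposable \<V> \<longleftrightarrow> complex_subspace \<V> \<and> closedin weak_star_topology \<V> \<and>
     (\<exists>\<Phi> \<W>. (\<forall>n::nat. schur_idempotent (\<Phi> n)) \<and> (\<forall>n. I_injective (\<W> n)) \<and>
        (\<exists>C. \<forall>n T. norm (\<Phi> n T) \<le> C * norm T) \<and>
        (\<forall>n. \<V> \<subseteq> range (\<Phi> n) + \<W> n) \<and>
        (\<forall>n. \<W> n \<subseteq> \<V>) \<and>
        weak_star_limsup (\<lambda>n. range (\<Phi> n)) \<subseteq> \<V>)"

end

theory Submission
  imports Defs
begin

text \<open>The multiplier of a Schur idempotent takes the values 0 and 1 only and is a sum
  \<open>\<Sum>i. a i \<otimes> b i\<close> with \<open>\<Sum>i. \<bar>a i\<bar>\<^sup>2\<close> and \<open>\<Sum>i. \<bar>b i\<bar>\<^sup>2\<close> finite almost everywhere. Cutting off where the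
  tails are small and the first terms bounded, and partitioning finitely so that these terms hardly
  vary, one obtains rectangular grids exhausting the product on whose cells the idempotent \<open>\<Phi>\<close> acts
  as the identity or as 0. Hence \<open>\<Phi>\<close> leaves weak* closed masa-bimodules invariant, and
  \<open>T \<in> Ref \<S>\<close> implies \<open>T - \<Phi> T \<in> Ref ((id - \<Phi>) \<S>)\<close>.

  Let \<open>\<phi>\<^sub>n\<close> and \<open>\<psi>\<^sub>n\<close> be the idempotents decomposing \<open>\<V>\<^sub>j\<close>, with \<open>\<psi>\<^sub>n\<close> having range \<open>\<W>\<^sub>n\<close>. For \<open>T\<close> in the
  closure of \<open>\<U> + \<V>\<^sub>j\<close> the part \<open>(1 - \<psi>\<^sub>n)(1 - \<phi>\<^sub>n)T\<close> lies in \<open>\<U>\<close>. If \<open>T\<close> is in all these closures, then by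
  induction on the number of bimodules \<open>\<psi>\<^sub>n(1 - \<phi>\<^sub>n)T\<close> lies in the closure \<open>\<Z>\<close> of \<open>\<U> + \<Inter>\<^sub>j \<V>\<^sub>j\<close>, since \<open>\<psi>\<^sub>n\<close> maps
  into \<open>\<V>\<^sub>j\<close>. So \<open>T - \<phi>\<^sub>n T \<in> \<Z>\<close>, and a cluster point \<open>S \<in> \<V>\<^sub>j\<close> of the bounded sequence \<open>\<phi>\<^sub>n T\<close> satisfies
  \<open>T - S \<in> \<Z>\<close>. Repeating this for each \<open>j\<close> moves \<open>T\<close> modulo \<open>\<Z>\<close> into \<open>\<Inter>\<^sub>j \<V>\<^sub>j \<subseteq> \<Z>\<close>. The same splitting inside
  the reflexive hull yields reflexivity.\<close>

section \<open>Trace pairings and the weak* topology\<close>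

text \<open>A Schur map \<open>\<Phi>\<close> is handled through its predual: weak* continuity,
  commutation and compatibility with cutoffs are read off from the multiplication of functions, and
  the only norm bound used for such maps is the constant of the decomposition. The obstacle is that
  membership in a reflexive hull is tested at each vector \<open>x\<close> separately, by
  approximants depending on \<open>x\<close>, while \<open>\<Phi>\<close> does not act on the values
  \<open>R x\<close>. Compressions by cutoffs do act on them; hence the wish to replace
  \<open>\<Phi>\<close> on cells of a grid by the identity or by 0. The part
  \<open>(1 - \<psi>\<^sub>n)(1 - \<phi>\<^sub>n)T\<close> falls into \<open>\<U>\<close> because
  the two idempotents commute: the product then kills
  \<open>Ran \<phi>\<^sub>n + Ran \<psi>\<^sub>n\<close>, which contains
  \<open>\<V>\<^sub>j\<close>. Passing from \<open>T\<close> to a cluster point must not undo what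
  earlier indices achieved. It does not, since a weak* closed masa-bimodule containing
  \<open>T\<close> contains every \<open>\<phi>\<^sub>n T\<close> and therefore the cluster
  point.\<close>

lemma complex_vector_minus_one: "(-1) *\<^sub>C (x::'a::complex_vector) = - x"
  using scaleR_scaleC[of "-1" x] by simp

lemma complex_subspace_add: "complex_subspace S \<Longrightarrow> x \<in> S \<Longrightarrow> y \<in> S \<Longrightarrow> x + y \<in> S"
  by (simp add: complex_subspace_def)

lemma complex_subspace_0: "complex_subspace S \<Longrightarrow> 0 \<in> S"
  by (simp add: complex_subspace_def)

lemma complex_subspace_diff:
  assumes "complex_subspace S" "x \<in> S" "y \<in> S"
  shows "x - y \<in> S"
proof -
  have "x + (-1) *\<^sub>C y \<in> S" using assms by (simp add: complex_subspace_def)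
  then show ?thesis by (simp add: complex_vector_minus_one)
qed

lemma complex_subspace_sum:
  "complex_subspace S \<Longrightarrow> (\<And>i. i \<in> I \<Longrightarrow> f i \<in> S) \<Longrightarrow> sum f I \<in> S"
  by (induction I rule: infinite_finite_induct) (auto simp: complex_subspace_def)

lemma complex_subspace_plus:
  fixes S T :: "'a::complex_vector set"
  assumes "complex_subspace S" "complex_subspace T"
  shows "complex_subspace (S + T)"
  unfolding complex_subspace_def
proof (intro conjI ballI allI)
  show "0 \<in> S + T" using set_plus_intro[of 0 S 0 T] assms by (simp add: complex_subspace_def)
next
  fix x y assume "x \<in> S + T" "y \<in> S + T"
  then obtain a b c d where "x = a + b" "y = c + d" "a \<in> S" "b \<in> T" "c \<in> S" "d \<in> T"
    by (auto simp: set_plus_def)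
  then have "x + y = (a + c) + (b + d)" "a + c \<in> S" "b + d \<in> T"
    using assms by (auto simp: complex_subspace_def)
  then show "x + y \<in> S + T" by (metis set_plus_intro)
next
  fix c x assume "x \<in> S + T"
  then obtain a b where "x = a + b" "a \<in> S" "b \<in> T" by (auto simp: set_plus_def)
  then have "c *\<^sub>C x = c *\<^sub>C a + c *\<^sub>C b" "c *\<^sub>C a \<in> S" "c *\<^sub>C b \<in> T"
    using assms by (auto simp: complex_subspace_def scaleC_add_right)
  then show "c *\<^sub>C x \<in> S + T" by (metis set_plus_intro)
qed

lemma complex_subspace_INT: "(\<And>j. j \<in> J \<Longrightarrow> complex_subspace (V j)) \<Longrightarrow> complex_subspace (\<Inter>j\<in>J. V j)"
  by (auto simp: complex_subspace_def)

section \<open>Sesquilinear forms and operators\<close>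

lemma cinner_add_right: "cinner x (y + z) = cinner x y + cinner x (z::'a::complex_inner)"
  by (metis cinner_add_left cinner_commute complex_cnj_add)

lemma cinner_scaleR_left: "cinner (r *\<^sub>R x) y = r *\<^sub>R cinner x (y::'a::complex_inner)"
  by (simp add: scaleR_scaleC cinner_scaleC_left scaleR_conv_of_real)

lemma cinner_scaleR_right: "cinner x (r *\<^sub>R y) = r *\<^sub>R cinner x (y::'a::complex_inner)"
  by (simp add: scaleR_scaleC cinner_scaleC_right scaleR_conv_of_real)

text \<open>Multiplying \<open>x\<close> by a unimodular scalar turns the complex inner product into
  its modulus without changing \<open>norm x\<close>; the real Cauchy-Schwarz inequality then
  applies.\<close>

lemma norm_cinner_le: "cmod (cinner x y) \<le> norm x * norm (y::'a::complex_inner)"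
proof (cases "cinner x y = 0")
  case False
  let ?c = "cnj (sgn (cinner x y))"
  have "cinner (?c *\<^sub>C x) y = (cinner x y * cnj (cinner x y)) / complex_of_real (cmod (cinner x y))"
    by (simp add: cinner_scaleC_left sgn_eq)
  also have "\<dots> = complex_of_real (cmod (cinner x y))"
    using False by (simp add: complex_norm_square[symmetric] power2_eq_square)
  finally have "complex_of_real (cmod (cinner x y)) = cinner (?c *\<^sub>C x) y" ..
  then have "cmod (cinner x y) = inner (?c *\<^sub>C x) y"
    unfolding inner_eq_Re_cinner by (metis Re_complex_of_real)
  also have "\<dots> \<le> norm (?c *\<^sub>C x) * norm y" by (rule norm_cauchy_schwarz)
  also have "norm (?c *\<^sub>C x) = norm x" using False by (simp add: norm_scaleC norm_sgn)
  finally show ?thesis .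
qed auto

lemma bounded_bilinear_cinner: "bounded_bilinear (cinner :: 'a::complex_inner \<Rightarrow> _)"
proof
  show "\<exists>K. \<forall>a b::'a. norm (cinner a b) \<le> norm a * norm b * K"
    by (rule exI[of _ 1]) (simp add: norm_cinner_le)
qed (auto simp: cinner_add_left cinner_add_right cinner_scaleR_left cinner_scaleR_right)

lemmas tendsto_cinner = bounded_bilinear.tendsto[OF bounded_bilinear_cinner]
lemmas cinner_diff_left = bounded_bilinear.diff_left[OF bounded_bilinear_cinner]
lemmas cinner_zero_left = bounded_bilinear.zero_left[OF bounded_bilinear_cinner]
lemmas cinner_zero_right = bounded_bilinear.zero_right[OF bounded_bilinear_cinner]

lemma cinner_eqI: "(\<And>y. cinner x y = cinner x' y) \<Longrightarrow> x = (x'::'a::complex_inner)"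
proof -
  assume "\<And>y. cinner x y = cinner x' y"
  then have "inner (x - x') (x - x') = 0"
    by (simp add: inner_eq_Re_cinner cinner_diff_left)
  then show "x = x'" by simp
qed

lemma bounded_linear_cblinfun_apply: "bounded_linear (cblinfun_apply T)"
  by transfer auto

lemma cblinfun_apply_scaleC: "cblinfun_apply T (c *\<^sub>C x) = c *\<^sub>C cblinfun_apply T x"
  by transfer auto

lemmas cblinfun_apply_add = linear_add[OF bounded_linear.linear[OF bounded_linear_cblinfun_apply]]
lemmas cblinfun_apply_diff = linear_diff[OF bounded_linear.linear[OF bounded_linear_cblinfun_apply]]
lemmas cblinfun_apply_zero = linear_0[OF bounded_linear.linear[OF bounded_linear_cblinfun_apply]]

lemma norm_cblinfun: "norm (cblinfun_apply T x) \<le> norm T * norm x"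
  by transfer (auto intro: onorm)

lemma cblinfun_add_apply [simp]: "cblinfun_apply (S + T) x = cblinfun_apply S x + cblinfun_apply T x"
  by transfer simp

lemma cblinfun_zero_apply [simp]: "cblinfun_apply 0 x = 0"
  by transfer simp

lemma cblinfun_diff_apply [simp]: "cblinfun_apply (S - T) x = cblinfun_apply S x - cblinfun_apply T x"
  unfolding minus_cblinfun_def by transfer simp

lemma cblinfun_scaleC_apply [simp]: "cblinfun_apply (c *\<^sub>C T) x = c *\<^sub>C cblinfun_apply T x"
  by transfer simp

lemma cblinfun_compose_apply [simp]:
  "cblinfun_apply (S o\<^sub>C\<^sub>L T) x = cblinfun_apply S (cblinfun_apply T x)"
  by transfer simp

lemma cblinfun_sum_apply: "cblinfun_apply (sum T I) x = (\<Sum>i\<in>I. cblinfun_apply (T i) x)"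
  by (induction I rule: infinite_finite_induct) auto

lemma cblinfun_compose_add_left: "(S + S') o\<^sub>C\<^sub>L T = S o\<^sub>C\<^sub>L T + S' o\<^sub>C\<^sub>L T"
  by (rule cblinfun_eqI) simp

lemma cblinfun_compose_add_right: "T o\<^sub>C\<^sub>L (S + S') = T o\<^sub>C\<^sub>L S + T o\<^sub>C\<^sub>L S'"
  by (rule cblinfun_eqI) (simp add: cblinfun_apply_add)

lemma cblinfun_compose_diff_left: "(S - S') o\<^sub>C\<^sub>L T = S o\<^sub>C\<^sub>L T - S' o\<^sub>C\<^sub>L T"
  by (rule cblinfun_eqI) simp

lemma cblinfun_compose_diff_right: "T o\<^sub>C\<^sub>L (S - S') = T o\<^sub>C\<^sub>L S - T o\<^sub>C\<^sub>L S'"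
  by (rule cblinfun_eqI) (simp add: cblinfun_apply_diff)

lemma cblinfun_compose_sum_left: "sum S I o\<^sub>C\<^sub>L T = (\<Sum>i\<in>I. S i o\<^sub>C\<^sub>L T)"
  by (rule cblinfun_eqI) (simp add: cblinfun_sum_apply)

lemma cblinfun_compose_sum_right: "T o\<^sub>C\<^sub>L sum S I = (\<Sum>i\<in>I. T o\<^sub>C\<^sub>L S i)"
  by (rule cblinfun_eqI)
    (simp add: cblinfun_sum_apply linear_sum[OF bounded_linear.linear[OF bounded_linear_cblinfun_apply]])

section \<open>Square summable sequences and trace pairings\<close>

lemma square_summable_dominated:
  assumes "square_summable u" "\<And>i. norm (u' i) \<le> C * norm (u i)"
  shows "square_summable u'"
  unfolding square_summable_def
proof (rule summable_comparison_test)
  show "summable (\<lambda>i. C\<^sup>2 * (norm (u i))\<^sup>2)"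
    using assms(1) by (auto simp: square_summable_def intro: summable_mult)
  have "(norm (u' i))\<^sup>2 \<le> (C * norm (u i))\<^sup>2" for i
    using assms(2)[of i] by (intro power_mono) auto
  then show "\<exists>N. \<forall>n\<ge>N. norm ((norm (u' n))\<^sup>2) \<le> C\<^sup>2 * (norm (u n))\<^sup>2"
    by (simp add: power_mult_distrib)
qed

lemma square_summable_mult:
  assumes "square_summable u" "square_summable v"
  shows "summable (\<lambda>i. norm (u i) * norm (v i))"
proof (rule summable_comparison_test)
  show "summable (\<lambda>i. (norm (u i))\<^sup>2 + (norm (v i))\<^sup>2)"
    using assms by (auto simp: square_summable_def intro: summable_add)
  have "norm (u i) * norm (v i) \<le> (norm (u i))\<^sup>2 + (norm (v i))\<^sup>2" for i
    using sum_squares_bound[of "norm (u i)" "norm (v i)"]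
      mult_nonneg_nonneg[OF norm_ge_zero[of "u i"] norm_ge_zero[of "v i"]] by linarith
  then show "\<exists>N. \<forall>n\<ge>N. norm (norm (u n) * norm (v n)) \<le> (norm (u n))\<^sup>2 + (norm (v n))\<^sup>2"
    by auto
qed

text \<open>Makes each matrix coefficient \<open>cinner (T x) y\<close> a trace pairing, so that
  trace pairings separate operators.\<close>

definition single :: "'a::real_normed_vector \<Rightarrow> nat \<Rightarrow> 'a" where
  "single x i = (if i = 0 then x else 0)"

lemma square_summable_single: "square_summable (single x)"
  unfolding square_summable_def single_def
  by (rule summable_finite[of "{0}"]) auto

lemma trace_pairing_bound:
  "cmod (cinner (cblinfun_apply T x) y) \<le> norm T * (norm x * norm y)"
proof -
  have "cmod (cinner (cblinfun_apply T x) y) \<le> norm (cblinfun_apply T x) * norm y"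
    by (rule norm_cinner_le)
  also have "\<dots> \<le> (norm T * norm x) * norm y"
    by (intro mult_right_mono norm_cblinfun) auto
  finally show ?thesis by (simp add: mult.assoc)
qed

lemma summable_trace_pairing:
  assumes "square_summable u" "square_summable v"
  shows "summable (\<lambda>i. cinner (cblinfun_apply T (u i)) (v i))"
  by (rule summable_comparison_test'[OF summable_mult[OF square_summable_mult[OF assms], of "norm T"]])
    (simp add: trace_pairing_bound)

lemma trace_pairing_single: "trace_pairing T (single x) (single y) = cinner (cblinfun_apply T x) y"
proof -
  have "trace_pairing T (single x) (single y)
      = (\<Sum>i\<in>{0}. cinner (cblinfun_apply T (single x i)) (single y i))"
    unfolding trace_pairing_def
    by (rule suminf_finite) (auto simp: single_def cinner_zero_right)
  then show ?thesis by (simp add: single_def)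
qed

lemma trace_pairing_add:
  assumes "square_summable u" "square_summable v"
  shows "trace_pairing (S + T) u v = trace_pairing S u v + trace_pairing T u v"
  unfolding trace_pairing_def
  by (simp add: cinner_add_left suminf_add[OF summable_trace_pairing summable_trace_pairing] assms)

lemma trace_pairing_diff:
  assumes "square_summable u" "square_summable v"
  shows "trace_pairing (S - T) u v = trace_pairing S u v - trace_pairing T u v"
  unfolding trace_pairing_def
  by (simp add: cinner_diff_left suminf_diff[OF summable_trace_pairing summable_trace_pairing] assms)

lemma cblinfun_eq_trace_pairingI:
  assumes "\<And>u v. square_summable u \<Longrightarrow> square_summable v \<Longrightarrow> trace_pairing S u v = trace_pairing T u v"
  shows "S = T"
proof (rule cblinfun_eqI, rule cinner_eqI)
  fix x y
  show "cinner (cblinfun_apply S x) y = cinner (cblinfun_apply T x) y"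
    using assms[OF square_summable_single square_summable_single, of x y]
    by (simp add: trace_pairing_single)
qed

section \<open>Continuity and limits in the weak* topology\<close>

lemma topspace_weak_star [simp]: "topspace weak_star_topology = UNIV"
proof -
  have "T \<in> \<Union> {{T. trace_pairing T u v \<in> G} | u v G. square_summable u \<and> square_summable v \<and> open G}"
    for T :: "'a \<Rightarrow>\<^sub>C\<^sub>L 'b"
  proof (rule UnionI, rule CollectI, intro exI conjI)
    show "square_summable (single (0::'a))" "square_summable (single (0::'b))"
      by (rule square_summable_single)+
    show "T \<in> {T. trace_pairing T (single 0) (single 0) \<in> UNIV}" by simp
  qed (rule refl open_UNIV)+
  then show ?thesis
    unfolding weak_star_topology_def topology_generated_by_topspace by (intro equalityI subset_UNIV subsetI)
qed

lemma openin_weak_star_trace_pairing: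
  assumes "square_summable u" "square_summable v" "open G"
  shows "openin weak_star_topology {T. trace_pairing T u v \<in> G}"
  unfolding weak_star_topology_def
  by (rule topology_generated_by_Basis, rule CollectI, intro exI conjI) (rule refl assms)+

lemma continuous_map_weak_star_iff:
  "continuous_map X weak_star_topology f \<longleftrightarrow>
    (\<forall>u v. square_summable u \<longrightarrow> square_summable v \<longrightarrow>
      continuous_map X euclidean (\<lambda>x. trace_pairing (f x) u v))" (is "?l \<longleftrightarrow> ?r")
proof
  assume l: ?l
  show ?r
  proof (intro allI impI)
    fix u :: "nat \<Rightarrow> 'b" and v :: "nat \<Rightarrow> 'c"
    assume uv: "square_summable u" "square_summable v"
    show "continuous_map X euclidean (\<lambda>x. trace_pairing (f x) u v)"
      unfolding continuous_map_alt
    proof (intro conjI allI impI)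
      fix G :: "complex set" assume "openin euclidean G"
      then have "openin weak_star_topology {T. trace_pairing T u v \<in> G}"
        using openin_weak_star_trace_pairing[OF uv] by simp
      then have "openin X (f -` {T. trace_pairing T u v \<in> G} \<inter> topspace X)"
        using l unfolding continuous_map_alt by blast
      then show "openin X ((\<lambda>x. trace_pairing (f x) u v) -` G \<inter> topspace X)"
        by (simp add: vimage_def)
    qed auto
  qed
next
  assume r: ?r
  have S: "\<Union> {{T::'b \<Rightarrow>\<^sub>C\<^sub>L 'c. trace_pairing T u v \<in> G} | u v G.
      square_summable u \<and> square_summable v \<and> open G} = UNIV"
    using topspace_weak_star unfolding weak_star_topology_def topology_generated_by_topspace .
  show ?l unfolding weak_star_topology_def
  proof (rule continuous_on_generated_topo)
    fix U assume "U \<in> {{T::'b \<Rightarrow>\<^sub>C\<^sub>L 'c. trace_pairing T u v \<in> G} | u v G.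
      square_summable u \<and> square_summable v \<and> open G}"
    then obtain u v G where U: "U = {T. trace_pairing T u v \<in> G}" and uv: "square_summable u"
      "square_summable v" and G: "open G" by blast
    have "continuous_map X euclidean (\<lambda>x. trace_pairing (f x) u v)" using r uv by blast
    then have "openin X ((\<lambda>x. trace_pairing (f x) u v) -` G \<inter> topspace X)"
      using G by (simp add: continuous_map_alt)
    then show "openin X (f -` U \<inter> topspace X)" by (simp add: U vimage_def)
  qed (simp only: S subset_UNIV)
qed

lemma continuous_map_trace_pairing:
  "square_summable u \<Longrightarrow> square_summable v \<Longrightarrow>
    continuous_map weak_star_topology euclidean (\<lambda>T. trace_pairing T u v)"
  using continuous_map_weak_star_iff[of weak_star_topology "\<lambda>T. T"] continuous_map_id[unfolded id_def]
  by blast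

lemma limitin_weak_star_iff:
  "limitin weak_star_topology f T F \<longleftrightarrow>
    (\<forall>u v. square_summable u \<longrightarrow> square_summable v \<longrightarrow>
      ((\<lambda>n. trace_pairing (f n) u v) \<longlongrightarrow> trace_pairing T u v) F)" (is "?l \<longleftrightarrow> ?r")
proof
  assume ?l
  then have "limitin euclidean ((\<lambda>T. trace_pairing T u v) \<circ> f) (trace_pairing T u v) F"
    if "square_summable u" "square_summable v" for u v
    using continuous_map_limit[OF continuous_map_trace_pairing[OF that]] by blast
  then show ?r by (simp add: o_def)
next
  assume r: ?r
  have "eventually (\<lambda>n. f n \<in> G) F"
    if "generate_topology_on {{T. trace_pairing T u v \<in> G} |u v G.
      square_summable u \<and> square_summable v \<and> open G} G" "T \<in> G" for G
    using that
  proof induction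
    case (Int a b)
    then show ?case by (auto intro: eventually_conj)
  next
    case (UN K)
    then obtain k where "k \<in> K" "T \<in> k" by blast
    then show ?case using UN.IH[of k] by (auto elim!: eventually_mono)
  next
    case (Basis s)
    then obtain u v U where s: "s = {T. trace_pairing T u v \<in> U}"
      and uv: "square_summable u" "square_summable v" and U: "open U" by blast
    have "((\<lambda>n. trace_pairing (f n) u v) \<longlongrightarrow> trace_pairing T u v) F"
      using r uv by blast
    from topological_tendstoD[OF this U] show ?case using Basis.prems by (simp add: s)
  qed simp
  then show ?l
    unfolding limitin_def topspace_weak_star
    by (simp add: weak_star_topology_def openin_topology_generated_by_iff)
qed

abbreviation (input) weak_closed where "weak_closed \<equiv> closedin weak_star_topology"
abbreviation (input) weak_closure where "weak_closure \<equiv> (closure_of) weak_star_topology"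
abbreviation (input) weak_continuous where
  "weak_continuous \<equiv> continuous_map weak_star_topology weak_star_topology"

text \<open>The criterion asks for a pre-adjoint: every trace functional pulls back along
  \<open>L\<close> to another one. The constant \<open>c\<close> admits translations as well as
  linear maps.\<close>

lemma weak_continuousI:
  assumes "\<And>u v. square_summable u \<Longrightarrow> square_summable v \<Longrightarrow>
    \<exists>u' v' c. square_summable u' \<and> square_summable v' \<and>
      (\<forall>T. trace_pairing (L T) u v = trace_pairing T u' v' + c)"
  shows "weak_continuous L"
  unfolding continuous_map_weak_star_iff
proof (intro allI impI)
  fix u :: "nat \<Rightarrow> 'a" and v :: "nat \<Rightarrow> 'b"
  assume "square_summable u" "square_summable v"
  then obtain u' v' c where *: "square_summable u'" "square_summable v'"
    "\<And>T. trace_pairing (L T) u v = trace_pairing T u' v' + c" using assms by blast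
  show "continuous_map weak_star_topology euclidean (\<lambda>x. trace_pairing (L x) u v)"
    unfolding *(3) by (intro continuous_map_add continuous_map_trace_pairing *) auto
qed

lemma weak_continuous_diff:
  assumes "weak_continuous L" "weak_continuous M"
  shows "weak_continuous (\<lambda>T. L T - M T)"
  using assms by (auto simp: continuous_map_weak_star_iff trace_pairing_diff intro!: continuous_map_diff)

lemma weak_continuous_add_const: "weak_continuous (\<lambda>T. T + S)"
  by (rule weak_continuousI) (use trace_pairing_add in blast)

lemma weak_continuous_scaleC: "weak_continuous (\<lambda>T. c *\<^sub>C T)"
proof (rule weak_continuousI, intro exI conjI allI)
  fix u :: "nat \<Rightarrow> 'a" and v :: "nat \<Rightarrow> 'b" and T
  assume *: "square_summable u" "square_summable v"
  show "square_summable (\<lambda>i. c *\<^sub>C u i)"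
    by (rule square_summable_dominated[OF *(1), of _ "cmod c"]) (simp add: norm_scaleC)
  show "trace_pairing (c *\<^sub>C T) u v = trace_pairing T (\<lambda>i. c *\<^sub>C u i) v + 0"
    by (simp add: trace_pairing_def cblinfun_apply_scaleC)
  show "square_summable v" by fact
qed

lemma weak_closure_subsetI:
  assumes "weak_continuous L" "weak_closed Z" "\<And>T. T \<in> S \<Longrightarrow> L T \<in> Z" "T \<in> weak_closure S"
  shows "L T \<in> Z"
proof -
  have "L T \<in> weak_closure (L ` S)"
    using continuous_map_image_closure_subset[OF assms(1)] assms(4) by blast
  also have "\<dots> \<subseteq> Z" by (rule closure_of_minimal) (use assms in auto)
  finally show ?thesis .
qed

lemma weak_closure_incl: "S \<subseteq> weak_closure S"
  by (rule closure_of_subset) simp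

lemma complex_subspace_weak_closure:
  assumes S: "complex_subspace S"
  shows "complex_subspace (weak_closure S)"
proof -
  \<comment> \<open>Only translations by a fixed operator are known to be continuous, so closedness
    under addition is obtained in two rounds: one summand in \<open>S\<close> first, then both in
    the closure.\<close>
  let ?C = "weak_closure S"
  have 1: "x + y \<in> ?C" if "x \<in> ?C" "y \<in> S" for x y
    using weak_closure_subsetI[OF weak_continuous_add_const[of y], of ?C S x] that S
      weak_closure_incl[of S] by (auto simp: complex_subspace_def)
  have "x + y \<in> ?C" if "x \<in> ?C" "y \<in> ?C" for x y
    using weak_closure_subsetI[OF weak_continuous_add_const[of y], of ?C S x] that 1[of y]
    by (auto simp: add.commute)
  moreover have "c *\<^sub>C x \<in> ?C" if "x \<in> ?C" for c x
    by (rule weak_closure_subsetI[OF weak_continuous_scaleC[of c] _ _ that])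
      (use S weak_closure_incl[of S] in \<open>auto simp: complex_subspace_def\<close>)
  moreover have "0 \<in> ?C"
    using S weak_closure_incl[of S] by (auto simp: complex_subspace_def)
  ultimately show ?thesis by (auto simp: complex_subspace_def)
qed

text \<open>Tannery's theorem is dominated convergence for series. A uniform norm bound supplies the
  dominating series, so on bounded families convergence of matrix coefficients is already weak*
  convergence.\<close>

lemma tendsto_trace_pairing:
  assumes u: "square_summable u" and v: "square_summable v" and F: "F \<noteq> bot"
    and lim: "\<And>x y. ((\<lambda>n. cinner (cblinfun_apply (f n) x) y) \<longlongrightarrow> cinner (cblinfun_apply T x) y) F"
    and bound: "\<And>n. norm (f n) \<le> K"
  shows "((\<lambda>n. trace_pairing (f n) u v) \<longlongrightarrow> trace_pairing T u v) F"
  unfolding trace_pairing_def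
proof (rule tannerys_theorem[THEN conjunct2, THEN conjunct2])
  show "summable (\<lambda>i. K * (norm (u i) * norm (v i)))"
    by (intro summable_mult square_summable_mult u v)
  have "cmod (cinner (cblinfun_apply (f n) (u k)) (v k)) \<le> K * (norm (u k) * norm (v k))" for k n
    by (rule order_trans[OF trace_pairing_bound]) (intro mult_right_mono bound mult_nonneg_nonneg norm_ge_zero)
  then show "\<forall>\<^sub>F (k, n) in sequentially \<times>\<^sub>F F.
      cmod (cinner (cblinfun_apply (f n) (u k)) (v k)) \<le> K * (norm (u k) * norm (v k))"
    by (auto intro: always_eventually)
qed (fact lim F)+

lemma limitin_weak_starI:
  assumes "F \<noteq> bot" "\<And>n. norm (f n) \<le> K"
    and "\<And>x y. ((\<lambda>n. cinner (cblinfun_apply (f n) x) y) \<longlongrightarrow> cinner (cblinfun_apply T x) y) F"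
  shows "limitin weak_star_topology f T F"
  unfolding limitin_weak_star_iff using assms tendsto_trace_pairing by blast

lemma norm_cblinfun_le:
  assumes "0 \<le> K" "\<And>x. norm (cblinfun_apply T x) \<le> K * norm x"
  shows "norm T \<le> K"
  using assms by transfer (auto intro: onorm_bound)

lemma norm_cblinfun_compose: "norm (S o\<^sub>C\<^sub>L T) \<le> norm S * norm T"
  by transfer (auto intro: onorm_compose)

section \<open>Hilbert space arguments\<close>

text \<open>The representing vector is the minimiser of \<open>J y = inner y y - 2 * l y\<close>,
  found without projections onto closed subspaces. Completeness enters through a minimising
  sequence, which is Cauchy by the parallelogram law.\<close>

lemma riesz_real:
  fixes l :: "'a::{real_inner, complete_space} \<Rightarrow> real"
  assumes l: "bounded_linear l"
  shows "\<exists>z. \<forall>y. inner z y = l y"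
proof -
  interpret l: bounded_linear l by fact
  obtain K where K: "\<And>x. \<bar>l x\<bar> \<le> norm x * K" using l.bounded by auto
  define J where "J y = inner y y - 2 * l y" for y
  have low: "J y \<ge> - K\<^sup>2" for y
  proof -
    have "J y \<ge> (norm y)\<^sup>2 - 2 * (norm y * K)"
      using K[of y] by (simp add: J_def dot_square_norm abs_le_iff)
    moreover have "(norm y - K)\<^sup>2 \<ge> 0" by simp
    ultimately show ?thesis by (simp add: power2_diff)
  qed
  define m where "m = (INF y. J y)"
  have bdd: "bdd_below (range J)" using low by (auto intro!: bdd_belowI[of _ "- K\<^sup>2"])
  have m: "m \<le> J y" for y unfolding m_def by (rule cINF_lower[OF bdd]) simp
  have "\<exists>y. J y < m + 1 / Suc n" for n
  proof -
    have "(INF y. J y) < m + 1 / Suc n" unfolding m_def by simp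
    then show ?thesis using cINF_less_iff[OF _ bdd] by auto
  qed
  then obtain y where y: "\<And>n. J (y n) < m + 1 / Suc n" by metis
  \<comment> \<open>The parallelogram identity for \<open>J\<close>: the linear terms cancel, and
    the midpoint cannot lie below the infimum \<open>m\<close>.\<close>
  have par: "inner (a - b) (a - b) \<le> 2 * (J a + J b - 2 * m)" for a b
  proof -
    have "inner (a - b) (a - b) = 2 * (J a + J b - 2 * J ((1/2) *\<^sub>R (a + b)))"
      by (simp add: J_def l.scaleR l.add inner_add_left inner_add_right inner_diff_left
          inner_diff_right inner_commute[of b a] algebra_simps)
    then show ?thesis using m[of "(1/2) *\<^sub>R (a + b)"] by simp
  qed
  have "Cauchy y"
  proof (rule metric_CauchyI)
    fix e :: real assume e: "e > 0"
    obtain N where N: "inverse (of_nat (Suc N)) < e\<^sup>2 / 4"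
      using reals_Archimedean[of "e\<^sup>2 / 4"] e by auto
    have "dist (y i) (y j) < e" if "i \<ge> N" "j \<ge> N" for i j
    proof -
      have "1 / real (Suc i) \<le> 1 / real (Suc N)" "1 / real (Suc j) \<le> 1 / real (Suc N)"
        using that by (auto simp: field_simps)
      then have "J (y i) + J (y j) - 2 * m < 2 * (e\<^sup>2 / 4)"
        using y[of i] y[of j] N by (simp add: inverse_eq_divide)
      then have "(norm (y i - y j))\<^sup>2 < e\<^sup>2" using par[of "y i" "y j"] by (simp add: dot_square_norm)
      then show ?thesis using e by (simp add: dist_norm power_less_imp_less_base)
    qed
    then show "\<exists>M. \<forall>m\<ge>M. \<forall>n\<ge>M. dist (y m) (y n) < e" by blast
  qed
  then obtain z where z: "y \<longlonglongrightarrow> z" using Cauchy_convergent convergent_def by blast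
  have "(\<lambda>n. J (y n)) \<longlonglongrightarrow> J z"
    unfolding J_def by (intro tendsto_intros l.tendsto z)
  moreover have "(\<lambda>n. m + 1 / Suc n) \<longlonglongrightarrow> m + 0"
    by (intro tendsto_intros LIMSEQ_Suc[OF lim_1_over_n])
  ultimately have "J z \<le> m + 0"
    by (rule LIMSEQ_le) (use y in \<open>auto intro: less_imp_le\<close>)
  then have Jz: "J z \<le> m" by simp
  have "inner z x = l x" for x
  proof (rule ccontr)
    assume ne: "inner z x \<noteq> l x"
    define c where "c = inner z x - l x"
    define a where "a = inner x x"
    have a: "a \<ge> 0" by (simp add: a_def)
    define s where "s = a + 1" \<comment> \<open>used instead of \<open>a\<close>, which may vanish\<close>
    have s: "s > 0" "a = s - 1" using a by (simp_all add: s_def)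
    define t where "t = - c / s"
    \<comment> \<open>If the derivative \<open>2 * c\<close> of \<open>J\<close> at \<open>z\<close>
      in direction \<open>x\<close> were nonzero, a step of size \<open>t\<close> against it would
      go below the infimum.\<close>
    have "J (z + t *\<^sub>R x) = J z + (t\<^sup>2 * a + 2 * t * c)"
      by (simp add: J_def l.scaleR l.add inner_add_left inner_add_right inner_commute[of x z]
          a_def c_def algebra_simps power2_eq_square)
    then have "0 \<le> t\<^sup>2 * a + 2 * t * c" using m[of "z + t *\<^sub>R x"] Jz by simp
    also have "\<dots> = - (c\<^sup>2 * (s + 1) / s\<^sup>2)"
      using s(1) unfolding t_def s(2) by (simp add: field_simps power2_eq_square)
    also have "\<dots> < 0" using s ne by (simp add: c_def)
    finally show False by simp
  qed
  then show ?thesis by blast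
qed

text \<open>\<open>cinner\<close> is conjugate linear in its second argument, hence so is
  \<open>b\<close>. The real theorem matches the real parts, and evaluating at
  \<open>\<i> *\<^sub>C y\<close> matches the imaginary parts.\<close>

lemma riesz_complex:
  fixes b :: "'a::{complex_inner, complete_space} \<Rightarrow> complex"
  assumes add: "\<And>x y. b (x + y) = b x + b y"
    and scale: "\<And>c x. b (c *\<^sub>C x) = cnj c * b x"
    and bound: "\<And>x. cmod (b x) \<le> K * norm x"
  shows "\<exists>z. \<forall>y. cinner z y = b y"
proof -
  have "bounded_linear (\<lambda>x. Re (b x))"
  proof (rule bounded_linear_intro[where K = K])
    show "norm (Re (b x)) \<le> norm x * K" for x
      using bound[of x] abs_Re_le_cmod[of "b x"] by (simp add: mult.commute)
  qed (simp_all add: add scaleR_scaleC scale)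
  then obtain z where z: "\<And>y. inner z y = Re (b y)" using riesz_real by blast
  have "cinner z y = b y" for y
  proof (rule complex_eqI)
    show "Re (cinner z y) = Re (b y)" using z[of y] by (simp add: inner_eq_Re_cinner)
    show "Im (cinner z y) = Im (b y)"
      using z[of "\<i> *\<^sub>C y"] by (simp add: inner_eq_Re_cinner cinner_scaleC_right scale)
  qed
  then show ?thesis by blast
qed

lemma norm_le_cinnerI:
  assumes "0 \<le> K" "\<And>y. cmod (cinner z y) \<le> K * norm y"
  shows "norm (z::'a::complex_inner) \<le> K"
proof (cases "z = 0")
  case False
  have "norm z * norm z = inner z z"
    using dot_square_norm[of z] by (simp add: power2_eq_square)
  also have "\<dots> \<le> cmod (cinner z z)" unfolding inner_eq_Re_cinner by (rule complex_Re_le_cmod)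
  also have "\<dots> \<le> K * norm z" by (rule assms)
  finally show ?thesis using False by simp
qed (use assms in auto)

text \<open>The adjoint is kept as a plain function with a norm bound; the bound is what carries
  square summable sequences to square summable ones.\<close>

lemma ex_adjoint:
  fixes B :: "'a::{complex_inner, complete_space} \<Rightarrow>\<^sub>C\<^sub>L 'b::complex_inner"
  shows "\<exists>A. \<forall>x y. cinner (cblinfun_apply B x) y = cinner x (A y) \<and> norm (A y) \<le> norm B * norm y"
proof -
  have "\<exists>z. \<forall>x. cinner z x = cinner y (cblinfun_apply B x)" for y
  proof (rule riesz_complex[where K = "norm B * norm y"])
    show "cmod (cinner y (cblinfun_apply B x)) \<le> norm B * norm y * norm x" for x
      using trace_pairing_bound[of B x y]
      by (subst cinner_commute) (simp add: mult_ac)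
  qed (simp_all add: cblinfun_apply_add cinner_add_right cblinfun_apply_scaleC cinner_scaleC_right)
  then obtain A where A: "\<And>x y. cinner (A y) x = cinner y (cblinfun_apply B x)" by metis
  have "norm (A y) \<le> norm B * norm y" for y
  proof (rule norm_le_cinnerI)
    show "cmod (cinner (A y) x) \<le> norm B * norm y * norm x" for x
      unfolding A using trace_pairing_bound[of B x y]
      by (subst cinner_commute) (simp add: mult_ac)
  qed simp
  then show ?thesis using A by (metis cinner_commute)
qed

text \<open>The pre-adjoint sends the pair \<open>u\<close>, \<open>v\<close> to \<open>A u\<close>
  and the adjoint of \<open>B\<close> applied to \<open>v\<close>.\<close>

lemma weak_continuous_compose:
  fixes B :: "'b::{complex_inner, complete_space} \<Rightarrow>\<^sub>C\<^sub>L 'c::complex_inner"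
    and A :: "'d::complex_inner \<Rightarrow>\<^sub>C\<^sub>L 'a::complex_inner"
  shows "weak_continuous (\<lambda>T. B o\<^sub>C\<^sub>L T o\<^sub>C\<^sub>L A)"
proof (rule weak_continuousI)
  fix u :: "nat \<Rightarrow> 'd" and v :: "nat \<Rightarrow> 'c"
  assume u: "square_summable u" and v: "square_summable v"
  obtain B' where B': "\<And>x y. cinner (cblinfun_apply B x) y = cinner x (B' y)"
    "\<And>y. norm (B' y) \<le> norm B * norm y" using ex_adjoint[of B] by blast
  have "square_summable (\<lambda>i. cblinfun_apply A (u i))"
    by (rule square_summable_dominated[OF u]) (rule norm_cblinfun)
  moreover have "square_summable (\<lambda>i. B' (v i))"
    by (rule square_summable_dominated[OF v]) (rule B')
  moreover have "trace_pairing (B o\<^sub>C\<^sub>L T o\<^sub>C\<^sub>L A) u v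
      = trace_pairing T (\<lambda>i. cblinfun_apply A (u i)) (\<lambda>i. B' (v i)) + 0" for T
    by (simp add: trace_pairing_def B')
  ultimately show "\<exists>u' v' c. square_summable u' \<and> square_summable v' \<and>
      (\<forall>T. trace_pairing (B o\<^sub>C\<^sub>L T o\<^sub>C\<^sub>L A) u v = trace_pairing T u' v' + c)" by blast
qed

text \<open>By Tychonoff's theorem the sequence has a cluster point \<open>l\<close> in a product of
  closed discs. Joining the pulled back neighbourhoods of \<open>l\<close> to
  \<open>sequentially\<close> gives one proper filter along which all coordinates converge
  simultaneously.\<close>

lemma ex_cluster_filter:
  fixes b :: "nat \<Rightarrow> 'i \<Rightarrow> complex"
  assumes bound: "\<And>n i. cmod (b n i) \<le> K i"
  shows "\<exists>F l. F \<noteq> bot \<and> F \<le> sequentially \<and> (\<forall>i. ((\<lambda>n. b n i) \<longlongrightarrow> l i) F)"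
proof -
  let ?U = "PiE UNIV (\<lambda>i. cball (0::complex) (K i))"
  have "compact ?U"
    using compactin_PiE[of "\<lambda>_. euclidean" UNIV "\<lambda>i. cball (0::complex) (K i)"]
    by (simp add: euclidean_product_topology)
  moreover have "eventually (\<lambda>x. x \<in> ?U) (filtermap b sequentially)"
    using bound by (auto simp: eventually_filtermap PiE_UNIV_domain)
  moreover have "filtermap b sequentially \<noteq> bot" by (simp add: filtermap_bot_iff)
  ultimately obtain l where l: "inf (nhds l) (filtermap b sequentially) \<noteq> bot"
    unfolding compact_filter by blast
  define F where "F = inf sequentially (filtercomap b (nhds l))"
  have "F \<noteq> bot"
  proof
    assume "F = bot"
    then have "eventually (\<lambda>_. False) F" by simp
    then obtain P Q where P: "eventually P sequentially" and Q: "eventually Q (nhds l)"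
      and PQ: "\<And>n. P n \<Longrightarrow> Q (b n) \<Longrightarrow> False"
      unfolding F_def eventually_inf eventually_filtercomap by blast
    have "eventually (\<lambda>x. \<not> Q x) (filtermap b sequentially)"
      unfolding eventually_filtermap by (rule eventually_mono[OF P]) (use PQ in blast)
    with Q have "eventually (\<lambda>_. False) (inf (nhds l) (filtermap b sequentially))"
      unfolding eventually_inf by blast
    with l show False by (simp add: eventually_False)
  qed
  moreover have "F \<le> sequentially" by (simp add: F_def)
  moreover have "((\<lambda>n. b n i) \<longlongrightarrow> l i) F" for i
  proof (rule continuous_on_tendsto_compose[of UNIV "\<lambda>f. f i" b l F])
    show "filterlim b (nhds l) F" by (simp add: F_def filterlim_iff_le_filtercomap)
  qed auto
  ultimately show ?thesis by blast
qed

text \<open>Norm balls are weak* compact but no separability is available here, so the cluster point is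
  the limit along a filter finer than \<^term>\<open>sequentially\<close>.\<close>

lemma bounded_sequence_weak_cluster:
  fixes T :: "nat \<Rightarrow> 'h::complex_inner \<Rightarrow>\<^sub>C\<^sub>L 'k::{complex_inner, complete_space}"
  assumes bound: "\<And>n. norm (T n) \<le> K"
  shows "\<exists>F S. F \<noteq> bot \<and> F \<le> sequentially \<and> limitin weak_star_topology T S F"
proof -
  let ?b = "\<lambda>n (x, y). cinner (cblinfun_apply (T n) x) y"
  have K: "K \<ge> 0" using bound[of 0] norm_ge_zero order_trans by blast
  have bd: "cmod (?b n p) \<le> K * (norm (fst p) * norm (snd p))" for n p
  proof -
    have "cmod (?b n p) \<le> norm (T n) * (norm (fst p) * norm (snd p))"
      by (simp add: case_prod_beta trace_pairing_bound)
    also have "\<dots> \<le> K * (norm (fst p) * norm (snd p))"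
      by (intro mult_right_mono bound mult_nonneg_nonneg norm_ge_zero)
    finally show ?thesis .
  qed
  obtain F l where F: "F \<noteq> bot" "F \<le> sequentially"
    and lim0: "\<And>i. ((\<lambda>n. ?b n i) \<longlongrightarrow> l i) F"
    using ex_cluster_filter[of ?b "\<lambda>p. K * (norm (fst p) * norm (snd p))"] bd by blast
  have lim: "((\<lambda>n. cinner (cblinfun_apply (T n) x) y) \<longlongrightarrow> l (x, y)) F" for x y
    using lim0[of "(x, y)"] by simp
  have uniq: "a = b" if "((\<lambda>n. f n) \<longlongrightarrow> a) F" "((\<lambda>n. f n) \<longlongrightarrow> b) F" for f :: "nat \<Rightarrow> complex" and a b
    using tendsto_unique[OF F(1)] that by blast
  have l_add_right: "l (x, y + y') = l (x, y) + l (x, y')" for x y y'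
    by (rule uniq[OF lim]) (unfold cinner_add_right, intro tendsto_add lim)
  have l_scale_right: "l (x, c *\<^sub>C y) = cnj c * l (x, y)" for x y c
    by (rule uniq[OF lim]) (unfold cinner_scaleC_right, intro tendsto_mult tendsto_const lim)
  have l_add_left: "l (x + x', y) = l (x, y) + l (x', y)" for x x' y
    by (rule uniq[OF lim]) (unfold cblinfun_apply_add cinner_add_left, intro tendsto_add lim)
  have l_scale_left: "l (c *\<^sub>C x, y) = c * l (x, y)" for x y c
    by (rule uniq[OF lim])
      (unfold cblinfun_apply_scaleC cinner_scaleC_left, intro tendsto_mult tendsto_const lim)
  have l_bound: "cmod (l (x, y)) \<le> K * norm x * norm y" for x y
    by (rule tendsto_upperbound[OF tendsto_norm[OF lim] always_eventually F(1)])
      (use bd[of _ "(x, y)"] in \<open>auto simp: mult_ac\<close>)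
  \<comment> \<open>The limit of the matrix coefficients is a bounded sesquilinear form; Riesz
    representation in the second variable turns it into an operator.\<close>
  have "\<exists>z. \<forall>y. cinner z y = l (x, y)" for x
    by (rule riesz_complex[OF l_add_right l_scale_right l_bound])
  then obtain t where t: "\<And>x y. cinner (t x) y = l (x, y)" by metis
  have t_add: "t (x + y) = t x + t y" for x y
    by (rule cinner_eqI) (simp add: t cinner_add_left l_add_left)
  have t_scale: "t (c *\<^sub>C x) = c *\<^sub>C t x" for c x
    by (rule cinner_eqI) (simp add: t cinner_scaleC_left l_scale_left)
  have "norm (t x) \<le> norm x * K" for x
  proof (rule norm_le_cinnerI)
    show "cmod (cinner (t x) y) \<le> norm x * K * norm y" for y
      using l_bound[of x y] by (simp add: t mult_ac)
  qed (use K in simp)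
  then have "bounded_linear t"
    by (intro bounded_linear_intro[where K = K]) (auto simp: t_add scaleR_scaleC t_scale)
  then have "cblinfun_apply (CBlinfun t) = t"
    by (intro CBlinfun_inverse) (auto simp: t_scale)
  then have "limitin weak_star_topology T (CBlinfun t) F"
    by (intro limitin_weak_starI[OF F(1) bound]) (simp add: t lim)
  with F show ?thesis by blast
qed

text \<open>Since \<open>Q n\<close> is selfadjoint it can be moved to the other side of the inner
  product. Each matrix coefficient is then that of the fixed operator \<open>T\<close> at two
  vectors converging in norm.\<close>

lemma limitin_weak_star_compose:
  fixes T :: "'h::complex_inner \<Rightarrow>\<^sub>C\<^sub>L 'k::complex_inner"
  assumes P: "\<And>n. norm (P n) \<le> 1" "\<And>x. (\<lambda>n. cblinfun_apply (P n) x) \<longlonglongrightarrow> x"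
    and Q: "\<And>n. norm (Q n) \<le> 1" "\<And>x. (\<lambda>n. cblinfun_apply (Q n) x) \<longlonglongrightarrow> x"
    and Q_adj: "\<And>n x y. cinner (cblinfun_apply (Q n) x) y = cinner x (cblinfun_apply (Q n) y)"
  shows "limitin weak_star_topology (\<lambda>n. Q n o\<^sub>C\<^sub>L T o\<^sub>C\<^sub>L P n) T sequentially"
proof (rule limitin_weak_starI)
  fix n
  have "norm (Q n o\<^sub>C\<^sub>L T o\<^sub>C\<^sub>L P n) \<le> norm (Q n) * norm T * norm (P n)"
    by (meson norm_cblinfun_compose order_trans mult_right_mono norm_ge_zero)
  also have "\<dots> \<le> 1 * norm T * 1"
    by (intro mult_mono P Q) auto
  finally show "norm (Q n o\<^sub>C\<^sub>L T o\<^sub>C\<^sub>L P n) \<le> norm T" by simp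
next
  fix x y
  show "(\<lambda>n. cinner (cblinfun_apply (Q n o\<^sub>C\<^sub>L T o\<^sub>C\<^sub>L P n) x) y) \<longlonglongrightarrow> cinner (cblinfun_apply T x) y"
    by (simp add: Q_adj)
      (intro tendsto_cinner bounded_linear.tendsto[OF bounded_linear_cblinfun_apply] P Q)
qed simp

section \<open>The space \<open>L\<^sup>2\<close>\<close>

lemma square_integrable_rep_l2: "square_integrable (rep_l2 f)"
  using Quotient_rep_reflp[OF Quotient_l2, of f] by simp

lemma rep_abs_l2: "square_integrable f \<Longrightarrow> AE x in std_measure. rep_l2 (abs_l2 f) x = f x"
  using Quotient_rep_abs[OF Quotient_l2, of f] by simp

lemma abs_rep_l2: "abs_l2 (rep_l2 f) = f"
  by (rule Quotient_abs_rep[OF Quotient_l2])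

lemma abs_l2_cong:
  assumes "square_integrable f" "square_integrable g" "AE x in std_measure. f x = g x"
  shows "abs_l2 f = abs_l2 g"
  using Quotient_rel_abs[OF Quotient_l2, of f g] assms by simp

lemma l2_eqI: "AE x in std_measure. rep_l2 f x = rep_l2 g x \<Longrightarrow> f = g"
  using abs_l2_cong[OF square_integrable_rep_l2 square_integrable_rep_l2, of f g] by (simp add: abs_rep_l2)

lemma measurable_rep_l2 [measurable]: "rep_l2 f \<in> borel_measurable std_measure"
  using square_integrable_rep_l2[of f] by (simp add: square_integrable_def)

lemma integrable_rep_l2: "integrable std_measure (\<lambda>x. (cmod (rep_l2 f x))\<^sup>2)"
  using square_integrable_rep_l2[of f] by (simp add: square_integrable_def)

lemma rep_l2_plus: "AE x in std_measure. rep_l2 (f + g) x = rep_l2 f x + rep_l2 g x"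
proof -
  have "f + g = abs_l2 (\<lambda>x. rep_l2 f x + rep_l2 g x)"
    using plus_l2.abs_eq[of "rep_l2 f" "rep_l2 g"]
    by (simp add: abs_rep_l2 square_integrable_rep_l2 eq_onp_def)
  then show ?thesis
    using rep_abs_l2 square_integrable_add square_integrable_rep_l2 by metis
qed

lemma rep_l2_scaleC: "AE x in std_measure. rep_l2 (c *\<^sub>C f) x = c * rep_l2 f x"
proof -
  have "c *\<^sub>C f = abs_l2 (\<lambda>x. c * rep_l2 f x)"
    using scaleC_l2.abs_eq[of "rep_l2 f" c]
    by (simp add: abs_rep_l2 square_integrable_rep_l2)
  then show ?thesis
    using rep_abs_l2 square_integrable_scale square_integrable_rep_l2 by metis
qed

lemma rep_l2_zero: "AE x in std_measure. rep_l2 0 x = 0"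
  unfolding zero_l2_def by (rule rep_abs_l2) (simp add: square_integrable_def)

lemma rep_l2_diff: "AE x in std_measure. rep_l2 (f - g) x = rep_l2 f x - rep_l2 g x"
proof -
  have eq: "f - g = f + (-1) *\<^sub>C g" by (simp add: complex_vector_minus_one)
  show ?thesis
    unfolding eq using rep_l2_plus[of f "(-1) *\<^sub>C g"] rep_l2_scaleC[of "-1" g]
    by eventually_elim simp
qed

lemma rep_l2_cnj: "AE x in std_measure. rep_l2 (l2_cnj f) x = cnj (rep_l2 f x)"
proof -
  have "l2_cnj f = abs_l2 (\<lambda>x. cnj (rep_l2 f x))"
    using l2_cnj.abs_eq[of "rep_l2 f"]
    by (simp add: abs_rep_l2 square_integrable_rep_l2)
  then show ?thesis
    using rep_abs_l2 square_integrable_cnj square_integrable_rep_l2 by metis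
qed

lemma cinner_l2: "cinner f g = (\<integral>x. rep_l2 f x * cnj (rep_l2 g x) \<partial>std_measure)"
  using cinner_l2.abs_eq[of "rep_l2 f" "rep_l2 g"]
  by (simp add: abs_rep_l2 square_integrable_rep_l2)

lemma norm_l2_square: "(norm f)\<^sup>2 = (\<integral>x. (cmod (rep_l2 f x))\<^sup>2 \<partial>std_measure)"
proof -
  have "cinner f f = complex_of_real (\<integral>x. (cmod (rep_l2 f x))\<^sup>2 \<partial>std_measure)"
    unfolding cinner_l2 by (simp only: complex_norm_square[symmetric] integral_complex_of_real)
  then show ?thesis by (simp add: power2_norm_eq_inner inner_eq_Re_cinner)
qed

lemma nn_integral_rep_l2:
  "(\<integral>\<^sup>+x. ennreal ((cmod (rep_l2 f x))\<^sup>2) \<partial>std_measure) = ennreal ((norm f)\<^sup>2)"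
  unfolding norm_l2_square by (rule nn_integral_eq_integral[OF integrable_rep_l2]) simp

lemma norm_l2_leI:
  assumes "0 \<le> C" "AE x in std_measure. cmod (rep_l2 f x) \<le> C * cmod (rep_l2 g x)"
  shows "norm f \<le> C * norm g"
proof -
  have "(norm f)\<^sup>2 \<le> (\<integral>x. C\<^sup>2 * (cmod (rep_l2 g x))\<^sup>2 \<partial>std_measure)"
    unfolding norm_l2_square
  proof (rule integral_mono_AE)
    show "AE x in std_measure. (cmod (rep_l2 f x))\<^sup>2 \<le> C\<^sup>2 * (cmod (rep_l2 g x))\<^sup>2"
      using assms(2) by eventually_elim (metis norm_ge_zero power_mono power_mult_distrib)
  qed (auto intro: integrable_rep_l2)
  also have "\<dots> = (C * norm g)\<^sup>2" by (simp add: norm_l2_square power_mult_distrib)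
  finally show ?thesis by (rule power2_le_imp_le) (simp add: assms(1))
qed

lemma norm_l2_cnj: "norm (l2_cnj f) = norm f"
proof -
  have "(\<integral>x. (cmod (rep_l2 (l2_cnj f) x))\<^sup>2 \<partial>std_measure) = (\<integral>x. (cmod (rep_l2 f x))\<^sup>2 \<partial>std_measure)"
  proof (rule integral_cong_AE)
    show "AE x in std_measure. (cmod (rep_l2 (l2_cnj f) x))\<^sup>2 = (cmod (rep_l2 f x))\<^sup>2"
      using rep_l2_cnj[of f] by eventually_elim simp
  qed measurable
  then show ?thesis by (simp add: norm_l2_square[symmetric])
qed

lemma l2_cnj_cnj: "l2_cnj (l2_cnj f) = f"
proof (rule l2_eqI)
  show "AE x in std_measure. rep_l2 (l2_cnj (l2_cnj f)) x = rep_l2 f x"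
    using rep_l2_cnj[of f] rep_l2_cnj[of "l2_cnj f"] by eventually_elim simp
qed

lemma square_summable_l2_cnj: "square_summable f \<Longrightarrow> square_summable (\<lambda>i. l2_cnj (f i))"
  by (simp add: square_summable_def norm_l2_cnj)

section \<open>Pointwise summability and completeness\<close>

lemma AE_summable:
  fixes f :: "nat \<Rightarrow> 'a \<Rightarrow> real"
  assumes f: "\<And>i. integrable M (f i)" "\<And>i x. 0 \<le> f i x" and s: "summable (\<lambda>i. integral\<^sup>L M (f i))"
  shows "AE x in M. summable (\<lambda>i. f i x)"
proof -
  have [measurable]: "f i \<in> borel_measurable M" for i using f by auto
  have "(\<integral>\<^sup>+x. (\<Sum>i. ennreal (f i x)) \<partial>M) = (\<Sum>i. \<integral>\<^sup>+x. ennreal (f i x) \<partial>M)"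
    by (intro nn_integral_suminf) auto
  also have "\<dots> = (\<Sum>i. ennreal (integral\<^sup>L M (f i)))"
    using f by (simp add: nn_integral_eq_integral)
  also have "\<dots> = ennreal (\<Sum>i. integral\<^sup>L M (f i))"
    by (intro suminf_ennreal2 s integral_nonneg_AE) (simp add: f)
  finally have "(\<integral>\<^sup>+x. (\<Sum>i. ennreal (f i x)) \<partial>M) \<noteq> \<infinity>" by simp
  then have "AE x in M. (\<Sum>i. ennreal (f i x)) \<noteq> \<infinity>"
    by (intro nn_integral_PInf_AE) auto
  then show ?thesis
    by eventually_elim (auto intro: summable_suminf_not_top f(2))
qed

lemma AE_summable_square_rep_l2:
  assumes "square_summable f"
  shows "AE x in std_measure. summable (\<lambda>i. (cmod (rep_l2 (f i) x))\<^sup>2)"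
  using assms by (intro AE_summable integrable_rep_l2) (auto simp: square_summable_def norm_l2_square)

text \<open>The factor \<open>sqrt 2 ^ k\<close> leaves the increments square summable in norm while forcing their
  representatives to decay geometrically almost everywhere.\<close>

lemma l2_subsequence_limit:
  fixes Y :: "nat \<Rightarrow> 'a::standard_measure_space l2"
  assumes Y: "Cauchy Y" and fast: "\<And>k. norm (Y (Suc k) - Y k) < (1/2) ^ k"
  shows "convergent Y"
proof -
  define d where "d k = (sqrt 2 ^ k) *\<^sub>R (Y (Suc k) - Y k)" for k
  have "square_summable d"
    unfolding square_summable_def
  proof (rule summable_comparison_test')
    show "summable (\<lambda>k. (1/2::real) ^ k)" by (rule summable_geometric) simp
    show "norm ((norm (d k))\<^sup>2) \<le> (1/2) ^ k" if "0 \<le> k" for k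
    proof -
      have "(sqrt 2 ^ k)\<^sup>2 = 2 ^ k"
        by (metis power_mult mult.commute real_sqrt_pow2 zero_le_numeral)
      then have "(norm (d k))\<^sup>2 = 2 ^ k * (norm (Y (Suc k) - Y k))\<^sup>2"
        by (simp add: d_def power_mult_distrib)
      also have "\<dots> \<le> 2 ^ k * ((1/2) ^ k)\<^sup>2"
        using fast[of k] by (intro mult_left_mono power_mono) auto
      also have "\<dots> = (1/2) ^ k" by (simp add: power2_eq_square power_divide)
      finally show ?thesis by simp
    qed
  qed
  then have AEd: "AE x in std_measure. summable (\<lambda>i. (cmod (rep_l2 (d i) x))\<^sup>2)"
    by (rule AE_summable_square_rep_l2)
  have "AE x in std_measure. rep_l2 (d k) x = (sqrt 2 ^ k) * (rep_l2 (Y (Suc k)) x - rep_l2 (Y k) x)" for k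
    using rep_l2_scaleC[of "complex_of_real (sqrt 2 ^ k)" "Y (Suc k) - Y k"]
      rep_l2_diff[of "Y (Suc k)" "Y k"]
    unfolding d_def scaleR_scaleC by eventually_elim simp
  then have AEk: "AE x in std_measure. \<forall>k. rep_l2 (d k) x = (sqrt 2 ^ k) * (rep_l2 (Y (Suc k)) x - rep_l2 (Y k) x)"
    by (simp add: AE_all_countable)
  have conv: "AE x in std_measure. convergent (\<lambda>k. rep_l2 (Y k) x)"
    using AEd AEk
  proof eventually_elim
    case (elim x)
    have "(\<lambda>i. (cmod (rep_l2 (d i) x))\<^sup>2) \<longlonglongrightarrow> 0" using elim(1) by (rule summable_LIMSEQ_zero)
    then have "Bseq (\<lambda>i. (cmod (rep_l2 (d i) x))\<^sup>2)" by (intro convergent_imp_Bseq convergentI)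
    then obtain C where C: "C > 0" "\<And>i. (cmod (rep_l2 (d i) x))\<^sup>2 \<le> C"
      by (auto simp: Bseq_def)
    \<comment> \<open>Square summability bounds the values of \<open>d\<close> at \<open>x\<close>;
      undoing the weights \<open>sqrt 2 ^ k\<close> makes this a geometric bound on the
      increments.\<close>
    have "summable (\<lambda>k. rep_l2 (Y (Suc k)) x - rep_l2 (Y k) x)"
    proof (rule summable_comparison_test')
      show "summable (\<lambda>k. sqrt C * (1 / sqrt 2) ^ k)"
        by (intro summable_mult summable_geometric) simp
      show "norm (rep_l2 (Y (Suc k)) x - rep_l2 (Y k) x) \<le> sqrt C * (1 / sqrt 2) ^ k" if "0 \<le> k" for k
      proof -
        have "cmod (rep_l2 (d k) x) \<le> sqrt C" using C(2)[of k] by (rule real_le_rsqrt)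
        moreover have "cmod (rep_l2 (d k) x) = sqrt 2 ^ k * cmod (rep_l2 (Y (Suc k)) x - rep_l2 (Y k) x)"
          using elim(2) by (simp add: norm_mult norm_power)
        ultimately show ?thesis by (simp add: field_simps power_divide)
      qed
    qed
    then have "convergent (\<lambda>n. \<Sum>k<n. rep_l2 (Y (Suc k)) x - rep_l2 (Y k) x)"
      by (simp add: summable_iff_convergent)
    then have "convergent (\<lambda>n. rep_l2 (Y n) x - rep_l2 (Y 0) x)"
      by (simp only: sum_lessThan_telescope[of "\<lambda>k. rep_l2 (Y k) x"])
    from convergent_add[OF this convergent_const[of "rep_l2 (Y 0) x"]]
    show ?case by simp
  qed
  \<comment> \<open>Where the values diverge, \<open>lim\<close> is an arbitrary value; this occurs
    on a null set only.\<close>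
  define g where "g x = lim (\<lambda>k. rep_l2 (Y k) x)" for x
  have [measurable]: "g \<in> borel_measurable std_measure"
    unfolding g_def by measurable
  have g: "AE x in std_measure. (\<lambda>k. rep_l2 (Y k) x) \<longlonglongrightarrow> g x"
    using conv by eventually_elim (simp add: g_def convergent_LIMSEQ_iff)
  \<comment> \<open>Fatou's lemma bounds the distance from \<open>g\<close> to \<open>Y k\<close>
    before \<open>g\<close> is known to be square integrable, and the same estimate later gives norm
    convergence.\<close>
  have key: "(\<integral>\<^sup>+x. ennreal ((cmod (g x - rep_l2 (Y k) x))\<^sup>2) \<partial>std_measure) \<le> ennreal (e\<^sup>2)"
    if e: "\<And>j. j \<ge> k \<Longrightarrow> norm (Y j - Y k) \<le> e" for e k
  proof -
    have "(\<integral>\<^sup>+x. ennreal ((cmod (g x - rep_l2 (Y k) x))\<^sup>2) \<partial>std_measure)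
        = (\<integral>\<^sup>+x. liminf (\<lambda>j. ennreal ((cmod (rep_l2 (Y j) x - rep_l2 (Y k) x))\<^sup>2)) \<partial>std_measure)"
    proof (rule nn_integral_cong_AE)
      show "AE x in std_measure. ennreal ((cmod (g x - rep_l2 (Y k) x))\<^sup>2)
          = liminf (\<lambda>j. ennreal ((cmod (rep_l2 (Y j) x - rep_l2 (Y k) x))\<^sup>2))"
        using g
      proof eventually_elim
        case (elim x)
        have "(\<lambda>j. ennreal ((cmod (rep_l2 (Y j) x - rep_l2 (Y k) x))\<^sup>2))
            \<longlonglongrightarrow> ennreal ((cmod (g x - rep_l2 (Y k) x))\<^sup>2)"
          by (intro tendsto_ennrealI tendsto_intros elim)
        from lim_imp_Liminf[OF sequentially_bot this] show ?case by (rule sym)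
      qed
    qed
    also have "\<dots> \<le> liminf (\<lambda>j. \<integral>\<^sup>+x. ennreal ((cmod (rep_l2 (Y j) x - rep_l2 (Y k) x))\<^sup>2) \<partial>std_measure)"
      by (rule nn_integral_liminf) measurable
    also have "\<dots> = liminf (\<lambda>j. ennreal ((norm (Y j - Y k))\<^sup>2))"
    proof -
      have "(\<integral>\<^sup>+x. ennreal ((cmod (rep_l2 (Y j) x - rep_l2 (Y k) x))\<^sup>2) \<partial>std_measure)
          = ennreal ((norm (Y j - Y k))\<^sup>2)" for j
      proof -
        have "AE x in std_measure. ennreal ((cmod (rep_l2 (Y j) x - rep_l2 (Y k) x))\<^sup>2)
            = ennreal ((cmod (rep_l2 (Y j - Y k) x))\<^sup>2)"
          using rep_l2_diff[of "Y j" "Y k"] by eventually_elim simp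
        then show ?thesis by (simp only: nn_integral_rep_l2[symmetric] nn_integral_cong_AE)
      qed
      then show ?thesis by simp
    qed
    also have "\<dots> \<le> ennreal (e\<^sup>2)"
    proof -
      have "eventually (\<lambda>j. ennreal ((norm (Y j - Y k))\<^sup>2) \<le> ennreal (e\<^sup>2)) sequentially"
        using e by (intro eventually_sequentiallyI[of k] ennreal_leI power_mono) auto
      then have "liminf (\<lambda>j. ennreal ((norm (Y j - Y k))\<^sup>2)) \<le> liminf (\<lambda>j. ennreal (e\<^sup>2))"
        by (rule Liminf_mono)
      then show ?thesis by (simp add: Liminf_const)
    qed
    finally show ?thesis .
  qed
  have sq: "square_integrable (\<lambda>x. g x - rep_l2 (Y k) x)"
    if e: "\<And>j. j \<ge> k \<Longrightarrow> norm (Y j - Y k) \<le> e" for e k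
    unfolding square_integrable_def
  proof (intro conjI integrableI_bounded)
    show "(\<integral>\<^sup>+x. ennreal (norm ((cmod (g x - rep_l2 (Y k) x))\<^sup>2)) \<partial>std_measure) < \<infinity>"
      using key[OF e] by (simp add: le_less_trans)
  qed measurable
  have ev: "\<exists>k0. \<forall>k\<ge>k0. \<forall>j\<ge>k. norm (Y j - Y k) \<le> e" if e: "e > 0" for e
  proof -
    obtain M where "\<And>m n. m \<ge> M \<Longrightarrow> n \<ge> M \<Longrightarrow> norm (Y m - Y n) < e"
      using CauchyD[OF Y e] by blast
    then show ?thesis by (intro exI[of _ M]) (auto intro!: less_imp_le)
  qed
  obtain k0 where k0: "\<And>j. j \<ge> k0 \<Longrightarrow> norm (Y j - Y k0) \<le> 1"
    using ev[of 1] by auto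
  have "square_integrable g"
    using square_integrable_add[OF sq[OF k0] square_integrable_rep_l2[of "Y k0"]] by simp
  then have G: "AE x in std_measure. rep_l2 (abs_l2 g) x = g x" by (rule rep_abs_l2)
  have "Y \<longlonglongrightarrow> abs_l2 g"
  proof (rule metric_LIMSEQ_I)
    fix r :: real assume r: "r > 0"
    obtain k1 where k1: "\<And>k j. k \<ge> k1 \<Longrightarrow> j \<ge> k \<Longrightarrow> norm (Y j - Y k) \<le> r / 2"
      using ev[of "r/2"] r by auto
    have "dist (Y k) (abs_l2 g) < r" if "k \<ge> k1" for k
    proof -
      have "ennreal ((norm (abs_l2 g - Y k))\<^sup>2)
          = (\<integral>\<^sup>+x. ennreal ((cmod (g x - rep_l2 (Y k) x))\<^sup>2) \<partial>std_measure)"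
      proof -
        have "AE x in std_measure. ennreal ((cmod (rep_l2 (abs_l2 g - Y k) x))\<^sup>2)
            = ennreal ((cmod (g x - rep_l2 (Y k) x))\<^sup>2)"
          using G rep_l2_diff[of "abs_l2 g" "Y k"] by eventually_elim simp
        then show ?thesis by (simp only: nn_integral_rep_l2[symmetric] nn_integral_cong_AE)
      qed
      also have "\<dots> \<le> ennreal ((r/2)\<^sup>2)" by (rule key) (use k1 that in auto)
      finally have "(norm (abs_l2 g - Y k))\<^sup>2 \<le> (r/2)\<^sup>2" using r by (simp add: ennreal_le_iff)
      then have "norm (abs_l2 g - Y k) \<le> r / 2" by (rule power2_le_imp_le) (use r in simp)
      then show ?thesis using r by (simp add: dist_norm norm_minus_commute)
    qed
    then show "\<exists>no. \<forall>n\<ge>no. dist (Y n) (abs_l2 g) < r" by blast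
  qed
  then show ?thesis by (rule convergentI)
qed

text \<open>Makes Riesz representation available on \<open>l2\<close>, and with it adjoints and the
  weak* cluster points of bounded sequences.\<close>

instance l2 :: (standard_measure_space) complete_space
proof
  fix X :: "nat \<Rightarrow> 'a l2" assume X: "Cauchy X"
  have "\<exists>N. \<forall>m\<ge>N. \<forall>n\<ge>N. norm (X m - X n) < (1/2) ^ k" for k
    using CauchyD[OF X, of "(1/2) ^ k"] by simp
  then obtain N where N: "\<And>k m n. m \<ge> N k \<Longrightarrow> n \<ge> N k \<Longrightarrow> norm (X m - X n) < (1/2) ^ k" by metis
  \<comment> \<open>The sum keeps \<open>r k\<close> above \<open>N k\<close>, and the summand
    \<open>k\<close> makes \<open>r\<close> strictly increasing.\<close>
  define r where "r k = k + (\<Sum>i\<le>k. N i)" for k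
  have r: "strict_mono r" by (rule strict_mono_Suc_iff[THEN iffD2]) (simp add: r_def)
  have rN: "N k \<le> r k" for k
    using member_le_sum[of k "{..k}" N] by (simp add: r_def)
  have "convergent (X \<circ> r)"
  proof (rule l2_subsequence_limit)
    show "Cauchy (X \<circ> r)" by (rule Cauchy_subseq_Cauchy[OF X r])
    show "norm ((X \<circ> r) (Suc k) - (X \<circ> r) k) < (1/2) ^ k" for k
      using N[of k "r (Suc k)" "r k"] rN[of k] strict_mono_leD[OF r, of k "Suc k"] by simp
  qed
  then obtain L where "(X \<circ> r) \<longlonglongrightarrow> L" by (auto simp: convergent_def)
  then have "X \<longlonglongrightarrow> L"
    using Cauchy_converges_subseq[OF X r] by simp
  then show "convergent X" by (rule convergentI)
qed

section \<open>Restrictions to measurable sets\<close>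

text \<open>The value 0 on nonmeasurable sets lets \<open>cutoff\<close> be a bounded operator for
  every set, without a hypothesis in its lifting.\<close>

definition l2_restrict :: "'a::standard_measure_space set \<Rightarrow> 'a l2 \<Rightarrow> 'a l2" where
  "l2_restrict E f = (if E \<in> sets std_measure then abs_l2 (\<lambda>x. indicator E x * rep_l2 f x) else 0)"

lemma rep_l2_restrict:
  assumes E: "E \<in> sets std_measure"
  shows "AE x in std_measure. rep_l2 (l2_restrict E f) x = indicator E x * rep_l2 f x"
proof -
  have "square_integrable (\<lambda>x. indicator E x * rep_l2 f x)"
    unfolding square_integrable_def
  proof
    show "(\<lambda>x. indicator E x * rep_l2 f x) \<in> borel_measurable std_measure"
      using E by measurable
    show "integrable std_measure (\<lambda>x. (cmod (indicator E x * rep_l2 f x))\<^sup>2)"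
      by (rule Bochner_Integration.integrable_bound[OF integrable_rep_l2[of f]])
        (use E in \<open>measurable, auto simp: indicator_def\<close>)
  qed
  then show ?thesis using E by (simp add: l2_restrict_def rep_abs_l2)
qed

lift_definition cutoff :: "'a::standard_measure_space set \<Rightarrow> 'a l2 \<Rightarrow>\<^sub>C\<^sub>L 'a l2" is l2_restrict
proof -
  fix E :: "'a set"
  show "bounded_linear (l2_restrict E) \<and> (\<forall>c x. l2_restrict E (c *\<^sub>C x) = c *\<^sub>C l2_restrict E x)"
  proof (cases "E \<in> sets std_measure")
    case False
    have "c *\<^sub>C (0::'a l2) = 0" for c using norm_scaleC[of c "0::'a l2"] by simp
    then show ?thesis using False by (simp add: l2_restrict_def[abs_def])
  next
    case E: True
    note R = rep_l2_restrict[OF E]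
    have add: "l2_restrict E (f + g) = l2_restrict E f + l2_restrict E g" for f g
    proof (rule l2_eqI)
      show "AE x in std_measure. rep_l2 (l2_restrict E (f + g)) x = rep_l2 (l2_restrict E f + l2_restrict E g) x"
        using R[of "f + g"] R[of f] R[of g] rep_l2_plus[of f g] rep_l2_plus[of "l2_restrict E f" "l2_restrict E g"]
        by eventually_elim (simp add: algebra_simps)
    qed
    have scale: "l2_restrict E (c *\<^sub>C f) = c *\<^sub>C l2_restrict E f" for c f
    proof (rule l2_eqI)
      show "AE x in std_measure. rep_l2 (l2_restrict E (c *\<^sub>C f)) x = rep_l2 (c *\<^sub>C l2_restrict E f) x"
        using R[of "c *\<^sub>C f"] R[of f] rep_l2_scaleC[of c f] rep_l2_scaleC[of c "l2_restrict E f"]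
        by eventually_elim simp
    qed
    have "norm (l2_restrict E f) \<le> norm f * 1" for f
    proof -
      have "norm (l2_restrict E f) \<le> 1 * norm f"
        by (rule norm_l2_leI) (use R[of f] in \<open>auto elim!: eventually_mono simp: indicator_def\<close>)
      then show ?thesis by simp
    qed
    then have "bounded_linear (l2_restrict E)"
      by (intro bounded_linear_intro add) (simp add: scaleR_scaleC scale)
    with scale show ?thesis by blast
  qed
qed

lemma rep_l2_cutoff:
  "E \<in> sets std_measure \<Longrightarrow>
    AE x in std_measure. rep_l2 (cblinfun_apply (cutoff E) f) x = indicator E x * rep_l2 f x"
  by transfer (rule rep_l2_restrict)

lemma norm_cutoff_apply:
  assumes E: "E \<in> sets std_measure"
  shows "norm (cblinfun_apply (cutoff E) f) \<le> 1 * norm f"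
  by (rule norm_l2_leI) (use rep_l2_cutoff[OF E, of f] in \<open>auto elim!: eventually_mono simp: indicator_def\<close>)

lemma norm_cutoff: "E \<in> sets std_measure \<Longrightarrow> norm (cutoff E) \<le> 1"
  by (rule norm_cblinfun_le[OF zero_le_one norm_cutoff_apply])

lemma cutoff_in_masa:
  assumes E: "E \<in> sets std_measure"
  shows "cutoff E \<in> multiplication_masa"
  unfolding multiplication_masa_def
proof (rule CollectI, rule bexI[of _ "indicator E"], rule allI)
  show "AE x in std_measure. rep_l2 (cblinfun_apply (cutoff E) f) x = indicator E x * rep_l2 f x" for f
    by (rule rep_l2_cutoff[OF E])
  show "indicator E \<in> L_infinity std_measure"
    using E by (auto simp: L_infinity_def indicator_def intro!: exI[of _ 1])
qed

lemma masa_bimodule_cutoff: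
  assumes "masa_bimodule U" "T \<in> U" "E \<in> sets std_measure" "F \<in> sets std_measure"
  shows "cutoff F o\<^sub>C\<^sub>L T o\<^sub>C\<^sub>L cutoff E \<in> U"
  using assms(1)[unfolded masa_bimodule_def, THEN conjunct2, rule_format,
      OF cutoff_in_masa[OF assms(3)] cutoff_in_masa[OF assms(4)] assms(2)] .

lemma cutoff_adjoint:
  assumes E: "E \<in> sets std_measure"
  shows "cinner (cblinfun_apply (cutoff E) f) g = cinner f (cblinfun_apply (cutoff E) g)"
  unfolding cinner_l2
proof (rule integral_cong_AE)
  show "AE x in std_measure. rep_l2 (cblinfun_apply (cutoff E) f) x * cnj (rep_l2 g x)
      = rep_l2 f x * cnj (rep_l2 (cblinfun_apply (cutoff E) g) x)"
    using rep_l2_cutoff[OF E, of f] rep_l2_cutoff[OF E, of g]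
    by eventually_elim (simp add: indicator_def)
qed (rule borel_measurable_integrable, intro square_integrable_mult square_integrable_cnj square_integrable_rep_l2)+

lemma cutoff_cnj:
  assumes E: "E \<in> sets std_measure"
  shows "l2_cnj (cblinfun_apply (cutoff E) f) = cblinfun_apply (cutoff E) (l2_cnj f)"
proof (rule l2_eqI)
  show "AE x in std_measure. rep_l2 (l2_cnj (cblinfun_apply (cutoff E) f)) x
      = rep_l2 (cblinfun_apply (cutoff E) (l2_cnj f)) x"
    using rep_l2_cutoff[OF E, of f] rep_l2_cutoff[OF E, of "l2_cnj f"] rep_l2_cnj[of f]
      rep_l2_cnj[of "cblinfun_apply (cutoff E) f"]
    by eventually_elim (simp add: indicator_def)
qed

lemma cutoff_disjoint_Un:
  assumes E: "E \<in> sets std_measure" "F \<in> sets std_measure" "E \<inter> F = {}"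
  shows "cutoff (E \<union> F) = cutoff E + cutoff F"
proof (rule cblinfun_eqI, rule l2_eqI)
  fix f
  have EF: "E \<union> F \<in> sets std_measure" using E by blast
  show "AE x in std_measure. rep_l2 (cblinfun_apply (cutoff (E \<union> F)) f) x
      = rep_l2 (cblinfun_apply (cutoff E + cutoff F) f) x"
    unfolding cblinfun_add_apply
    using rep_l2_cutoff[OF EF, of f] rep_l2_cutoff[OF E(1), of f] rep_l2_cutoff[OF E(2), of f]
      rep_l2_plus[of "cblinfun_apply (cutoff E) f" "cblinfun_apply (cutoff F) f"]
    by eventually_elim (use E(3) in \<open>auto simp: indicator_def\<close>)
qed

lemma cutoff_empty: "cutoff {} = 0"
proof (rule cblinfun_eqI, rule l2_eqI)
  fix f
  show "AE x in std_measure. rep_l2 (cblinfun_apply (cutoff {}) f) x = rep_l2 (cblinfun_apply 0 f) x"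
    unfolding cblinfun_zero_apply using rep_l2_cutoff[of "{}" f] rep_l2_zero by fastforce
qed

lemma cutoff_Union:
  assumes "finite \<E>" "\<E> \<subseteq> sets std_measure" "disjoint \<E>"
  shows "cutoff (\<Union>\<E>) = (\<Sum>E\<in>\<E>. cutoff E)"
  using assms
proof (induction \<E> rule: finite_induct)
  case (insert E \<E>)
  have "\<Union>\<E> \<in> sets std_measure" using insert.prems insert.hyps by (auto intro: sets.finite_Union)
  moreover have "E \<inter> \<Union>\<E> = {}" using insert.prems insert.hyps by (auto simp: disjoint_def)
  moreover have "cutoff (\<Union>\<E>) = (\<Sum>E\<in>\<E>. cutoff E)"
    using insert by (auto simp: disjoint_def)
  ultimately show ?case using insert by (simp add: cutoff_disjoint_Un)
qed (simp add: cutoff_empty)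

text \<open>The squared distance is the integral of the squared modulus of \<open>f\<close> over the
  complement of \<open>E n\<close>, and almost every point eventually leaves these complements;
  dominated convergence applies.\<close>

lemma cutoff_tendsto:
  fixes E :: "nat \<Rightarrow> 'a::standard_measure_space set"
  assumes E: "\<And>n. E n \<in> sets std_measure" and ev: "AE x in std_measure. \<forall>\<^sub>F n in sequentially. x \<in> E n"
  shows "(\<lambda>n. cblinfun_apply (cutoff (E n)) f) \<longlonglongrightarrow> f"
proof -
  note [measurable] = E
  have eq: "(norm (cblinfun_apply (cutoff (E n)) f - f))\<^sup>2
      = (\<integral>x. (1 - indicator (E n) x) * (cmod (rep_l2 f x))\<^sup>2 \<partial>std_measure)" for n
    unfolding norm_l2_square
  proof (rule integral_cong_AE)
    show "(\<lambda>x. (1 - indicator (E n) x) * (cmod (rep_l2 f x))\<^sup>2) \<in> borel_measurable std_measure"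
      by measurable
    show "AE x in std_measure. (cmod (rep_l2 (cblinfun_apply (cutoff (E n)) f - f) x))\<^sup>2
        = (1 - indicator (E n) x) * (cmod (rep_l2 f x))\<^sup>2"
      using rep_l2_cutoff[OF E, of n f] rep_l2_diff[of "cblinfun_apply (cutoff (E n)) f" f]
      by eventually_elim (simp add: indicator_def)
  qed measurable
  have "(\<lambda>n. \<integral>x. (1 - indicator (E n) x) * (cmod (rep_l2 f x))\<^sup>2 \<partial>std_measure)
      \<longlonglongrightarrow> (\<integral>x. 0 \<partial>(std_measure :: 'a measure))"
  proof (rule integral_dominated_convergence[where w = "\<lambda>x. (cmod (rep_l2 f x))\<^sup>2"])
    show "AE x in std_measure. (\<lambda>n. (1 - indicator (E n) x) * (cmod (rep_l2 f x))\<^sup>2) \<longlonglongrightarrow> 0"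
      using ev
    proof eventually_elim
      case (elim x)
      show ?case by (rule tendsto_eventually) (use elim in \<open>auto elim!: eventually_mono\<close>)
    qed
    show "(\<lambda>x. (1 - indicator (E n) x) * (cmod (rep_l2 f x))\<^sup>2) \<in> borel_measurable std_measure" for n
      by measurable
  qed (auto simp: integrable_rep_l2 indicator_def)
  then have "(\<lambda>n. (norm (cblinfun_apply (cutoff (E n)) f - f))\<^sup>2) \<longlonglongrightarrow> 0"
    unfolding eq by simp
  from tendsto_real_sqrt[OF this] have "(\<lambda>n. norm (cblinfun_apply (cutoff (E n)) f - f)) \<longlonglongrightarrow> 0"
    by simp
  then show ?thesis by (simp add: tendsto_norm_zero_iff LIM_zero_iff)
qed

section \<open>The product measure\<close>

lemma sigma_finite_std_measure: "sigma_finite_measure (std_measure :: 'a::standard_measure_space measure)"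
  using standard_measure by (auto simp: standard_measure_def)

lemma pair_sigma_finite_std_measure:
  "pair_sigma_finite (std_measure :: 'a::standard_measure_space measure)
     (std_measure :: 'b::standard_measure_space measure)"
  by (simp add: pair_sigma_finite_def sigma_finite_std_measure)

lemma AE_pair_fst:
  assumes N: "sigma_finite_measure N" and P: "AE x in M. P x"
  shows "AE z in M \<Otimes>\<^sub>M N. P (fst z)"
proof -
  interpret N: sigma_finite_measure N by fact
  obtain A where A: "{x \<in> space M. \<not> P x} \<subseteq> A" "emeasure M A = 0" "A \<in> sets M"
    using P by (auto elim: AE_E)
  show ?thesis
  proof (rule AE_I)
    show "{z \<in> space (M \<Otimes>\<^sub>M N). \<not> P (fst z)} \<subseteq> A \<times> space N"
      using A(1) by (auto simp: space_pair_measure)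
    show "emeasure (M \<Otimes>\<^sub>M N) (A \<times> space N) = 0"
      using A by (simp add: N.emeasure_pair_measure_Times)
    show "A \<times> space N \<in> sets (M \<Otimes>\<^sub>M N)" using A by simp
  qed
qed

lemma AE_pair_snd:
  assumes N: "sigma_finite_measure N" and P: "AE y in N. P y"
  shows "AE z in M \<Otimes>\<^sub>M N. P (snd z)"
proof -
  interpret N: sigma_finite_measure N by fact
  obtain A where A: "{x \<in> space N. \<not> P x} \<subseteq> A" "emeasure N A = 0" "A \<in> sets N"
    using P by (auto elim: AE_E)
  show ?thesis
  proof (rule AE_I)
    show "{z \<in> space (M \<Otimes>\<^sub>M N). \<not> P (snd z)} \<subseteq> space M \<times> A"
      using A(1) by (auto simp: space_pair_measure)
    show "emeasure (M \<Otimes>\<^sub>M N) (space M \<times> A) = 0"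
      using A by (simp add: N.emeasure_pair_measure_Times)
    show "space M \<times> A \<in> sets (M \<Otimes>\<^sub>M N)" using A by simp
  qed
qed

lemma (in pair_sigma_finite) integrable_times:
  fixes f :: "'a \<Rightarrow> 'c::{real_normed_field, banach, second_countable_topology}"
  assumes f: "integrable M1 f" and g: "integrable M2 g"
  shows "integrable (M1 \<Otimes>\<^sub>M M2) (\<lambda>z. f (fst z) * g (snd z))"
    and "(\<integral>z. f (fst z) * g (snd z) \<partial>(M1 \<Otimes>\<^sub>M M2)) = (\<integral>x. f x \<partial>M1) * (\<integral>y. g y \<partial>M2)"
proof -
  have [measurable]: "f \<in> borel_measurable M1" "g \<in> borel_measurable M2" using f g by auto
  show *: "integrable (M1 \<Otimes>\<^sub>M M2) (\<lambda>z. f (fst z) * g (snd z))"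
  proof (rule Fubini_integrable)
    show "integrable M1 (\<lambda>x. \<integral>y. norm (f (fst (x, y)) * g (snd (x, y))) \<partial>M2)"
      using f by (simp add: norm_mult)
    show "AE x in M1. integrable M2 (\<lambda>y. f (fst (x, y)) * g (snd (x, y)))"
      using g by simp
  qed measurable
  show "(\<integral>z. f (fst z) * g (snd z) \<partial>(M1 \<Otimes>\<^sub>M M2)) = (\<integral>x. f x \<partial>M1) * (\<integral>y. g y \<partial>M2)"
    using integral_fst'[OF *] by simp
qed

text \<open>Integrating over the set where a function is positive shows that its positive part
  vanishes; this is applied to \<open>W\<close> and to \<open>- W\<close>.\<close>

lemma AE_zero_of_integrals_zero:
  fixes W :: "'a \<Rightarrow> real"
  assumes W: "integrable M W" and z: "\<And>A. A \<in> sets M \<Longrightarrow> (LINT x:A|M. W x) = 0"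
  shows "AE x in M. W x = 0"
proof -
  have [measurable]: "W \<in> borel_measurable M" using W by auto
  have *: "AE x in M. V x \<le> 0"
    if V: "integrable M V" and zV: "\<And>A. A \<in> sets M \<Longrightarrow> (LINT x:A|M. V x) = 0" for V :: "'a \<Rightarrow> real"
  proof -
    have [measurable]: "V \<in> borel_measurable M" using V by auto
    let ?A = "{x \<in> space M. V x > 0}"
    have "?A \<in> sets M" by measurable
    then have int: "integrable M (\<lambda>x. indicator ?A x *\<^sub>R V x)"
      using V by (rule integrable_mult_indicator)
    have "(\<integral>x. indicator ?A x *\<^sub>R V x \<partial>M) = 0"
      using zV[of ?A] by (simp add: set_lebesgue_integral_def)
    then have "AE x in M. indicator ?A x *\<^sub>R V x = 0"
      using integral_nonneg_eq_0_iff_AE[OF int] by (simp add: indicator_def)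
    then show ?thesis
      using AE_space by eventually_elim (auto simp: indicator_def split: if_splits)
  qed
  have "AE x in M. W x \<le> 0" by (rule *[OF W z])
  moreover have "AE x in M. - W x \<le> 0"
    by (rule *) (use W z in \<open>auto simp: set_lebesgue_integral_def\<close>)
  ultimately show ?thesis by eventually_elim simp
qed

text \<open>Dynkin's argument: rectangles generate the product sigma-algebra and are stable under
  intersection, and the sets with zero integral are closed under disjoint countable unions.
  Complements work because the whole space is itself a rectangle.\<close>

lemma integral_zero_on_rectangles:
  fixes W :: "'a \<times> 'b \<Rightarrow> 'c::{banach, second_countable_topology}"
  assumes W: "integrable (M \<Otimes>\<^sub>M N) W"
    and rect: "\<And>E F. E \<in> sets M \<Longrightarrow> F \<in> sets N \<Longrightarrow> (LINT z:E \<times> F|M \<Otimes>\<^sub>M N. W z) = 0"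
    and A: "A \<in> sets (M \<Otimes>\<^sub>M N)"
  shows "(LINT z:A|M \<Otimes>\<^sub>M N. W z) = 0"
proof -
  have setint: "set_integrable (M \<Otimes>\<^sub>M N) B W" if "B \<in> sets (M \<Otimes>\<^sub>M N)" for B
    unfolding set_integrable_def using that W by (rule integrable_mult_indicator)
  have sets: "sets (M \<Otimes>\<^sub>M N) = sigma_sets (space M \<times> space N) {a \<times> b |a b. a \<in> sets M \<and> b \<in> sets N}"
    by (rule sets_pair_measure)
  have "{a \<times> b |a b. a \<in> sets M \<and> b \<in> sets N} \<subseteq> Pow (space M \<times> space N)"
    by (rule pair_measure_closed)
  from Int_stable_pair_measure_generator this A[unfolded sets]
  show ?thesis
  proof (induction rule: sigma_sets_induct_disjoint)
    case (basic A)
    then show ?case using rect by auto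
  next
    case empty
    show ?case by (simp add: set_lebesgue_integral_def)
  next
    case (compl A)
    have A: "A \<in> sets (M \<Otimes>\<^sub>M N)" using compl.hyps unfolding sets .
    have "(LINT z:space M \<times> space N|M \<Otimes>\<^sub>M N. W z) = 0" by (rule rect) auto
    moreover have "space M \<times> space N = (space M \<times> space N - A) \<union> A"
      using sets.sets_into_space[OF A] by (auto simp: space_pair_measure)
    moreover have "(LINT z:(space M \<times> space N - A) \<union> A|M \<Otimes>\<^sub>M N. W z)
        = (LINT z:space M \<times> space N - A|M \<Otimes>\<^sub>M N. W z) + (LINT z:A|M \<Otimes>\<^sub>M N. W z)"
      by (rule set_integral_Un) (use A setint in auto)
    ultimately show ?case using compl.IH by simp
  next
    case (union A)
    have A: "A i \<in> sets (M \<Otimes>\<^sub>M N)" for i using union.hyps unfolding sets by auto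
    have "(LINT z:(\<Union>i. A i)|M \<Otimes>\<^sub>M N. W z) = (\<Sum>i. (LINT z:A i|M \<Otimes>\<^sub>M N. W z))"
      by (rule lebesgue_integral_countable_add)
        (use A union.hyps setint in \<open>auto simp: disjoint_family_on_def\<close>)
    then show ?case using union.IH by simp
  qed
qed

lemma AE_zero_of_rectangles:
  fixes W :: "'a \<times> 'b \<Rightarrow> complex"
  assumes W: "integrable (M \<Otimes>\<^sub>M N) W"
    and rect: "\<And>E F. E \<in> sets M \<Longrightarrow> F \<in> sets N \<Longrightarrow> (LINT z:E \<times> F|M \<Otimes>\<^sub>M N. W z) = 0"
  shows "AE z in M \<Otimes>\<^sub>M N. W z = 0"
proof -
  have z: "(LINT z:A|M \<Otimes>\<^sub>M N. W z) = 0" if "A \<in> sets (M \<Otimes>\<^sub>M N)" for A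
    by (rule integral_zero_on_rectangles[OF W rect that])
  have si: "integrable (M \<Otimes>\<^sub>M N) (\<lambda>z. indicator A z *\<^sub>R W z)" if "A \<in> sets (M \<Otimes>\<^sub>M N)" for A
    using that W by (rule integrable_mult_indicator)
  have "AE z in M \<Otimes>\<^sub>M N. Re (W z) = 0"
  proof (rule AE_zero_of_integrals_zero)
    fix A assume A: "A \<in> sets (M \<Otimes>\<^sub>M N)"
    show "(LINT z:A|M \<Otimes>\<^sub>M N. Re (W z)) = 0"
      using integral_Re[OF si[OF A]] z[OF A] by (simp add: set_lebesgue_integral_def)
  qed (use W in auto)
  moreover have "AE z in M \<Otimes>\<^sub>M N. Im (W z) = 0"
  proof (rule AE_zero_of_integrals_zero)
    fix A assume A: "A \<in> sets (M \<Otimes>\<^sub>M N)"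
    show "(LINT z:A|M \<Otimes>\<^sub>M N. Im (W z)) = 0"
      using integral_Im[OF si[OF A]] z[OF A] by (simp add: set_lebesgue_integral_def)
  qed (use W in auto)
  ultimately show ?thesis by eventually_elim (simp add: complex_eq_iff)
qed

section \<open>Schur maps\<close>

lemma measurable_rep_l2_fst [measurable]:
  "(\<lambda>z. rep_l2 f (fst z)) \<in> borel_measurable (std_measure \<Otimes>\<^sub>M N)"
  by (rule measurable_compose[OF measurable_fst measurable_rep_l2])

lemma measurable_rep_l2_snd [measurable]:
  "(\<lambda>z. rep_l2 f (snd z)) \<in> borel_measurable (N \<Otimes>\<^sub>M std_measure)"
  by (rule measurable_compose[OF measurable_snd measurable_rep_l2])

text \<open>A measurable representative of the function with expansion \<open>f\<close>,
  \<open>g\<close>. For square summable sequences the series diverges at most on a null set, where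
  the default value of the infinite sum does no harm.\<close>

definition tensor_sum :: "(nat \<Rightarrow> 'a::standard_measure_space l2) \<Rightarrow>
    (nat \<Rightarrow> 'b::standard_measure_space l2) \<Rightarrow> 'a \<times> 'b \<Rightarrow> complex" where
  "tensor_sum f g z = (\<Sum>i. rep_l2 (f i) (fst z) * rep_l2 (g i) (snd z))"

lemma measurable_tensor_sum [measurable]:
  "tensor_sum f g \<in> borel_measurable (std_measure \<Otimes>\<^sub>M std_measure)"
  unfolding tensor_sum_def[abs_def] by measurable

lemma AE_summable_tensor:
  assumes f: "square_summable f" and g: "square_summable g"
  shows "AE z in std_measure \<Otimes>\<^sub>M std_measure.
    summable (\<lambda>i. norm (rep_l2 (f i) (fst z) * rep_l2 (g i) (snd z)))"
  using AE_pair_fst[OF sigma_finite_std_measure AE_summable_square_rep_l2[OF f]]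
    AE_pair_snd[OF sigma_finite_std_measure AE_summable_square_rep_l2[OF g]]
  by eventually_elim
    (use square_summable_mult in \<open>auto simp: square_summable_def norm_mult\<close>)

lemma Gamma_expansion_tensor_sum:
  assumes f: "square_summable f" and g: "square_summable g"
  shows "Gamma_expansion f g (tensor_sum f g)"
  unfolding Gamma_expansion_def
proof (intro conjI f g)
  show "AE z in std_measure \<Otimes>\<^sub>M std_measure.
      (\<lambda>i. rep_l2 (f i) (fst z) * rep_l2 (g i) (snd z)) sums tensor_sum f g z"
    using AE_summable_tensor[OF f g] unfolding tensor_sum_def
    by eventually_elim (rule summable_sums[OF summable_norm_cancel])
qed

lemma Gamma_expansion_AE_eq:
  assumes "Gamma_expansion f g h"
  shows "AE z in std_measure \<Otimes>\<^sub>M std_measure. h z = tensor_sum f g z"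
proof -
  have "AE z in std_measure \<Otimes>\<^sub>M std_measure.
      (\<lambda>i. rep_l2 (f i) (fst z) * rep_l2 (g i) (snd z)) sums h z"
    using assms by (simp add: Gamma_expansion_def)
  then show ?thesis unfolding tensor_sum_def by eventually_elim (rule sums_unique)
qed

lemma Gamma_expansion_cong:
  assumes "Gamma_expansion f g h" "AE z in std_measure \<Otimes>\<^sub>M std_measure. h z = h' z"
  shows "Gamma_expansion f g h'"
  using assms unfolding Gamma_expansion_def by (auto elim: eventually_elim2)

lemma Gamma_expansion_zero: "Gamma_expansion (\<lambda>_. 0) (\<lambda>_. 0) (\<lambda>_. 0)"
  unfolding Gamma_expansion_def
proof (intro conjI)
  show "AE z in std_measure \<Otimes>\<^sub>M std_measure.
      (\<lambda>i. rep_l2 (0::'a l2) (fst z) * rep_l2 (0::'b l2) (snd z)) sums 0"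
    using AE_pair_fst[OF sigma_finite_std_measure rep_l2_zero]
    by eventually_elim (simp only: mult_zero_left sums_zero)
qed (simp_all add: square_summable_def)

lemma square_summable_cutoff:
  assumes "E \<in> sets std_measure" "square_summable f"
  shows "square_summable (\<lambda>i. cblinfun_apply (cutoff E) (f i))"
  by (rule square_summable_dominated[OF assms(2) norm_cutoff_apply[OF assms(1)]])

lemma Gamma_expansion_cutoff:
  assumes E: "E \<in> sets std_measure" and F: "F \<in> sets std_measure" and h: "Gamma_expansion f g h"
  shows "Gamma_expansion (\<lambda>i. cblinfun_apply (cutoff E) (f i)) (\<lambda>i. cblinfun_apply (cutoff F) (g i))
    (\<lambda>z. indicator E (fst z) * indicator F (snd z) * h z)"
  unfolding Gamma_expansion_def
proof (intro conjI square_summable_cutoff E F)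
  have 1: "AE x in std_measure. \<forall>i. rep_l2 (cblinfun_apply (cutoff E) (f i)) x = indicator E x * rep_l2 (f i) x"
    using rep_l2_cutoff[OF E] by (simp add: AE_all_countable)
  have 2: "AE x in std_measure. \<forall>i. rep_l2 (cblinfun_apply (cutoff F) (g i)) x = indicator F x * rep_l2 (g i) x"
    using rep_l2_cutoff[OF F] by (simp add: AE_all_countable)
  have 3: "AE z in std_measure \<Otimes>\<^sub>M std_measure.
      (\<lambda>i. rep_l2 (f i) (fst z) * rep_l2 (g i) (snd z)) sums h z"
    using h by (simp add: Gamma_expansion_def)
  show "AE z in std_measure \<Otimes>\<^sub>M std_measure.
      (\<lambda>i. rep_l2 (cblinfun_apply (cutoff E) (f i)) (fst z) * rep_l2 (cblinfun_apply (cutoff F) (g i)) (snd z))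
        sums (indicator E (fst z) * indicator F (snd z) * h z)"
    using AE_pair_fst[OF sigma_finite_std_measure 1] AE_pair_snd[OF sigma_finite_std_measure 2] 3
  proof eventually_elim
    case (elim z)
    from sums_mult[OF elim(3), of "indicator E (fst z) * indicator F (snd z)"]
    show ?case using elim(1,2) by (simp add: mult_ac)
  qed
qed (use h in \<open>simp_all add: Gamma_expansion_def\<close>)

definition schur_map ::
  "('a::standard_measure_space \<times> 'b::standard_measure_space \<Rightarrow> complex) \<Rightarrow>
   (('a l2 \<Rightarrow>\<^sub>C\<^sub>L 'b l2) \<Rightarrow> ('a l2 \<Rightarrow>\<^sub>C\<^sub>L 'b l2)) \<Rightarrow> bool" where
  "schur_map \<phi> \<Phi> \<longleftrightarrow> schur_multiplier \<phi> \<and> is_schur_map_of \<phi> \<Phi>"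

lemma schur_map_expansion:
  assumes "schur_map \<phi> \<Phi>" "Gamma_expansion f g h"
  shows "\<exists>f' g'. Gamma_expansion f' g' (\<lambda>z. \<phi> z * h z)"
  using assms unfolding schur_map_def schur_multiplier_def Gamma_def by blast

lemma schur_map_pairing:
  assumes "schur_map \<phi> \<Phi>" "Gamma_expansion f g h" "Gamma_expansion f' g' (\<lambda>z. \<phi> z * h z)"
  shows "trace_pairing (\<Phi> T) f (\<lambda>i. l2_cnj (g i)) = trace_pairing T f' (\<lambda>i. l2_cnj (g' i))"
  using assms unfolding schur_map_def is_schur_map_of_def by blast

text \<open>Conjugation is an involution on square summable sequences, so every trace pairing has
  the form in which the duality of a Schur map is stated.\<close>

lemma ex_expansion:
  assumes "square_summable u" "square_summable v"
  shows "\<exists>g h. Gamma_expansion u g h \<and> v = (\<lambda>i. l2_cnj (g i))"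
  using Gamma_expansion_tensor_sum[OF assms(1) square_summable_l2_cnj[OF assms(2)]]
  by (intro exI[of _ "\<lambda>i. l2_cnj (v i)"] exI[of _ "tensor_sum u (\<lambda>i. l2_cnj (v i))"])
    (simp add: l2_cnj_cnj)

lemma cblinfun_eq_expansionI:
  assumes "\<And>f g h. Gamma_expansion f g h \<Longrightarrow>
    trace_pairing S f (\<lambda>i. l2_cnj (g i)) = trace_pairing T f (\<lambda>i. l2_cnj (g i))"
  shows "S = T"
proof (rule cblinfun_eq_trace_pairingI)
  fix u :: "nat \<Rightarrow> 'a l2" and v :: "nat \<Rightarrow> 'b l2"
  assume "square_summable u" "square_summable v"
  then obtain g h where "Gamma_expansion u g h" "v = (\<lambda>i. l2_cnj (g i))"
    using ex_expansion by blast
  then show "trace_pairing S u v = trace_pairing T u v" using assms by blast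
qed

lemma square_summable_expansion:
  "Gamma_expansion f g h \<Longrightarrow> square_summable f"
  "Gamma_expansion f g h \<Longrightarrow> square_summable (\<lambda>i. l2_cnj (g i))"
  by (auto simp: Gamma_expansion_def intro: square_summable_l2_cnj)

text \<open>Multiplication by \<open>\<phi>\<close> is the pre-adjoint. The expansion of the product
  is chosen before \<open>T\<close>, so one pair of sequences serves all operators.\<close>

lemma schur_map_continuous:
  assumes S: "schur_map \<phi> \<Phi>"
  shows "weak_continuous \<Phi>"
proof (rule weak_continuousI)
  fix u :: "nat \<Rightarrow> 'a l2" and v :: "nat \<Rightarrow> 'b l2"
  assume "square_summable u" "square_summable v"
  then obtain g h where h: "Gamma_expansion u g h" and v: "v = (\<lambda>i. l2_cnj (g i))"
    using ex_expansion by blast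
  obtain f' g' where h': "Gamma_expansion f' g' (\<lambda>z. \<phi> z * h z)"
    using schur_map_expansion[OF S h] by blast
  show "\<exists>u' v' c. square_summable u' \<and> square_summable v' \<and>
      (\<forall>T. trace_pairing (\<Phi> T) u v = trace_pairing T u' v' + c)"
    unfolding v
    by (rule exI[of _ f'], rule exI[of _ "\<lambda>i. l2_cnj (g' i)"], rule exI[of _ 0])
      (use schur_map_pairing[OF S h h'] square_summable_expansion[OF h'] in simp)
qed

lemma schur_map_add:
  assumes S: "schur_map \<phi> \<Phi>"
  shows "\<Phi> (T + T') = \<Phi> T + \<Phi> T'"
proof (rule cblinfun_eq_expansionI)
  fix f g and h :: "'a \<times> 'b \<Rightarrow> complex" assume h: "Gamma_expansion f g h"
  obtain f' g' where h': "Gamma_expansion f' g' (\<lambda>z. \<phi> z * h z)"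
    using schur_map_expansion[OF S h] by blast
  show "trace_pairing (\<Phi> (T + T')) f (\<lambda>i. l2_cnj (g i)) = trace_pairing (\<Phi> T + \<Phi> T') f (\<lambda>i. l2_cnj (g i))"
    by (simp add: trace_pairing_add square_summable_expansion[OF h] square_summable_expansion[OF h']
        schur_map_pairing[OF S h h'])
qed

lemma schur_map_diff:
  assumes S: "schur_map \<phi> \<Phi>"
  shows "\<Phi> (T - T') = \<Phi> T - \<Phi> T'"
  using schur_map_add[OF S, of "T - T'" T'] by (simp add: algebra_simps)

text \<open>Dual to the commutation of the two multiplications; the expansion of the double product
  can be shared by both orders.\<close>

lemma schur_map_commute:
  assumes S: "schur_map \<phi> \<Phi>" and S': "schur_map \<psi> \<Psi>"
  shows "\<Phi> (\<Psi> T) = \<Psi> (\<Phi> T)"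
proof (rule cblinfun_eq_expansionI)
  fix f g and h :: "'a \<times> 'b \<Rightarrow> complex" assume h: "Gamma_expansion f g h"
  obtain f1 g1 where h1: "Gamma_expansion f1 g1 (\<lambda>z. \<phi> z * h z)"
    using schur_map_expansion[OF S h] by blast
  obtain f2 g2 where h2: "Gamma_expansion f2 g2 (\<lambda>z. \<psi> z * h z)"
    using schur_map_expansion[OF S' h] by blast
  obtain f3 g3 where h3: "Gamma_expansion f3 g3 (\<lambda>z. \<psi> z * (\<phi> z * h z))"
    using schur_map_expansion[OF S' h1] by blast
  then have h3': "Gamma_expansion f3 g3 (\<lambda>z. \<phi> z * (\<psi> z * h z))"
    by (simp add: mult.left_commute)
  show "trace_pairing (\<Phi> (\<Psi> T)) f (\<lambda>i. l2_cnj (g i)) = trace_pairing (\<Psi> (\<Phi> T)) f (\<lambda>i. l2_cnj (g i))"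
    by (simp add: schur_map_pairing[OF S h h1] schur_map_pairing[OF S' h1 h3]
        schur_map_pairing[OF S' h h2] schur_map_pairing[OF S h2 h3'])
qed

lemma trace_pairing_cutoff:
  assumes "E \<in> sets std_measure" "F \<in> sets std_measure"
  shows "trace_pairing (cutoff F o\<^sub>C\<^sub>L T o\<^sub>C\<^sub>L cutoff E) f (\<lambda>i. l2_cnj (g i))
    = trace_pairing T (\<lambda>i. cblinfun_apply (cutoff E) (f i)) (\<lambda>i. l2_cnj (cblinfun_apply (cutoff F) (g i)))"
  by (simp add: trace_pairing_def cutoff_adjoint cutoff_cnj assms)

text \<open>The part of the masa-bimodule property that the argument uses: multiplication by
  \<open>\<phi>\<close> commutes with multiplication by the indicator of a rectangle.\<close>

lemma schur_map_cutoff: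
  assumes S: "schur_map \<phi> \<Phi>" and E: "E \<in> sets std_measure" and F: "F \<in> sets std_measure"
  shows "\<Phi> (cutoff F o\<^sub>C\<^sub>L T o\<^sub>C\<^sub>L cutoff E) = cutoff F o\<^sub>C\<^sub>L \<Phi> T o\<^sub>C\<^sub>L cutoff E"
proof (rule cblinfun_eq_expansionI)
  fix f g and h :: "'a \<times> 'b \<Rightarrow> complex" assume h: "Gamma_expansion f g h"
  obtain f' g' where h': "Gamma_expansion f' g' (\<lambda>z. \<phi> z * h z)"
    using schur_map_expansion[OF S h] by blast
  have "Gamma_expansion (\<lambda>i. cblinfun_apply (cutoff E) (f' i)) (\<lambda>i. cblinfun_apply (cutoff F) (g' i))
      (\<lambda>z. \<phi> z * (indicator E (fst z) * indicator F (snd z) * h z))"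
    using Gamma_expansion_cutoff[OF E F h'] by (simp add: mult_ac)
  from schur_map_pairing[OF S Gamma_expansion_cutoff[OF E F h] this]
  show "trace_pairing (\<Phi> (cutoff F o\<^sub>C\<^sub>L T o\<^sub>C\<^sub>L cutoff E)) f (\<lambda>i. l2_cnj (g i))
      = trace_pairing (cutoff F o\<^sub>C\<^sub>L \<Phi> T o\<^sub>C\<^sub>L cutoff E) f (\<lambda>i. l2_cnj (g i))"
    by (simp add: schur_map_pairing[OF S h h'] trace_pairing_cutoff E F)
qed

text \<open>On functions supported in the rectangle multiplication by \<open>\<phi>\<close> changes
  nothing almost everywhere, so a single expansion represents the function before and after
  it.\<close>

lemma schur_map_cell_one:
  assumes S: "schur_map \<phi> \<Phi>" and E: "E \<in> sets std_measure" and F: "F \<in> sets std_measure"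
    and one: "AE z in std_measure \<Otimes>\<^sub>M std_measure. z \<in> E \<times> F \<longrightarrow> \<phi> z = 1"
  shows "cutoff F o\<^sub>C\<^sub>L \<Phi> T o\<^sub>C\<^sub>L cutoff E = cutoff F o\<^sub>C\<^sub>L T o\<^sub>C\<^sub>L cutoff E"
proof (rule cblinfun_eq_expansionI)
  fix f g and h :: "'a \<times> 'b \<Rightarrow> complex" assume h: "Gamma_expansion f g h"
  note h1 = Gamma_expansion_cutoff[OF E F h]
  have "Gamma_expansion (\<lambda>i. cblinfun_apply (cutoff E) (f i)) (\<lambda>i. cblinfun_apply (cutoff F) (g i))
      (\<lambda>z. \<phi> z * (indicator E (fst z) * indicator F (snd z) * h z))"
    by (rule Gamma_expansion_cong[OF h1])
      (use one in \<open>auto elim!: eventually_mono simp: indicator_def mem_Times_iff\<close>)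
  from schur_map_pairing[OF S h1 this]
  show "trace_pairing (cutoff F o\<^sub>C\<^sub>L \<Phi> T o\<^sub>C\<^sub>L cutoff E) f (\<lambda>i. l2_cnj (g i))
      = trace_pairing (cutoff F o\<^sub>C\<^sub>L T o\<^sub>C\<^sub>L cutoff E) f (\<lambda>i. l2_cnj (g i))"
    by (simp add: trace_pairing_cutoff E F)
qed

lemma schur_map_cell_zero:
  assumes S: "schur_map \<phi> \<Phi>" and E: "E \<in> sets std_measure" and F: "F \<in> sets std_measure"
    and zero: "AE z in std_measure \<Otimes>\<^sub>M std_measure. z \<in> E \<times> F \<longrightarrow> \<phi> z = 0"
  shows "cutoff F o\<^sub>C\<^sub>L \<Phi> T o\<^sub>C\<^sub>L cutoff E = 0"
proof (rule cblinfun_eq_expansionI)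
  fix f g and h :: "'a \<times> 'b \<Rightarrow> complex" assume h: "Gamma_expansion f g h"
  note h1 = Gamma_expansion_cutoff[OF E F h]
  have "Gamma_expansion (\<lambda>_. 0) (\<lambda>_. 0)
      (\<lambda>z. \<phi> z * (indicator E (fst z) * indicator F (snd z) * h z))"
    by (rule Gamma_expansion_cong[OF Gamma_expansion_zero])
      (use zero in \<open>auto elim!: eventually_mono simp: indicator_def mem_Times_iff\<close>)
  from schur_map_pairing[OF S h1 this]
  show "trace_pairing (cutoff F o\<^sub>C\<^sub>L \<Phi> T o\<^sub>C\<^sub>L cutoff E) f (\<lambda>i. l2_cnj (g i))
      = trace_pairing 0 f (\<lambda>i. l2_cnj (g i))"
    by (simp add: trace_pairing_cutoff E F) (simp add: trace_pairing_def cinner_zero_left cblinfun_apply_zero)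
qed

section \<open>Rank one test operators and the values of the multiplier\<close>

lift_definition rank1 :: "'a::complex_inner \<Rightarrow> 'b::complex_inner \<Rightarrow> 'a \<Rightarrow>\<^sub>C\<^sub>L 'b"
  is "\<lambda>p q f. cinner f p *\<^sub>C q"
proof (intro conjI allI)
  fix p :: 'a and q :: 'b and c x
  show "bounded_linear (\<lambda>f. cinner f p *\<^sub>C q)"
  proof (rule bounded_linear_intro[where K = "norm p * norm q"])
    show "norm (cinner f p *\<^sub>C q) \<le> norm f * (norm p * norm q)" for f
      using mult_right_mono[OF norm_cinner_le[of f p] norm_ge_zero[of q]]
      by (simp add: norm_scaleC mult.assoc)
  qed (simp_all add: cinner_add_left scaleC_add_left scaleR_scaleC scaleC_scaleC cinner_scaleC_left)
  show "cinner (c *\<^sub>C x) p *\<^sub>C q = c *\<^sub>C (cinner x p *\<^sub>C q)"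
    by (simp add: cinner_scaleC_left scaleC_scaleC)
qed

text \<open>Cauchy-Schwarz applied to the moduli of \<open>f\<close> and \<open>g\<close>, which are
  again elements of \<open>l2\<close> with the same norms.\<close>

lemma integral_norm_mult_l2_le:
  "(\<integral>x. cmod (rep_l2 f x * rep_l2 g x) \<partial>std_measure) \<le> norm f * norm g"
proof -
  have ex: "\<exists>k. (AE x in std_measure. rep_l2 k x = complex_of_real (cmod (rep_l2 f x))) \<and> norm k = norm f" for f :: "'a l2"
  proof -
    let ?k = "abs_l2 (\<lambda>x. complex_of_real (cmod (rep_l2 f x)))"
    have k: "AE x in std_measure. rep_l2 ?k x = complex_of_real (cmod (rep_l2 f x))"
      by (rule rep_abs_l2) (simp add: square_integrable_def integrable_rep_l2)
    have "(\<integral>x. (cmod (rep_l2 ?k x))\<^sup>2 \<partial>std_measure) = (\<integral>x. (cmod (rep_l2 f x))\<^sup>2 \<partial>std_measure)"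
    proof (rule integral_cong_AE)
      show "AE x in std_measure. (cmod (rep_l2 ?k x))\<^sup>2 = (cmod (rep_l2 f x))\<^sup>2"
        using k by eventually_elim simp
    qed measurable
    then have "norm ?k = norm f" by (simp add: norm_l2_square[symmetric])
    with k show ?thesis by blast
  qed
  obtain f' g' where f': "AE x in std_measure. rep_l2 f' x = complex_of_real (cmod (rep_l2 f x))" "norm f' = norm f"
    and g': "AE x in std_measure. rep_l2 g' x = complex_of_real (cmod (rep_l2 g x))" "norm g' = norm g"
    using ex[of f] ex[of g] by blast
  have "cinner f' g' = (\<integral>x. complex_of_real (cmod (rep_l2 f x * rep_l2 g x)) \<partial>std_measure)"
    unfolding cinner_l2
  proof (rule integral_cong_AE)
    show "AE x in std_measure. rep_l2 f' x * cnj (rep_l2 g' x) = complex_of_real (cmod (rep_l2 f x * rep_l2 g x))"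
      using f'(1) g'(1) by eventually_elim (simp add: norm_mult)
    show "(\<lambda>x. rep_l2 f' x * cnj (rep_l2 g' x)) \<in> borel_measurable std_measure"
      by (rule borel_measurable_integrable, intro square_integrable_mult square_integrable_cnj square_integrable_rep_l2)
  qed measurable
  then have "cinner f' g' = complex_of_real (\<integral>x. cmod (rep_l2 f x * rep_l2 g x) \<partial>std_measure)"
    by (simp only: integral_complex_of_real)
  then have "\<bar>\<integral>x. cmod (rep_l2 f x * rep_l2 g x) \<partial>std_measure\<bar> \<le> norm f' * norm g'"
    using norm_cinner_le[of f' g'] by simp
  then show ?thesis using f'(2) g'(2) by simp
qed

text \<open>Allows the function of an expansion to be tested by trace pairings. Each term is a
  product of two integrals, which Fubini joins into one; the L1 bounds from Cauchy-Schwarz justify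
  exchanging sum and integral.\<close>

lemma trace_pairing_rank1:
  fixes p :: "'a::standard_measure_space l2" and q :: "'b::standard_measure_space l2"
  assumes f: "square_summable f" and g: "square_summable g"
  shows "trace_pairing (rank1 (l2_cnj p) q) f (\<lambda>i. l2_cnj (g i))
    = (\<integral>z. tensor_sum f g z * (rep_l2 p (fst z) * rep_l2 q (snd z)) \<partial>(std_measure \<Otimes>\<^sub>M std_measure))"
proof -
  interpret pair_sigma_finite "std_measure :: 'a measure" "std_measure :: 'b measure"
    by (rule pair_sigma_finite_std_measure)
  let ?P = "std_measure \<Otimes>\<^sub>M std_measure :: ('a \<times> 'b) measure"
  let ?F = "\<lambda>i x. rep_l2 (f i) x * rep_l2 p x" and ?G = "\<lambda>i y. rep_l2 (g i) y * rep_l2 q y"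
  have F: "integrable std_measure (?F i)" and G: "integrable std_measure (?G i)" for i
    by (intro square_integrable_mult square_integrable_rep_l2)+
  have c1: "cinner (f i) (l2_cnj p) = (\<integral>x. ?F i x \<partial>std_measure)" for i
    unfolding cinner_l2
  proof (rule integral_cong_AE)
    show "AE x in std_measure. rep_l2 (f i) x * cnj (rep_l2 (l2_cnj p) x) = ?F i x"
      using rep_l2_cnj[of p] by eventually_elim simp
  qed ((rule borel_measurable_integrable, intro square_integrable_mult square_integrable_cnj square_integrable_rep_l2)+)
  have c2: "cinner q (l2_cnj (g i)) = (\<integral>y. ?G i y \<partial>std_measure)" for i
    unfolding cinner_l2
  proof (rule integral_cong_AE)
    show "AE x in std_measure. rep_l2 q x * cnj (rep_l2 (l2_cnj (g i)) x) = ?G i x"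
      using rep_l2_cnj[of "g i"] by eventually_elim (simp add: mult.commute)
  qed ((rule borel_measurable_integrable, intro square_integrable_mult square_integrable_cnj square_integrable_rep_l2)+)
  have "(\<lambda>i. integral\<^sup>L ?P (\<lambda>z. ?F i (fst z) * ?G i (snd z)))
      sums (\<integral>z. (\<Sum>i. ?F i (fst z) * ?G i (snd z)) \<partial>?P)"
  proof (rule sums_integral)
    show "integrable ?P (\<lambda>z. ?F i (fst z) * ?G i (snd z))" for i
      by (rule integrable_times[OF F G])
    show "AE z in ?P. summable (\<lambda>i. norm (?F i (fst z) * ?G i (snd z)))"
      using AE_summable_tensor[OF f g]
    proof eventually_elim
      case (elim z)
      from summable_mult[OF elim, of "norm (rep_l2 p (fst z) * rep_l2 q (snd z))"]
      show ?case by (simp add: norm_mult mult_ac)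
    qed
    show "summable (\<lambda>i. \<integral>z. norm (?F i (fst z) * ?G i (snd z)) \<partial>?P)"
    proof (rule summable_comparison_test')
      show "summable (\<lambda>i. (norm p * norm q) * (norm (f i) * norm (g i)))"
        by (intro summable_mult square_summable_mult f g)
      fix i
      have "(\<integral>z. norm (?F i (fst z) * ?G i (snd z)) \<partial>?P)
          = (\<integral>x. cmod (?F i x) \<partial>std_measure) * (\<integral>y. cmod (?G i y) \<partial>std_measure)"
        using integrable_times(2)[OF integrable_norm[OF F[of i]] integrable_norm[OF G[of i]]]
        by (simp add: norm_mult)
      also have "\<dots> \<le> (norm (f i) * norm p) * (norm (g i) * norm q)"
        by (intro mult_mono integral_norm_mult_l2_le) auto
      finally show "norm (\<integral>z. norm (?F i (fst z) * ?G i (snd z)) \<partial>?P)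
          \<le> (norm p * norm q) * (norm (f i) * norm (g i))"
        by (simp add: mult_ac)
    qed
  qed
  then have "(\<lambda>i. cinner (cblinfun_apply (rank1 (l2_cnj p) q) (f i)) (l2_cnj (g i)))
      sums (\<integral>z. (\<Sum>i. ?F i (fst z) * ?G i (snd z)) \<partial>?P)"
    by (simp only: integrable_times(2)[OF F G] rank1.rep_eq cinner_scaleC_left c1 c2)
  then have "trace_pairing (rank1 (l2_cnj p) q) f (\<lambda>i. l2_cnj (g i))
      = (\<integral>z. (\<Sum>i. ?F i (fst z) * ?G i (snd z)) \<partial>?P)"
    unfolding trace_pairing_def by (rule sums_unique[symmetric])
  also have "\<dots> = (\<integral>z. tensor_sum f g z * (rep_l2 p (fst z) * rep_l2 q (snd z)) \<partial>?P)"
  proof (rule integral_cong_AE)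
    show "AE z in ?P. (\<Sum>i. ?F i (fst z) * ?G i (snd z)) = tensor_sum f g z * (rep_l2 p (fst z) * rep_l2 q (snd z))"
      using AE_summable_tensor[OF f g]
    proof eventually_elim
      case (elim z)
      from suminf_mult2[OF summable_norm_cancel[OF elim], of "rep_l2 p (fst z) * rep_l2 q (snd z)"]
      show ?case by (simp add: tensor_sum_def mult_ac)
    qed
  qed measurable
  finally show ?thesis .
qed

text \<open>Constants need not be square integrable, so \<open>w\<close> and its analogue
  \<open>v\<close> replace them: \<open>w \<otimes> v\<close> is a member of \<open>Gamma\<close>
  that vanishes almost nowhere. Sigma-finiteness provides \<open>r\<close>, and
  \<open>r \<le> 1\<close> makes its square integrable too.\<close>

lemma ex_positive_l2:
  "\<exists>(w :: 'a::standard_measure_space l2) r. r \<in> borel_measurable std_measure \<and> (\<forall>x. 0 < r x) \<and>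
    (AE x in std_measure. rep_l2 w x = complex_of_real (r x))"
proof -
  obtain r :: "'a \<Rightarrow> real" where r: "r \<in> borel_measurable std_measure" "\<And>x. r x > 0" "\<And>x. r x \<le> 1"
    "integrable std_measure r"
    using sigma_finite_measure.obtain_positive_integrable_function[OF sigma_finite_std_measure] by metis
  have [measurable]: "r \<in> borel_measurable std_measure" by fact
  have "integrable std_measure (\<lambda>x. (r x)\<^sup>2)"
  proof (rule Bochner_Integration.integrable_bound[OF r(4)])
    have "(r x)\<^sup>2 \<le> r x" for x
      using mult_left_mono[OF r(3)[of x], of "r x"] r(2)[of x] by (simp add: power2_eq_square)
    then show "AE x in std_measure. norm ((r x)\<^sup>2) \<le> norm (r x)"
      by (auto intro: order_trans[OF _ abs_ge_self])
  qed measurable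
  then have "square_integrable (\<lambda>x. complex_of_real (r x))"
    by (simp add: square_integrable_def)
  from rep_abs_l2[OF this] show ?thesis using r by blast
qed

text \<open>Testing \<open>\<Phi> \<circ> \<Phi> = \<Phi>\<close> on rank one operators against \<open>w \<otimes> v\<close> shows that
  \<open>(\<phi>\<^sup>2 - \<phi>) w\<^sup>2 v\<^sup>2\<close> has zero integral over every rectangle; \<open>w\<close> and \<open>v\<close> are strictly positive.\<close>

lemma schur_multiplier_idempotent:
  fixes \<phi> :: "'a::standard_measure_space \<times> 'b::standard_measure_space \<Rightarrow> complex"
  assumes S: "schur_map \<phi> \<Phi>" and idem: "\<Phi> \<circ> \<Phi> = \<Phi>"
  shows "AE z in std_measure \<Otimes>\<^sub>M std_measure. \<phi> z = 0 \<or> \<phi> z = 1"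
proof -
  interpret pair_sigma_finite "std_measure :: 'a measure" "std_measure :: 'b measure"
    by (rule pair_sigma_finite_std_measure)
  let ?P = "std_measure \<Otimes>\<^sub>M std_measure :: ('a \<times> 'b) measure"
  have \<phi>: "\<phi> \<in> L_infinity ?P" using S by (simp add: schur_map_def schur_multiplier_def)
  then have [measurable]: "\<phi> \<in> borel_measurable ?P" by (simp add: L_infinity_def)
  obtain C where C: "AE z in ?P. cmod (\<phi> z) \<le> C" using \<phi> by (auto simp: L_infinity_def)
  obtain w :: "'a l2" and r where w: "\<And>x. 0 < r x" "AE x in std_measure. rep_l2 w x = complex_of_real (r x)"
    using ex_positive_l2[where 'a = 'a] by blast
  obtain v :: "'b l2" and s where v: "\<And>y. 0 < s y" "AE y in std_measure. rep_l2 v y = complex_of_real (s y)"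
    using ex_positive_l2[where 'a = 'b] by blast
  let ?k = "\<lambda>z. rep_l2 w (fst z) * rep_l2 v (snd z)"
  let ?h = "tensor_sum (single w) (single v)"
  have pos: "AE z in ?P. ?k z \<noteq> 0"
    using AE_pair_fst[OF sigma_finite_std_measure w(2)] AE_pair_snd[OF sigma_finite_std_measure v(2)]
    by eventually_elim (use w(1) v(1) in \<open>simp add: less_imp_neq[symmetric]\<close>)
  have hk: "AE z in ?P. ?h z = ?k z"
  proof -
    have "AE z in ?P. rep_l2 (0::'a l2) (fst z) = 0"
      by (rule AE_pair_fst[OF sigma_finite_std_measure rep_l2_zero])
    then show ?thesis
    proof eventually_elim
      case (elim z)
      have "?h z = (\<Sum>i\<in>{0}. rep_l2 (single w i) (fst z) * rep_l2 (single v i) (snd z))"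
        unfolding tensor_sum_def by (rule suminf_finite) (auto simp: single_def elim)
      then show ?case by (simp add: single_def)
    qed
  qed
  have h0: "Gamma_expansion (single w) (single v) ?h"
    by (intro Gamma_expansion_tensor_sum square_summable_single)
  obtain f1 g1 where h1: "Gamma_expansion f1 g1 (\<lambda>z. \<phi> z * ?h z)"
    using schur_map_expansion[OF S h0] by blast
  obtain f2 g2 where h2: "Gamma_expansion f2 g2 (\<lambda>z. \<phi> z * (\<phi> z * ?h z))"
    using schur_map_expansion[OF S h1] by blast
  have sq: "square_summable f1" "square_summable g1" "square_summable f2" "square_summable g2"
    using h1 h2 by (auto simp: Gamma_expansion_def)
  \<comment> \<open>Idempotence in the predual: multiplying \<open>?h\<close> by
    \<open>\<phi>\<close> once or twice gives elements that no operator \<open>T\<close>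
    distinguishes.\<close>
  have eq: "trace_pairing T f1 (\<lambda>i. l2_cnj (g1 i)) = trace_pairing T f2 (\<lambda>i. l2_cnj (g2 i))" for T
  proof -
    have "\<Phi> (\<Phi> T) = \<Phi> T" using idem by (metis comp_apply)
    then show ?thesis
      using schur_map_pairing[OF S h0 h1, of T] schur_map_pairing[OF S h0 h1, of "\<Phi> T"]
        schur_map_pairing[OF S h1 h2, of T] by simp
  qed
  \<comment> \<open>One factor \<open>?k\<close> is the function being multiplied; the other comes
    from the vectors of the rank one test operators.\<close>
  let ?W = "\<lambda>z. (\<phi> z * \<phi> z - \<phi> z) * (?k z * ?k z)"
  have t1: "AE z in ?P. tensor_sum f1 g1 z = \<phi> z * ?k z"
    using Gamma_expansion_AE_eq[OF h1] hk by eventually_elim simp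
  have t2: "AE z in ?P. tensor_sum f2 g2 z = \<phi> z * \<phi> z * ?k z"
    using Gamma_expansion_AE_eq[OF h2] hk by eventually_elim (simp add: mult.assoc)
  have k2: "integrable ?P (\<lambda>z. ?k z * ?k z)"
    using integrable_times(1)[OF square_integrable_mult square_integrable_mult,
        OF square_integrable_rep_l2[of w] square_integrable_rep_l2[of w]
          square_integrable_rep_l2[of v] square_integrable_rep_l2[of v]]
    by (simp add: mult_ac)
  have bdd: "integrable ?P (\<lambda>z. a z * (?k z * ?k z))"
    if [measurable]: "a \<in> borel_measurable ?P" and a: "AE z in ?P. cmod (a z) \<le> K" for a K
  proof (rule Bochner_Integration.integrable_bound)
    show "integrable ?P (\<lambda>z. of_real K * (?k z * ?k z))" using k2 by (rule integrable_mult_right)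
    show "AE z in ?P. norm (a z * (?k z * ?k z)) \<le> norm (of_real K * (?k z * ?k z))"
      using a by eventually_elim (auto simp: norm_mult intro!: mult_right_mono)
  qed measurable
  have i1: "integrable ?P (\<lambda>z. \<phi> z * (?k z * ?k z))" by (rule bdd[OF _ C]) measurable
  have i2: "integrable ?P (\<lambda>z. \<phi> z * \<phi> z * (?k z * ?k z))"
  proof (rule bdd[where K = "C * C"])
    show "AE z in ?P. cmod (\<phi> z * \<phi> z) \<le> C * C"
      using C by eventually_elim (simp add: norm_mult mult_mono')
  qed measurable
  have W: "integrable ?P ?W"
    using Bochner_Integration.integrable_diff[OF i2 i1] by (simp add: left_diff_distrib)
  have "AE z in ?P. ?W z = 0"
  proof (rule AE_zero_of_rectangles[OF W])
    fix E :: "'a set" and F :: "'b set"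
    assume E[measurable]: "E \<in> sets std_measure" and F[measurable]: "F \<in> sets std_measure"
    let ?p = "cblinfun_apply (cutoff E) w" and ?q = "cblinfun_apply (cutoff F) v"
    have pq: "AE z in ?P. rep_l2 ?p (fst z) * rep_l2 ?q (snd z) = indicator (E \<times> F) z *\<^sub>R ?k z"
      using AE_pair_fst[OF sigma_finite_std_measure rep_l2_cutoff[OF E, of w]]
        AE_pair_snd[OF sigma_finite_std_measure rep_l2_cutoff[OF F, of v]]
      by eventually_elim (auto simp: indicator_def mem_Times_iff)
    have [measurable]: "E \<times> F \<in> sets ?P" by measurable
    have c1: "(\<integral>z. tensor_sum f1 g1 z * (rep_l2 ?p (fst z) * rep_l2 ?q (snd z)) \<partial>?P)
        = (\<integral>z. indicator (E \<times> F) z *\<^sub>R (\<phi> z * (?k z * ?k z)) \<partial>?P)"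
    proof (rule integral_cong_AE)
      show "AE z in ?P. tensor_sum f1 g1 z * (rep_l2 ?p (fst z) * rep_l2 ?q (snd z))
          = indicator (E \<times> F) z *\<^sub>R (\<phi> z * (?k z * ?k z))"
        using t1 pq by eventually_elim simp
    qed measurable
    have c2: "(\<integral>z. tensor_sum f2 g2 z * (rep_l2 ?p (fst z) * rep_l2 ?q (snd z)) \<partial>?P)
        = (\<integral>z. indicator (E \<times> F) z *\<^sub>R (\<phi> z * \<phi> z * (?k z * ?k z)) \<partial>?P)"
    proof (rule integral_cong_AE)
      show "AE z in ?P. tensor_sum f2 g2 z * (rep_l2 ?p (fst z) * rep_l2 ?q (snd z))
          = indicator (E \<times> F) z *\<^sub>R (\<phi> z * \<phi> z * (?k z * ?k z))"
        using t2 pq by eventually_elim simp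
    qed measurable
    have "(LINT z:E \<times> F|?P. ?W z)
        = (\<integral>z. indicator (E \<times> F) z *\<^sub>R (\<phi> z * \<phi> z * (?k z * ?k z))
            - indicator (E \<times> F) z *\<^sub>R (\<phi> z * (?k z * ?k z)) \<partial>?P)"
      unfolding set_lebesgue_integral_def by (simp only: left_diff_distrib scaleR_diff_right)
    also have "\<dots> = (\<integral>z. indicator (E \<times> F) z *\<^sub>R (\<phi> z * \<phi> z * (?k z * ?k z)) \<partial>?P)
        - (\<integral>z. indicator (E \<times> F) z *\<^sub>R (\<phi> z * (?k z * ?k z)) \<partial>?P)"
      by (intro Bochner_Integration.integral_diff integrable_mult_indicator i1 i2) measurable
    also have "\<dots> = 0"
      unfolding c1[symmetric] c2[symmetric] trace_pairing_rank1[OF sq(1,2), symmetric]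
        trace_pairing_rank1[OF sq(3,4), symmetric] eq by simp
    finally show "(LINT z:E \<times> F|?P. ?W z) = 0" .
  qed
  then show ?thesis
    using pos by eventually_elim (auto simp: algebra_simps)
qed

section \<open>Schur idempotents are locally trivial\<close>

lemma finite_partition_small_oscillation:
  fixes a :: "nat \<Rightarrow> 'a \<Rightarrow> complex"
  assumes a [measurable]: "\<And>i. a i \<in> borel_measurable M" and X: "X \<in> sets M"
    and bound: "\<And>x i. x \<in> X \<Longrightarrow> i < n \<Longrightarrow> cmod (a i x) \<le> K" and \<delta>: "\<delta> > 0"
  shows "\<exists>\<E>. finite \<E> \<and> \<E> \<subseteq> sets M \<and> disjoint \<E> \<and> \<Union>\<E> = X \<and>
    (\<forall>E\<in>\<E>. \<forall>x\<in>E. \<forall>x'\<in>E. \<forall>i<n. cmod (a i x - a i x') \<le> \<delta>)"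
proof -
  \<comment> \<open>Cells are the level sets of the coordinates rounded to a mesh of
    \<open>\<delta> / 2\<close>: real and imaginary parts then each vary by at most half of
    \<open>\<delta>\<close>.\<close>
  define m where "m = 2 / \<delta>"
  have m: "m > 0" using \<delta> by (simp add: m_def)
  define c where "c x = map (\<lambda>i. (\<lfloor>m * Re (a i x)\<rfloor>, \<lfloor>m * Im (a i x)\<rfloor>)) [0..<n]" for x
  have c_eq: "c x = c x' \<longleftrightarrow> (\<forall>i\<in>{..<n}. \<lfloor>m * Re (a i x)\<rfloor> = \<lfloor>m * Re (a i x')\<rfloor> \<and>
      \<lfloor>m * Im (a i x)\<rfloor> = \<lfloor>m * Im (a i x')\<rfloor>)" for x x'
    by (auto simp: c_def)
  define \<E> where "\<E> = (\<lambda>x. {x' \<in> X. c x' = c x}) ` X"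
  have "finite (c ` X)"
  proof (rule finite_subset)
    let ?B = "{- \<lceil>m * K\<rceil> - 1 .. \<lceil>m * K\<rceil> + 1}"
    have fl: "\<lfloor>m * t\<rfloor> \<in> ?B" if "\<bar>t\<bar> \<le> K" for t
    proof -
      have "m * t \<le> m * K" "- (m * K) \<le> m * t"
        using mult_left_mono[of t K m] mult_left_mono[of "-K" t m] that m by auto
      then show ?thesis by (simp add: floor_le_iff le_floor_iff) linarith
    qed
    show "c ` X \<subseteq> {l. set l \<subseteq> ?B \<times> ?B \<and> length l = n}"
      using bound by (auto simp del: atLeastAtMost_iff simp: c_def
          intro!: fl order_trans[OF abs_Re_le_cmod] order_trans[OF abs_Im_le_cmod])
    show "finite {l. set l \<subseteq> ?B \<times> ?B \<and> length l = n}"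
      by (rule finite_lists_length_eq) simp
  qed
  moreover have "\<E> = (\<lambda>l. {x' \<in> X. c x' = l}) ` (c ` X)" by (auto simp: \<E>_def)
  ultimately have "finite \<E>" by simp
  moreover have "\<E> \<subseteq> sets M"
  proof
    fix E assume "E \<in> \<E>"
    then obtain x where x: "E = {x' \<in> X. c x' = c x}" by (auto simp: \<E>_def)
    have "E = X \<inter> {x' \<in> space M. \<forall>i\<in>{..<n}. \<lfloor>m * Re (a i x')\<rfloor> = \<lfloor>m * Re (a i x)\<rfloor> \<and>
      \<lfloor>m * Im (a i x')\<rfloor> = \<lfloor>m * Im (a i x)\<rfloor>}"
      using sets.sets_into_space[OF X] unfolding x c_eq by auto
    moreover have "{x' \<in> space M. \<forall>i\<in>{..<n}. \<lfloor>m * Re (a i x')\<rfloor> = \<lfloor>m * Re (a i x)\<rfloor> \<and>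
      \<lfloor>m * Im (a i x')\<rfloor> = \<lfloor>m * Im (a i x)\<rfloor>} \<in> sets M"
      by measurable
    ultimately show "E \<in> sets M" using X by simp
  qed
  moreover have "disjoint \<E>" by (auto simp: \<E>_def disjoint_def)
  moreover have "\<Union>\<E> = X" by (auto simp: \<E>_def)
  moreover have "cmod (a i x - a i x') \<le> \<delta>" if "E \<in> \<E>" "x \<in> E" "x' \<in> E" "i < n" for E x x' i
  proof -
    have close: "\<bar>s - t\<bar> \<le> \<delta> / 2" if "\<lfloor>m * s\<rfloor> = \<lfloor>m * t\<rfloor>" for s t
    proof -
      have "\<bar>m * s - m * t\<bar> \<le> 1"
        using that floor_correct[of "m * s"] floor_correct[of "m * t"] by linarith
      then have "m * \<bar>s - t\<bar> \<le> 1" using m by (simp add: abs_mult flip: right_diff_distrib)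
      then show ?thesis using \<delta> by (simp add: m_def field_simps)
    qed
    have "c x = c x'" using that by (auto simp: \<E>_def)
    then have "\<bar>Re (a i x - a i x')\<bar> \<le> \<delta> / 2" "\<bar>Im (a i x - a i x')\<bar> \<le> \<delta> / 2"
      using that(4) close by (auto simp: c_eq)
    then show ?thesis using cmod_le[of "a i x - a i x'"] by linarith
  qed
  ultimately show ?thesis by (intro exI[of _ \<E>] conjI ballI allI impI)
qed

text \<open>The index \<open>n\<close> is both the length of the head and the bound on its terms, so
  that each point with a square summable sequence is eventually included. Bounding all partial sums
  of the tail encodes its summability together with the size of its sum. The value 1/8 leaves room
  for two tails and the oscillation of the head below 1.\<close>

definition tail_small :: "'a measure \<Rightarrow> (nat \<Rightarrow> 'a \<Rightarrow> complex) \<Rightarrow> nat \<Rightarrow> 'a set" where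
  "tail_small M a n = {x \<in> space M. (\<forall>i<n. cmod (a i x) \<le> real n) \<and>
    (\<forall>N. (\<Sum>i<N. (cmod (a (i + n) x))\<^sup>2) \<le> 1/8)}"

lemma tail_small_measurable:
  assumes [measurable]: "\<And>i. a i \<in> borel_measurable M"
  shows "tail_small M a n \<in> sets M"
proof -
  have "tail_small M a n = {x \<in> space M. (\<forall>i\<in>{..<n}. cmod (a i x) \<le> real n) \<and>
    (\<forall>N. (\<Sum>i<N. (cmod (a (i + n) x))\<^sup>2) \<le> 1/8)}"
    by (auto simp: tail_small_def)
  also have "\<dots> \<in> sets M" by measurable
  finally show ?thesis .
qed

lemma eventually_tail_small:
  assumes s: "summable (\<lambda>i. (cmod (a i x))\<^sup>2)" and x: "x \<in> space M"
  shows "\<forall>\<^sub>F n in sequentially. x \<in> tail_small M a n"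
proof -
  obtain N where N: "\<And>m n. m \<ge> N \<Longrightarrow> norm (\<Sum>i=m..<n. (cmod (a i x))\<^sup>2) < 1/8"
    using s unfolding summable_Cauchy by (meson zero_less_divide_1_iff zero_less_numeral)
  have "Bseq (\<lambda>i. (cmod (a i x))\<^sup>2)"
    using summable_LIMSEQ_zero[OF s] by (intro convergent_imp_Bseq convergentI)
  then obtain C where C: "C > 0" "\<And>i. (cmod (a i x))\<^sup>2 \<le> C" by (auto simp: Bseq_def)
  obtain K :: nat where K: "sqrt C \<le> real K" using real_arch_simple by blast
  have "x \<in> tail_small M a n" if "n \<ge> max N K" for n
  proof -
    have "cmod (a i x) \<le> real n" for i
      using real_le_rsqrt[OF C(2)[of i]] K that by linarith
    moreover have "(\<Sum>i<k. (cmod (a (i + n) x))\<^sup>2) \<le> 1/8" for k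
    proof -
      have "(\<Sum>i<k. (cmod (a (i + n) x))\<^sup>2) = (\<Sum>i=0+n..<k+n. (cmod (a i x))\<^sup>2)"
        unfolding sum.shift_bounds_nat_ivl by (simp add: atLeast0LessThan)
      also have "\<dots> \<le> 1/8" using N[of n "k + n"] that by (simp add: abs_le_iff)
      finally show ?thesis .
    qed
    ultimately show ?thesis using x by (simp add: tail_small_def)
  qed
  then show ?thesis by (rule eventually_sequentiallyI)
qed

text \<open>The inequality of arithmetic and geometric means bounds the tail of the products by the
  average of the two tails of squares.\<close>

lemma tail_small_tail:
  assumes x: "x \<in> tail_small M a n" and y: "y \<in> tail_small N b n"
    and s: "(\<lambda>i. a i x * b i y) sums c"
  shows "cmod (c - (\<Sum>i<n. a i x * b i y)) \<le> 1/8"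
proof -
  have sum8: "summable (\<lambda>i. (cmod (f (i + n) t))\<^sup>2) \<and> (\<Sum>i. (cmod (f (i + n) t))\<^sup>2) \<le> 1/8"
    if "t \<in> tail_small L f n" for t L f
  proof -
    have bd: "(\<Sum>i<k. (cmod (f (i + n) t))\<^sup>2) \<le> 1/8" for k using that by (simp add: tail_small_def)
    have "summable (\<lambda>i. (cmod (f (i + n) t))\<^sup>2)"
      by (rule summableI_nonneg_bounded[OF _ bd]) simp
    then show ?thesis using suminf_le_const bd by blast
  qed
  note sx = sum8[OF x] and sy = sum8[OF y]
  have sm: "summable (\<lambda>i. ((cmod (a (i + n) x))\<^sup>2 + (cmod (b (i + n) y))\<^sup>2) / 2)"
    using sx sy by (intro summable_divide summable_add) auto
  have le: "norm (a (i + n) x * b (i + n) y) \<le> ((cmod (a (i + n) x))\<^sup>2 + (cmod (b (i + n) y))\<^sup>2) / 2" for i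
    using sum_squares_bound[of "cmod (a (i + n) x)" "cmod (b (i + n) y)"] by (simp add: norm_mult)
  have "c - (\<Sum>i<n. a i x * b i y) = (\<Sum>i. a (i + n) x * b (i + n) y)"
    using sums_split_initial_segment[OF s, of n] by (simp add: sums_iff)
  also have "cmod \<dots> \<le> (\<Sum>i. ((cmod (a (i + n) x))\<^sup>2 + (cmod (b (i + n) y))\<^sup>2) / 2)"
    by (rule norm_suminf_le[OF le sm])
  also have "\<dots> = ((\<Sum>i. (cmod (a (i + n) x))\<^sup>2) + (\<Sum>i. (cmod (b (i + n) y))\<^sup>2)) / 2"
    using sx sy by (subst suminf_divide) (auto intro: summable_add simp: suminf_add)
  also have "\<dots> \<le> 1/8" using sx[THEN conjunct2] sy[THEN conjunct2] by simp
  finally show ?thesis .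
qed

text \<open>Each of the \<open>n\<close> head terms varies by at most \<open>2 * n\<close> times the
  mesh, in total at most 1/4; the two tails add 1/8 each. The \<open>+ 1\<close> in the mesh keeps
  it positive at \<open>n = 0\<close>.\<close>

lemma cell_oscillation:
  assumes xs: "x \<in> tail_small M a n" "x' \<in> tail_small M a n" "y \<in> tail_small N b n" "y' \<in> tail_small N b n"
    and ax: "\<And>i. i < n \<Longrightarrow> cmod (a i x - a i x') \<le> 1 / (8 * (real n + 1)\<^sup>2)"
    and by': "\<And>i. i < n \<Longrightarrow> cmod (b i y - b i y') \<le> 1 / (8 * (real n + 1)\<^sup>2)"
    and c: "(\<lambda>i. a i x * b i y) sums c" "(\<lambda>i. a i x' * b i y') sums c'"
  shows "cmod (c - c') < 1"
proof -
  let ?d = "1 / (8 * (real n + 1)\<^sup>2)"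
  let ?S = "\<Sum>i<n. a i x * b i y" and ?S' = "\<Sum>i<n. a i x' * b i y'"
  have "cmod (a i x * b i y - a i x' * b i y') \<le> 2 * real n * ?d" if "i < n" for i
  proof -
    have "a i x * b i y - a i x' * b i y' = a i x * (b i y - b i y') + (a i x - a i x') * b i y'"
      by (simp add: algebra_simps)
    then have "cmod (a i x * b i y - a i x' * b i y')
        \<le> cmod (a i x) * cmod (b i y - b i y') + cmod (a i x - a i x') * cmod (b i y')"
      by (metis norm_mult norm_triangle_ineq)
    also have "\<dots> \<le> real n * ?d + ?d * real n"
      using xs that by (intro add_mono mult_mono ax by') (auto simp: tail_small_def)
    finally show ?thesis by simp
  qed
  then have "cmod (?S - ?S') \<le> (\<Sum>i<n. 2 * real n * ?d)"
    unfolding sum_subtractf[symmetric] by (intro sum_norm_le) auto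
  also have "\<dots> = 2 * (real n)\<^sup>2 * ?d" by (simp add: power2_eq_square)
  also have "\<dots> \<le> 1/4"
  proof -
    have "(real n)\<^sup>2 \<le> (real n + 1)\<^sup>2" by (intro power_mono) auto
    then show ?thesis by (simp add: divide_simps)
  qed
  finally have "cmod (?S - ?S') \<le> 1/4" .
  moreover have "cmod (c - ?S) \<le> 1/8" "cmod (c' - ?S') \<le> 1/8"
    using tail_small_tail[OF xs(1) xs(3) c(1)] tail_small_tail[OF xs(2) xs(4) c(2)] by simp_all
  moreover have "cmod (c - c') \<le> cmod (c - ?S) + cmod (?S - ?S') + cmod (c' - ?S')"
  proof -
    have "cmod ((c - ?S) + (?S - ?S') - (c' - ?S')) \<le> cmod (c - ?S) + cmod (?S - ?S') + cmod (c' - ?S')"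
      by (intro order_trans[OF norm_triangle_ineq4] add_right_mono norm_triangle_ineq)
    then show ?thesis by simp
  qed
  ultimately show ?thesis by linarith
qed

text \<open>Dividing an expansion of \<open>\<phi> (w \<otimes> v)\<close> by \<open>w \<otimes> v\<close> gives \<open>\<phi> = (\<Sum>i. a i \<otimes> b i)\<close>. On a cell of the
  grid \<open>\<phi>\<close> varies by less than 1, and it takes the values 0 and 1 only.\<close>

lemma schur_idempotent_grid:
  fixes \<phi> :: "'a::standard_measure_space \<times> 'b::standard_measure_space \<Rightarrow> complex"
  assumes S: "schur_map \<phi> \<Phi>" and idem: "\<Phi> \<circ> \<Phi> = \<Phi>"
  shows "\<exists>\<E> \<F>.
    (\<forall>n. finite (\<E> n) \<and> \<E> n \<subseteq> sets std_measure \<and> disjoint (\<E> n)) \<and>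
    (\<forall>n. finite (\<F> n) \<and> \<F> n \<subseteq> sets std_measure \<and> disjoint (\<F> n)) \<and>
    (AE x in std_measure. \<forall>\<^sub>F n in sequentially. x \<in> \<Union>(\<E> n)) \<and>
    (AE y in std_measure. \<forall>\<^sub>F n in sequentially. y \<in> \<Union>(\<F> n)) \<and>
    (\<forall>n. \<forall>E\<in>\<E> n. \<forall>F\<in>\<F> n.
      (AE z in std_measure \<Otimes>\<^sub>M std_measure. z \<in> E \<times> F \<longrightarrow> \<phi> z = 0) \<or>
      (AE z in std_measure \<Otimes>\<^sub>M std_measure. z \<in> E \<times> F \<longrightarrow> \<phi> z = 1))"
proof -
  let ?P = "std_measure \<Otimes>\<^sub>M std_measure :: ('a \<times> 'b) measure"
  obtain w :: "'a l2" and r where r[measurable]: "r \<in> borel_measurable std_measure"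
    and w: "\<And>x. 0 < r x" "AE x in std_measure. rep_l2 w x = complex_of_real (r x)"
    using ex_positive_l2[where 'a = 'a] by blast
  obtain v :: "'b l2" and s where s[measurable]: "s \<in> borel_measurable std_measure"
    and v: "\<And>y. 0 < s y" "AE y in std_measure. rep_l2 v y = complex_of_real (s y)"
    using ex_positive_l2[where 'a = 'b] by blast
  have "Gamma_expansion (single w) (single v) (\<lambda>z. rep_l2 w (fst z) * rep_l2 v (snd z))"
    unfolding Gamma_expansion_def
  proof (intro conjI square_summable_single)
    show "AE z in ?P. (\<lambda>i. rep_l2 (single w i) (fst z) * rep_l2 (single v i) (snd z))
        sums (rep_l2 w (fst z) * rep_l2 v (snd z))"
      using AE_pair_fst[OF sigma_finite_std_measure rep_l2_zero]
    proof eventually_elim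
      case (elim z)
      have "(\<lambda>i. rep_l2 (single w i) (fst z) * rep_l2 (single v i) (snd z))
          sums (\<Sum>i\<in>{0}. rep_l2 (single w i) (fst z) * rep_l2 (single v i) (snd z))"
        by (rule sums_finite) (auto simp: single_def elim)
      then show ?case by (simp add: single_def)
    qed
  qed
  then obtain f g where fg: "Gamma_expansion f g (\<lambda>z. \<phi> z * (rep_l2 w (fst z) * rep_l2 v (snd z)))"
    using schur_map_expansion[OF S] by blast
  define a where "a i x = rep_l2 (f i) x / complex_of_real (r x)" for i x
  define b where "b i y = rep_l2 (g i) y / complex_of_real (s y)" for i y
  have [measurable]: "a i \<in> borel_measurable std_measure" "b i \<in> borel_measurable std_measure" for i
    unfolding a_def[abs_def] b_def[abs_def] by measurable
  have sf: "square_summable f" and sg: "square_summable g"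
    using fg by (auto simp: Gamma_expansion_def)
  have sums: "AE z in ?P. (\<lambda>i. a i (fst z) * b i (snd z)) sums \<phi> z"
  proof -
    have "AE z in ?P. (\<lambda>i. rep_l2 (f i) (fst z) * rep_l2 (g i) (snd z))
        sums (\<phi> z * (rep_l2 w (fst z) * rep_l2 v (snd z)))"
      using fg by (simp add: Gamma_expansion_def)
    with AE_pair_fst[OF sigma_finite_std_measure w(2)] AE_pair_snd[OF sigma_finite_std_measure v(2)]
    show ?thesis
    proof eventually_elim
      case (elim z)
      have "r (fst z) \<noteq> 0" "s (snd z) \<noteq> 0" using w(1)[of "fst z"] v(1)[of "snd z"] by auto
      then show ?case
        using sums_divide[OF elim(3), of "rep_l2 w (fst z) * rep_l2 v (snd z)"] elim(1,2)
        by (simp add: a_def b_def)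
    qed
  qed
  have A: "AE x in std_measure. summable (\<lambda>i. (cmod (a i x))\<^sup>2)"
    using AE_summable_square_rep_l2[OF sf]
    by eventually_elim (simp add: a_def norm_divide power_divide summable_divide)
  have B: "AE y in std_measure. summable (\<lambda>i. (cmod (b i y))\<^sup>2)"
    using AE_summable_square_rep_l2[OF sg]
    by eventually_elim (simp add: b_def norm_divide power_divide summable_divide)
  let ?X = "tail_small std_measure a" and ?Y = "tail_small std_measure b"
  let ?d = "\<lambda>n. 1 / (8 * (real n + 1)\<^sup>2)"
  have d: "?d n > 0" for n by simp
  have "\<exists>\<E>. finite \<E> \<and> \<E> \<subseteq> sets std_measure \<and> disjoint \<E> \<and> \<Union>\<E> = ?X n \<and>
      (\<forall>E\<in>\<E>. \<forall>x\<in>E. \<forall>x'\<in>E. \<forall>i<n. cmod (a i x - a i x') \<le> ?d n)" for n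
    by (rule finite_partition_small_oscillation[where K = "real n", OF _ tail_small_measurable _ d])
      (auto simp: tail_small_def)
  then obtain \<E> where E: "\<And>n. finite (\<E> n)" "\<And>n. \<E> n \<subseteq> sets std_measure" "\<And>n. disjoint (\<E> n)"
    "\<And>n. \<Union>(\<E> n) = ?X n"
    and oscE: "\<And>n E x x' i. E \<in> \<E> n \<Longrightarrow> x \<in> E \<Longrightarrow> x' \<in> E \<Longrightarrow> i < n \<Longrightarrow> cmod (a i x - a i x') \<le> ?d n"
    by metis
  have "\<exists>\<F>. finite \<F> \<and> \<F> \<subseteq> sets std_measure \<and> disjoint \<F> \<and> \<Union>\<F> = ?Y n \<and>
      (\<forall>F\<in>\<F>. \<forall>y\<in>F. \<forall>y'\<in>F. \<forall>i<n. cmod (b i y - b i y') \<le> ?d n)" for n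
    by (rule finite_partition_small_oscillation[where K = "real n", OF _ tail_small_measurable _ d])
      (auto simp: tail_small_def)
  then obtain \<F> where F: "\<And>n. finite (\<F> n)" "\<And>n. \<F> n \<subseteq> sets std_measure" "\<And>n. disjoint (\<F> n)"
    "\<And>n. \<Union>(\<F> n) = ?Y n"
    and oscF: "\<And>n F y y' i. F \<in> \<F> n \<Longrightarrow> y \<in> F \<Longrightarrow> y' \<in> F \<Longrightarrow> i < n \<Longrightarrow> cmod (b i y - b i y') \<le> ?d n"
    by metis
  have good: "AE z in ?P. (\<lambda>i. a i (fst z) * b i (snd z)) sums \<phi> z \<and> (\<phi> z = 0 \<or> \<phi> z = 1)"
    using sums schur_multiplier_idempotent[OF S idem] by eventually_elim blast
  have cell: "(AE z in ?P. z \<in> E \<times> F \<longrightarrow> \<phi> z = 0) \<or> (AE z in ?P. z \<in> E \<times> F \<longrightarrow> \<phi> z = 1)"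
    if EF: "E \<in> \<E> n" "F \<in> \<F> n" for n E F
  \<comment> \<open>The expansion is valid only almost everywhere, so the case distinction looks for
    one point where it holds and \<open>\<phi>\<close> is 1. Such a point forces the value 1 at
    almost every point of the cell; without one the value is almost everywhere 0.\<close>
  proof (cases "\<exists>z0\<in>E \<times> F. (\<lambda>i. a i (fst z0) * b i (snd z0)) sums \<phi> z0 \<and> \<phi> z0 = 1")
    case True
    then obtain z0 where z0: "z0 \<in> E \<times> F" "(\<lambda>i. a i (fst z0) * b i (snd z0)) sums \<phi> z0" "\<phi> z0 = 1"
      by blast
    have "AE z in ?P. z \<in> E \<times> F \<longrightarrow> \<phi> z = 1"
      using good
    proof eventually_elim
      case (elim z)
      show ?case
      proof
        assume z: "z \<in> E \<times> F"
        have mem: "fst z \<in> E" "snd z \<in> F" "fst z0 \<in> E" "snd z0 \<in> F" using z z0 by auto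
        have "fst z \<in> ?X n" "fst z0 \<in> ?X n" "snd z \<in> ?Y n" "snd z0 \<in> ?Y n"
          using mem EF E(4)[of n] F(4)[of n] by blast+
        then have "cmod (\<phi> z - \<phi> z0) < 1"
          by (rule cell_oscillation) (use oscE oscF EF mem elim z0 in auto)
        then show "\<phi> z = 1" using elim z0 by auto
      qed
    qed
    then show ?thesis ..
  next
    case False
    have "AE z in ?P. z \<in> E \<times> F \<longrightarrow> \<phi> z = 0"
      using good by eventually_elim (use False in blast)
    then show ?thesis ..
  qed
  have evE: "AE x in std_measure. \<forall>\<^sub>F n in sequentially. x \<in> \<Union>(\<E> n)"
    unfolding E(4) using A AE_space by eventually_elim (rule eventually_tail_small)
  have evF: "AE y in std_measure. \<forall>\<^sub>F n in sequentially. y \<in> \<Union>(\<F> n)"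
    unfolding F(4) using B AE_space by eventually_elim (rule eventually_tail_small)
  show ?thesis
  proof (rule exI[of _ \<E>], rule exI[of _ \<F>], intro conjI)
    show "\<forall>n. finite (\<E> n) \<and> \<E> n \<subseteq> sets std_measure \<and> disjoint (\<E> n)" using E by simp
    show "\<forall>n. finite (\<F> n) \<and> \<F> n \<subseteq> sets std_measure \<and> disjoint (\<F> n)" using F by simp
    show "\<forall>n. \<forall>E\<in>\<E> n. \<forall>F\<in>\<F> n. (AE z in ?P. z \<in> E \<times> F \<longrightarrow> \<phi> z = 0) \<or>
        (AE z in ?P. z \<in> E \<times> F \<longrightarrow> \<phi> z = 1)"
      using cell by (intro allI ballI)
  qed (rule evE evF)+
qed

lemma cutoff_Union_compose:
  assumes "finite \<E>" "\<E> \<subseteq> sets std_measure" "disjoint \<E>"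
    and "finite \<F>" "\<F> \<subseteq> sets std_measure" "disjoint \<F>"
  shows "cutoff (\<Union>\<F>) o\<^sub>C\<^sub>L T o\<^sub>C\<^sub>L cutoff (\<Union>\<E>) = (\<Sum>F\<in>\<F>. \<Sum>E\<in>\<E>. cutoff F o\<^sub>C\<^sub>L T o\<^sub>C\<^sub>L cutoff E)"
  by (simp add: cutoff_Union assms cblinfun_compose_sum_left cblinfun_compose_sum_right) (rule sum.swap)

text \<open>The grid in terms of operators. The alternative on a cell is chosen uniformly in
  \<open>T\<close>, so an operator and its approximants can be treated by the same case.\<close>

lemma schur_map_grid:
  fixes \<Phi> :: "('a::standard_measure_space l2 \<Rightarrow>\<^sub>C\<^sub>L 'b::standard_measure_space l2) \<Rightarrow> ('a l2 \<Rightarrow>\<^sub>C\<^sub>L 'b l2)"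
  assumes S: "schur_map \<phi> \<Phi>" and idem: "\<Phi> \<circ> \<Phi> = \<Phi>"
  obtains \<E> \<F> where
    "\<And>n. finite (\<E> n)" "\<And>n. \<E> n \<subseteq> sets std_measure" "\<And>n. disjoint (\<E> n)"
    "\<And>n. finite (\<F> n)" "\<And>n. \<F> n \<subseteq> sets std_measure" "\<And>n. disjoint (\<F> n)"
    "\<And>f. (\<lambda>n. cblinfun_apply (cutoff (\<Union>(\<E> n))) f) \<longlonglongrightarrow> f"
    "\<And>f. (\<lambda>n. cblinfun_apply (cutoff (\<Union>(\<F> n))) f) \<longlonglongrightarrow> f"
    "\<And>n E F. E \<in> \<E> n \<Longrightarrow> F \<in> \<F> n \<Longrightarrow>
      (\<forall>T. cutoff F o\<^sub>C\<^sub>L \<Phi> T o\<^sub>C\<^sub>L cutoff E = 0) \<or>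
      (\<forall>T. cutoff F o\<^sub>C\<^sub>L \<Phi> T o\<^sub>C\<^sub>L cutoff E = cutoff F o\<^sub>C\<^sub>L T o\<^sub>C\<^sub>L cutoff E)"
proof -
  from schur_idempotent_grid[OF S idem]
  obtain \<E> \<F> where E: "\<forall>n. finite (\<E> n) \<and> \<E> n \<subseteq> sets std_measure \<and> disjoint (\<E> n)"
    and F: "\<forall>n. finite (\<F> n) \<and> \<F> n \<subseteq> sets std_measure \<and> disjoint (\<F> n)"
    and evE: "AE x in std_measure. \<forall>\<^sub>F n in sequentially. x \<in> \<Union>(\<E> n)"
    and evF: "AE y in std_measure. \<forall>\<^sub>F n in sequentially. y \<in> \<Union>(\<F> n)"
    and cell: "\<forall>n. \<forall>E\<in>\<E> n. \<forall>F\<in>\<F> n.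
      (AE z in std_measure \<Otimes>\<^sub>M std_measure. z \<in> E \<times> F \<longrightarrow> \<phi> z = 0) \<or>
      (AE z in std_measure \<Otimes>\<^sub>M std_measure. z \<in> E \<times> F \<longrightarrow> \<phi> z = 1)"
    by - (elim exE conjE, rule that, assumption+)
  show thesis
  proof (rule that[of \<E> \<F>])
    have "\<Union>(\<E> n) \<in> sets std_measure" for n using E by (intro sets.finite_Union) auto
    then show "(\<lambda>n. cblinfun_apply (cutoff (\<Union>(\<E> n))) f) \<longlonglongrightarrow> f" for f
      by (rule cutoff_tendsto[OF _ evE])
    have "\<Union>(\<F> n) \<in> sets std_measure" for n using F by (intro sets.finite_Union) auto
    then show "(\<lambda>n. cblinfun_apply (cutoff (\<Union>(\<F> n))) f) \<longlonglongrightarrow> f" for f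
      by (rule cutoff_tendsto[OF _ evF])
    fix n G H assume GH: "G \<in> \<E> n" "H \<in> \<F> n"
    then have meas: "G \<in> sets std_measure" "H \<in> sets std_measure" using E F by blast+
    show "(\<forall>T. cutoff H o\<^sub>C\<^sub>L \<Phi> T o\<^sub>C\<^sub>L cutoff G = 0) \<or>
        (\<forall>T. cutoff H o\<^sub>C\<^sub>L \<Phi> T o\<^sub>C\<^sub>L cutoff G = cutoff H o\<^sub>C\<^sub>L T o\<^sub>C\<^sub>L cutoff G)"
      using cell[rule_format, OF GH] schur_map_cell_zero[OF S meas] schur_map_cell_one[OF S meas] by blast
  qed (simp_all add: E F)
qed

section \<open>Masa-bimodules and invariance\<close>

lemma masa_bimodule_subspace: "masa_bimodule U \<Longrightarrow> complex_subspace U"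
  by (simp add: masa_bimodule_def)

lemma masa_bimodule_weak_closure:
  fixes U :: "('a::standard_measure_space l2 \<Rightarrow>\<^sub>C\<^sub>L 'b::standard_measure_space l2) set"
  assumes U: "masa_bimodule U"
  shows "masa_bimodule (weak_closure U)"
  unfolding masa_bimodule_def
proof (intro conjI ballI)
  show "complex_subspace (weak_closure U)"
    using U by (intro complex_subspace_weak_closure) (simp add: masa_bimodule_def)
  fix A :: "'a l2 \<Rightarrow>\<^sub>C\<^sub>L 'a l2" and B :: "'b l2 \<Rightarrow>\<^sub>C\<^sub>L 'b l2" and T
  assume AB: "A \<in> multiplication_masa" "B \<in> multiplication_masa" and T: "T \<in> weak_closure U"
  show "B o\<^sub>C\<^sub>L T o\<^sub>C\<^sub>L A \<in> weak_closure U"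
  proof (rule weak_closure_subsetI[OF weak_continuous_compose _ _ T])
    fix S assume "S \<in> U"
    then have "B o\<^sub>C\<^sub>L S o\<^sub>C\<^sub>L A \<in> U"
      using U AB unfolding masa_bimodule_def by simp
    then show "B o\<^sub>C\<^sub>L S o\<^sub>C\<^sub>L A \<in> weak_closure U" using weak_closure_incl by auto
  qed simp
qed

lemma masa_bimodule_plus:
  fixes U V :: "('a::standard_measure_space l2 \<Rightarrow>\<^sub>C\<^sub>L 'b::standard_measure_space l2) set"
  assumes U: "masa_bimodule U" and V: "masa_bimodule V"
  shows "masa_bimodule (U + V)"
  unfolding masa_bimodule_def
proof (intro conjI ballI)
  show "complex_subspace (U + V)"
    using U V by (intro complex_subspace_plus) (simp_all add: masa_bimodule_def)
  fix A :: "'a l2 \<Rightarrow>\<^sub>C\<^sub>L 'a l2" and B :: "'b l2 \<Rightarrow>\<^sub>C\<^sub>L 'b l2" and T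
  assume AB: "A \<in> multiplication_masa" "B \<in> multiplication_masa" and "T \<in> U + V"
  then obtain u v where T: "T = u + v" "u \<in> U" "v \<in> V" by (auto simp: set_plus_def)
  have "B o\<^sub>C\<^sub>L T o\<^sub>C\<^sub>L A = B o\<^sub>C\<^sub>L u o\<^sub>C\<^sub>L A + B o\<^sub>C\<^sub>L v o\<^sub>C\<^sub>L A"
    by (simp add: T cblinfun_compose_add_left cblinfun_compose_add_right)
  moreover have "B o\<^sub>C\<^sub>L u o\<^sub>C\<^sub>L A \<in> U" "B o\<^sub>C\<^sub>L v o\<^sub>C\<^sub>L A \<in> V"
    using U V AB T unfolding masa_bimodule_def by simp_all
  ultimately show "B o\<^sub>C\<^sub>L T o\<^sub>C\<^sub>L A \<in> U + V" by (simp add: set_plus_intro)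
qed

lemma masa_bimodule_INT:
  fixes V :: "'i \<Rightarrow> ('a::standard_measure_space l2 \<Rightarrow>\<^sub>C\<^sub>L 'b::standard_measure_space l2) set"
  assumes V: "\<And>j. j \<in> J \<Longrightarrow> masa_bimodule (V j)"
  shows "masa_bimodule (\<Inter>j\<in>J. V j)"
  unfolding masa_bimodule_def
proof (intro conjI ballI INT_I)
  show "complex_subspace (\<Inter>j\<in>J. V j)"
    using V by (intro complex_subspace_INT) (simp add: masa_bimodule_def)
  fix A :: "'a l2 \<Rightarrow>\<^sub>C\<^sub>L 'a l2" and B :: "'b l2 \<Rightarrow>\<^sub>C\<^sub>L 'b l2" and T j
  assume "A \<in> multiplication_masa" "B \<in> multiplication_masa" "T \<in> (\<Inter>j\<in>J. V j)" "j \<in> J"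
  then show "B o\<^sub>C\<^sub>L T o\<^sub>C\<^sub>L A \<in> V j"
    using V[of j] unfolding masa_bimodule_def by simp
qed

text \<open>Compressed to a finite grid, \<open>\<Phi> T\<close> is a sum of zeros and compressions
  of \<open>T\<close>, all in \<open>Z\<close>. The compressions converge weak* to
  \<open>\<Phi> T\<close> as the grids exhaust the product.\<close>

lemma schur_map_invariant:
  fixes Z :: "('a::standard_measure_space l2 \<Rightarrow>\<^sub>C\<^sub>L 'b::standard_measure_space l2) set"
  assumes S: "schur_map \<phi> \<Phi>" and idem: "\<Phi> \<circ> \<Phi> = \<Phi>"
    and Z: "masa_bimodule Z" "weak_closed Z" and T: "T \<in> Z"
  shows "\<Phi> T \<in> Z"
proof -
  obtain \<E> \<F> where E: "\<And>n. finite (\<E> n)" "\<And>n. \<E> n \<subseteq> sets std_measure" "\<And>n. disjoint (\<E> n)"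
    and F: "\<And>n. finite (\<F> n)" "\<And>n. \<F> n \<subseteq> sets std_measure" "\<And>n. disjoint (\<F> n)"
    and limE: "\<And>f. (\<lambda>n. cblinfun_apply (cutoff (\<Union>(\<E> n))) f) \<longlonglongrightarrow> f"
    and limF: "\<And>f. (\<lambda>n. cblinfun_apply (cutoff (\<Union>(\<F> n))) f) \<longlonglongrightarrow> f"
    and cell: "\<And>n E F. E \<in> \<E> n \<Longrightarrow> F \<in> \<F> n \<Longrightarrow>
      (\<forall>T. cutoff F o\<^sub>C\<^sub>L \<Phi> T o\<^sub>C\<^sub>L cutoff E = 0) \<or>
      (\<forall>T. cutoff F o\<^sub>C\<^sub>L \<Phi> T o\<^sub>C\<^sub>L cutoff E = cutoff F o\<^sub>C\<^sub>L T o\<^sub>C\<^sub>L cutoff E)"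
    using schur_map_grid[OF S idem] by blast
  have sub: "complex_subspace Z" using Z by (simp add: masa_bimodule_def)
  have UE: "\<Union>(\<E> n) \<in> sets std_measure" and UF: "\<Union>(\<F> n) \<in> sets std_measure" for n
    by (rule sets.finite_Union[OF E(1,2)], rule sets.finite_Union[OF F(1,2)])
  have mem: "cutoff (\<Union>(\<F> n)) o\<^sub>C\<^sub>L \<Phi> T o\<^sub>C\<^sub>L cutoff (\<Union>(\<E> n)) \<in> Z" for n
    unfolding cutoff_Union_compose[OF E F]
  proof (intro complex_subspace_sum sub)
    fix G H assume GH: "H \<in> \<F> n" "G \<in> \<E> n"
    then have "cutoff H o\<^sub>C\<^sub>L T o\<^sub>C\<^sub>L cutoff G \<in> Z"
      using masa_bimodule_cutoff[OF Z(1) T] E(2)[of n] F(2)[of n] by auto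
    then show "cutoff H o\<^sub>C\<^sub>L \<Phi> T o\<^sub>C\<^sub>L cutoff G \<in> Z"
      using cell[OF GH(2,1)] sub by (auto simp: complex_subspace_def)
  qed
  have lim: "limitin weak_star_topology
      (\<lambda>n. cutoff (\<Union>(\<F> n)) o\<^sub>C\<^sub>L \<Phi> T o\<^sub>C\<^sub>L cutoff (\<Union>(\<E> n))) (\<Phi> T) sequentially"
    by (rule limitin_weak_star_compose[OF norm_cutoff[OF UE] limE norm_cutoff[OF UF] limF cutoff_adjoint[OF UF]])
  show ?thesis
    by (rule limitin_closedin[OF lim Z(2) always_eventually]) (simp_all add: mem)
qed

text \<open>The hypotheses on \<open>Z\<close> are algebraic, without weak* closedness, so that the
  lemma can be applied again to the image of a bimodule under \<open>id - \<Phi>\<close>.\<close>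

lemma reflexive_hull_schur_map:
  fixes Z :: "('a::standard_measure_space l2 \<Rightarrow>\<^sub>C\<^sub>L 'b::standard_measure_space l2) set"
  assumes S: "schur_map \<phi> \<Phi>" and idem: "\<Phi> \<circ> \<Phi> = \<Phi>"
    and add: "\<And>R R'. R \<in> Z \<Longrightarrow> R' \<in> Z \<Longrightarrow> R + R' \<in> Z" and zero: "0 \<in> Z"
    and cutoff: "\<And>R E F. R \<in> Z \<Longrightarrow> E \<in> sets std_measure \<Longrightarrow> F \<in> sets std_measure \<Longrightarrow>
      cutoff F o\<^sub>C\<^sub>L R o\<^sub>C\<^sub>L cutoff E \<in> Z"
    and T: "T \<in> reflexive_hull Z"
  shows "T - \<Phi> T \<in> reflexive_hull ((\<lambda>R. R - \<Phi> R) ` Z)"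
  unfolding reflexive_hull_def
proof (intro CollectI allI)
  fix x
  obtain \<E> \<F> where E: "\<And>n. finite (\<E> n)" "\<And>n. \<E> n \<subseteq> sets std_measure" "\<And>n. disjoint (\<E> n)"
    and F: "\<And>n. finite (\<F> n)" "\<And>n. \<F> n \<subseteq> sets std_measure" "\<And>n. disjoint (\<F> n)"
    and limE: "\<And>f. (\<lambda>n. cblinfun_apply (cutoff (\<Union>(\<E> n))) f) \<longlonglongrightarrow> f"
    and limF: "\<And>f. (\<lambda>n. cblinfun_apply (cutoff (\<Union>(\<F> n))) f) \<longlonglongrightarrow> f"
    and cell: "\<And>n E F. E \<in> \<E> n \<Longrightarrow> F \<in> \<F> n \<Longrightarrow>
      (\<forall>T. cutoff F o\<^sub>C\<^sub>L \<Phi> T o\<^sub>C\<^sub>L cutoff E = 0) \<or>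
      (\<forall>T. cutoff F o\<^sub>C\<^sub>L \<Phi> T o\<^sub>C\<^sub>L cutoff E = cutoff F o\<^sub>C\<^sub>L T o\<^sub>C\<^sub>L cutoff E)"
    using schur_map_grid[OF S idem] by blast
  let ?A = "(\<lambda>R. cblinfun_apply R x) ` (\<lambda>R. R - \<Phi> R) ` Z"
  let ?R = "T - \<Phi> T"
  have UF: "\<Union>(\<F> n) \<in> sets std_measure" for n by (rule sets.finite_Union[OF F(1,2)])
  have \<Phi>0: "\<Phi> 0 = 0" using schur_map_diff[OF S, of 0 0] by simp
  have A0: "0 \<in> closure ?A"
    using zero \<Phi>0 by (intro subsetD[OF closure_subset]) (force intro: image_eqI[of _ _ 0])
  \<comment> \<open>Different cells may require different approximants from \<open>Z\<close>, so
    their contributions have to be summable inside the closure.\<close>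
  have Aadd: "y + y' \<in> closure ?A" if y: "y \<in> closure ?A" "y' \<in> closure ?A" for y y'
  proof -
    obtain s s' where s: "\<And>n. s n \<in> ?A" "s \<longlonglongrightarrow> y" and s': "\<And>n. s' n \<in> ?A" "s' \<longlonglongrightarrow> y'"
      using y unfolding closure_sequential by blast
    have "a + b \<in> ?A" if ab: "a \<in> ?A" "b \<in> ?A" for a b
    proof -
      obtain R R' where R: "R \<in> Z" "R' \<in> Z" "a = cblinfun_apply (R - \<Phi> R) x" "b = cblinfun_apply (R' - \<Phi> R') x"
        using ab by blast
      have "a + b = cblinfun_apply ((R + R') - \<Phi> (R + R')) x"
        by (simp add: R schur_map_add[OF S])
      then show ?thesis using add[OF R(1,2)] by blast
    qed
    then show ?thesis
      unfolding closure_sequential using s s' by (intro exI[of _ "\<lambda>n. s n + s' n"]) (auto intro: tendsto_add)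
  qed
  have Asum: "sum y I \<in> closure ?A" if "\<And>i. i \<in> I \<Longrightarrow> y i \<in> closure ?A" for y and I :: "'i set"
    using that by (induction I rule: infinite_finite_induct) (auto simp: A0 Aadd)
  have mem: "cblinfun_apply (cutoff H o\<^sub>C\<^sub>L ?R o\<^sub>C\<^sub>L cutoff G) x \<in> closure ?A"
    if GH: "G \<in> \<E> n" "H \<in> \<F> n" for n G H
  proof -
    have meas: "G \<in> sets std_measure" "H \<in> sets std_measure" using GH E(2)[of n] F(2)[of n] by auto
    have split: "cutoff H o\<^sub>C\<^sub>L ?R o\<^sub>C\<^sub>L cutoff G = cutoff H o\<^sub>C\<^sub>L T o\<^sub>C\<^sub>L cutoff G - cutoff H o\<^sub>C\<^sub>L \<Phi> T o\<^sub>C\<^sub>L cutoff G"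
      by (simp add: cblinfun_compose_diff_left cblinfun_compose_diff_right)
    from cell[OF GH] show ?thesis
    proof
      assume "\<forall>T. cutoff H o\<^sub>C\<^sub>L \<Phi> T o\<^sub>C\<^sub>L cutoff G = cutoff H o\<^sub>C\<^sub>L T o\<^sub>C\<^sub>L cutoff G"
      then show ?thesis unfolding split using A0 by simp
    next
      assume z: "\<forall>T. cutoff H o\<^sub>C\<^sub>L \<Phi> T o\<^sub>C\<^sub>L cutoff G = 0"
      let ?B = "(\<lambda>R. cblinfun_apply R (cblinfun_apply (cutoff G) x)) ` Z"
      have "cblinfun_apply T (cblinfun_apply (cutoff G) x) \<in> closure ?B"
        using T by (simp add: reflexive_hull_def)
      then have "cblinfun_apply (cutoff H) (cblinfun_apply T (cblinfun_apply (cutoff G) x))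
          \<in> closure (cblinfun_apply (cutoff H) ` ?B)"
        using bounded_linear_cblinfun_apply by (rule subsetD[OF closure_bounded_linear_image_subset imageI, rotated])
      also have "\<dots> \<subseteq> closure ?A"
      proof (rule closure_mono, clarify)
        fix R assume R: "R \<in> Z"
        let ?R' = "cutoff H o\<^sub>C\<^sub>L R o\<^sub>C\<^sub>L cutoff G"
        \<comment> \<open>On this cell \<open>id - \<Phi>\<close> fixes the compressed approximant,
          which is why its value at \<open>x\<close> belongs to \<open>?A\<close>.\<close>
        have "\<Phi> ?R' = 0" using z by (simp add: schur_map_cutoff[OF S meas])
        then have "cblinfun_apply (cutoff H) (cblinfun_apply R (cblinfun_apply (cutoff G) x))
            = cblinfun_apply (?R' - \<Phi> ?R') x" by simp
        then show "cblinfun_apply (cutoff H) (cblinfun_apply R (cblinfun_apply (cutoff G) x)) \<in> ?A"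
          using cutoff[OF R meas] by blast
      qed
      finally show ?thesis unfolding split using z by simp
    qed
  qed
  have "cblinfun_apply (cutoff (\<Union>(\<F> n)) o\<^sub>C\<^sub>L ?R o\<^sub>C\<^sub>L cutoff (\<Union>(\<E> n))) x \<in> closure ?A" for n
    unfolding cutoff_Union_compose[OF E F] cblinfun_sum_apply by (intro Asum mem)
  moreover have "(\<lambda>n. cblinfun_apply (cutoff (\<Union>(\<F> n)) o\<^sub>C\<^sub>L ?R o\<^sub>C\<^sub>L cutoff (\<Union>(\<E> n))) x) \<longlonglongrightarrow> cblinfun_apply ?R x"
  proof -
    let ?y = "\<lambda>n. cblinfun_apply ?R (cblinfun_apply (cutoff (\<Union>(\<E> n))) x)"
    have y: "?y \<longlonglongrightarrow> cblinfun_apply ?R x"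
      by (intro bounded_linear.tendsto[OF bounded_linear_cblinfun_apply] limE)
    have "(\<lambda>n. norm (?y n - cblinfun_apply ?R x)) \<longlonglongrightarrow> 0"
      using tendsto_norm[OF tendsto_diff[OF y tendsto_const[of "cblinfun_apply ?R x"]]] by simp
    \<comment> \<open>Both cutoffs vary with \<open>n\<close>. The output cutoffs are contractions,
      so the error coming from the input cutoff tends to 0 uniformly, and what is left is a cutoff
      of a fixed vector.\<close>
    then have "(\<lambda>n. cblinfun_apply (cutoff (\<Union>(\<F> n))) (?y n - cblinfun_apply ?R x)) \<longlonglongrightarrow> 0"
      by (rule Lim_null_comparison[rotated])
        (use norm_cutoff_apply[OF UF] in \<open>auto intro!: always_eventually\<close>)
    from tendsto_add[OF this limF[of "cblinfun_apply ?R x"]]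
    show ?thesis by (simp add: cblinfun_apply_diff)
  qed
  ultimately show "cblinfun_apply ?R x \<in> closure ?A"
    by (rule closed_sequentially[OF closed_closure])
qed

section \<open>Decomposable bimodules\<close>

lemma schur_idempotentE:
  assumes "schur_idempotent \<Phi>"
  obtains \<phi> where "schur_map \<phi> \<Phi>" "\<Phi> \<circ> \<Phi> = \<Phi>"
  using assms unfolding schur_idempotent_def schur_map_def by blast

lemma
  assumes "schur_idempotent \<Phi>"
  shows schur_idempotent_add: "\<Phi> (S + T) = \<Phi> S + \<Phi> T"
    and schur_idempotent_diff: "\<Phi> (S - T) = \<Phi> S - \<Phi> T"
    and schur_idempotent_idem: "\<Phi> (\<Phi> T) = \<Phi> T"
    and schur_idempotent_continuous: "weak_continuous \<Phi>"
    and schur_idempotent_invariant: "masa_bimodule Z \<Longrightarrow> weak_closed Z \<Longrightarrow> T \<in> Z \<Longrightarrow> \<Phi> T \<in> Z"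
proof -
  obtain \<phi> where S: "schur_map \<phi> \<Phi>" and idem: "\<Phi> \<circ> \<Phi> = \<Phi>"
    using assms by (rule schur_idempotentE)
  show "\<Phi> (S + T) = \<Phi> S + \<Phi> T" by (rule schur_map_add[OF S])
  show "\<Phi> (S - T) = \<Phi> S - \<Phi> T" by (rule schur_map_diff[OF S])
  show "\<Phi> (\<Phi> T) = \<Phi> T" using fun_cong[OF idem, of T] by simp
  show "weak_continuous \<Phi>" by (rule schur_map_continuous[OF S])
  show "\<Phi> T \<in> Z" if "masa_bimodule Z" "weak_closed Z" "T \<in> Z"
    by (rule schur_map_invariant[OF S idem that])
qed

lemma schur_idempotent_commute:
  "schur_idempotent \<Phi> \<Longrightarrow> schur_idempotent \<Psi> \<Longrightarrow> \<Phi> (\<Psi> T) = \<Psi> (\<Phi> T)"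
  by (elim schur_idempotentE) (rule schur_map_commute)

text \<open>Here \<open>\<Psi> n\<close> is an idempotent whose range is the space \<open>\<W> n\<close> of \<^const>\<open>I_decomposable\<close>.\<close>

definition decomposition :: "('a::standard_measure_space l2 \<Rightarrow>\<^sub>C\<^sub>L 'b::standard_measure_space l2) set \<Rightarrow>
    (nat \<Rightarrow> ('a l2 \<Rightarrow>\<^sub>C\<^sub>L 'b l2) \<Rightarrow> ('a l2 \<Rightarrow>\<^sub>C\<^sub>L 'b l2)) \<Rightarrow>
    (nat \<Rightarrow> ('a l2 \<Rightarrow>\<^sub>C\<^sub>L 'b l2) \<Rightarrow> ('a l2 \<Rightarrow>\<^sub>C\<^sub>L 'b l2)) \<Rightarrow> real \<Rightarrow> bool" where
  "decomposition V \<Phi> \<Psi> C \<longleftrightarrow>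
    (\<forall>n. schur_idempotent (\<Phi> n)) \<and> (\<forall>n. schur_idempotent (\<Psi> n)) \<and>
    (\<forall>n T. norm (\<Phi> n T) \<le> C * norm T) \<and> (\<forall>n. V \<subseteq> range (\<Phi> n) + range (\<Psi> n)) \<and>
    (\<forall>n. range (\<Psi> n) \<subseteq> V) \<and> weak_star_limsup (\<lambda>n. range (\<Phi> n)) \<subseteq> V"

lemma I_decomposable_decomposition:
  assumes "I_decomposable V"
  obtains \<Phi> \<Psi> C where "decomposition V \<Phi> \<Psi> C"
proof -
  obtain \<Phi> \<W> C where *: "\<forall>n. schur_idempotent (\<Phi> n)" "\<forall>n. I_injective (\<W> n)"
    "\<forall>n T. norm (\<Phi> n T) \<le> C * norm T" "\<forall>n. V \<subseteq> range (\<Phi> n) + \<W> n" "\<forall>n. \<W> n \<subseteq> V"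
    "weak_star_limsup (\<lambda>n. range (\<Phi> n)) \<subseteq> V"
    using assms unfolding I_decomposable_def by - (elim exE conjE, rule that, assumption+)
  from *(2) obtain \<Psi> where "\<forall>n. schur_idempotent (\<Psi> n) \<and> \<W> n = range (\<Psi> n)"
    unfolding I_injective_def choice_iff by blast
  with * have "decomposition V \<Phi> \<Psi> C" unfolding decomposition_def by simp
  then show thesis by (rule that)
qed

text \<open>On \<open>U + V\<close> only the component in \<open>U\<close> survives, and
  \<open>U\<close> is invariant under both idempotents. Weak* continuity of the composed map and
  closedness of \<open>U\<close> extend this to the closure.\<close>

lemma decomposition_complement:
  assumes D: "decomposition V \<Phi> \<Psi> C" and U: "masa_bimodule U" "weak_closed U"
    and T: "T \<in> weak_closure (U + V)"
  shows "(T - \<Phi> n T) - \<Psi> n (T - \<Phi> n T) \<in> U"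
proof (rule weak_closure_subsetI[OF _ U(2) _ T])
  have \<Phi>: "schur_idempotent (\<Phi> n)" and \<Psi>: "schur_idempotent (\<Psi> n)"
    using D by (auto simp: decomposition_def)
  show "weak_continuous (\<lambda>T. (T - \<Phi> n T) - \<Psi> n (T - \<Phi> n T))"
  proof -
    have c: "weak_continuous (\<lambda>T. T - \<Phi> n T)"
      by (intro weak_continuous_diff continuous_map_id[unfolded id_def] schur_idempotent_continuous[OF \<Phi>])
    then have "weak_continuous (\<lambda>T. \<Psi> n (T - \<Phi> n T))"
      using continuous_map_compose[OF c schur_idempotent_continuous[OF \<Psi>]] by (simp add: o_def)
    with c show ?thesis by (rule weak_continuous_diff)
  qed
  fix S assume "S \<in> U + V"
  moreover have "V \<subseteq> range (\<Phi> n) + range (\<Psi> n)" using D by (simp add: decomposition_def)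
  ultimately obtain u a b where S: "S = u + (\<Phi> n a + \<Psi> n b)" and u: "u \<in> U"
    by (fastforce simp: set_plus_def)
  have "\<Phi> n S = \<Phi> n u + (\<Phi> n a + \<Psi> n (\<Phi> n b))"
    by (simp add: S schur_idempotent_add[OF \<Phi>] schur_idempotent_idem[OF \<Phi>]
        schur_idempotent_commute[OF \<Phi> \<Psi>])
  then have "S - \<Phi> n S = (u - \<Phi> n u) + (\<Psi> n b - \<Psi> n (\<Phi> n b))" by (simp add: S)
  then have eq: "(S - \<Phi> n S) - \<Psi> n (S - \<Phi> n S) = (u - \<Phi> n u) - \<Psi> n (u - \<Phi> n u)"
    by (simp add: schur_idempotent_add[OF \<Psi>] schur_idempotent_diff[OF \<Psi>] schur_idempotent_idem[OF \<Psi>])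
  have sub: "complex_subspace U" using U by (simp add: masa_bimodule_def)
  show "(S - \<Phi> n S) - \<Psi> n (S - \<Phi> n S) \<in> U"
    unfolding eq by (intro complex_subspace_diff[OF sub] schur_idempotent_invariant[OF \<Psi> U]
        schur_idempotent_invariant[OF \<Phi> U] u)
qed

text \<open>The final clause records that \<open>S\<close> inherits membership in every weak* closed
  masa-bimodule containing \<open>T\<close>; it keeps earlier gains when the indices are treated one
  after another.\<close>

lemma decomposition_cluster:
  fixes V :: "('a::standard_measure_space l2 \<Rightarrow>\<^sub>C\<^sub>L 'b::standard_measure_space l2) set"
  assumes D: "decomposition V \<Phi> \<Psi> C" and Z: "weak_closed Z" and diff: "\<And>n. T - \<Phi> n T \<in> Z"
  shows "\<exists>S\<in>V. T - S \<in> Z \<and> (\<forall>D. masa_bimodule D \<longrightarrow> weak_closed D \<longrightarrow> T \<in> D \<longrightarrow> S \<in> D)"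
proof -
  have \<Phi>: "schur_idempotent (\<Phi> n)" for n using D by (auto simp: decomposition_def)
  have "norm (\<Phi> n T) \<le> C * norm T" for n using D by (simp add: decomposition_def)
  then obtain F S where F: "F \<noteq> bot" "F \<le> sequentially"
    and lim: "limitin weak_star_topology (\<lambda>n. \<Phi> n T) S F"
    using bounded_sequence_weak_cluster[of "\<lambda>n. \<Phi> n T" "C * norm T"] by blast
  \<comment> \<open>Convergence along a proper filter finer than \<open>sequentially\<close> makes
    each neighbourhood of \<open>S\<close> contain infinitely many terms, as a cluster point
    requires.\<close>
  have "S \<in> weak_star_limsup (\<lambda>n. range (\<Phi> n))"
    unfolding weak_star_limsup_def
  proof (intro CollectI exI conjI allI impI)
    fix G assume G: "openin weak_star_topology G \<and> S \<in> G"
    show "\<exists>\<^sub>F n in sequentially. \<Phi> n T \<in> G"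
    proof (rule ccontr)
      assume "\<not> ?thesis"
      then have "\<forall>\<^sub>F n in sequentially. \<Phi> n T \<notin> G" by (simp add: not_frequently)
      then have "\<forall>\<^sub>F n in F. \<Phi> n T \<notin> G" using F(2) by (simp add: filter_leD)
      moreover have "\<forall>\<^sub>F n in F. \<Phi> n T \<in> G" using lim G by (simp add: limitin_def)
      ultimately have "\<forall>\<^sub>F n in F. False" by eventually_elim simp
      then show False using F(1) by (simp add: eventually_False)
    qed
  qed simp
  then have "S \<in> V" using D by (auto simp: decomposition_def)
  moreover have "T - S \<in> Z"
  proof (rule limitin_closedin[OF _ Z always_eventually F(1)])
    show "\<forall>n. T - \<Phi> n T \<in> Z" using diff by blast
    show "limitin weak_star_topology (\<lambda>n. T - \<Phi> n T) (T - S) F"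
      using lim unfolding limitin_weak_star_iff
      by (auto simp: trace_pairing_diff intro!: tendsto_diff)
  qed
  moreover have "S \<in> Y" if "masa_bimodule Y" "weak_closed Y" "T \<in> Y" for Y
    by (rule limitin_closedin[OF lim that(2) always_eventually F(1)])
      (use schur_idempotent_invariant[OF \<Phi> that] in blast)
  ultimately show ?thesis by blast
qed

text \<open>By invariance \<open>T - \<Phi> n T\<close> lies in the same closures as
  \<open>T\<close>, so the hypothesis on \<open>J - {j}\<close> applies to it. Then
  \<open>\<Psi> n\<close> supplies membership in \<open>V j\<close> by its range and preserves
  \<open>U\<close> and the other \<open>V i\<close>.\<close>

lemma decomposition_closure_Int_step:
  fixes V :: "nat \<Rightarrow> ('a::standard_measure_space l2 \<Rightarrow>\<^sub>C\<^sub>L 'b::standard_measure_space l2) set"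
  assumes D: "decomposition (V j) \<Phi> \<Psi> C" and j: "j \<in> J"
    and V: "\<And>i. i \<in> J \<Longrightarrow> masa_bimodule (V i)" "\<And>i. i \<in> J \<Longrightarrow> weak_closed (V i)"
    and U: "masa_bimodule U" "weak_closed U"
    and IH: "(\<Inter>i\<in>J - {j}. weak_closure (U + V i)) \<subseteq> weak_closure (U + (\<Inter>i\<in>J - {j}. V i))"
    and T: "T \<in> (\<Inter>i\<in>J. weak_closure (U + V i))"
  shows "T - \<Phi> n T \<in> weak_closure (U + (\<Inter>i\<in>J. V i))"
proof -
  let ?Z = "weak_closure (U + (\<Inter>i\<in>J. V i))"
  have \<Phi>: "schur_idempotent (\<Phi> n)" and \<Psi>: "schur_idempotent (\<Psi> n)"
    using D by (auto simp: decomposition_def)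
  let ?S = "T - \<Phi> n T"
  have "?S \<in> weak_closure (U + V i)" if i: "i \<in> J" for i
  proof -
    have bim: "masa_bimodule (weak_closure (U + V i))"
      by (intro masa_bimodule_weak_closure masa_bimodule_plus U V i)
    have "T \<in> weak_closure (U + V i)" using T i by blast
    moreover from this have "\<Phi> n T \<in> weak_closure (U + V i)"
      by (rule schur_idempotent_invariant[OF \<Phi> bim closedin_closure_of])
    ultimately show ?thesis
      using bim by (intro complex_subspace_diff) (auto simp: masa_bimodule_def)
  qed
  then have S: "?S \<in> weak_closure (U + (\<Inter>i\<in>J - {j}. V i))" using IH by blast
  have U0: "0 \<in> U" and V0: "\<And>i. i \<in> J \<Longrightarrow> 0 \<in> V i"
    using U V by (auto simp: masa_bimodule_def complex_subspace_def)
  have "\<Psi> n ?S \<in> ?Z"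
  proof (rule weak_closure_subsetI[OF schur_idempotent_continuous[OF \<Psi>] closedin_closure_of _ S])
    fix R assume "R \<in> U + (\<Inter>i\<in>J - {j}. V i)"
    then obtain u v where R: "R = u + v" "u \<in> U" "\<And>i. i \<in> J - {j} \<Longrightarrow> v \<in> V i"
      by (auto simp: set_plus_def)
    have "\<Psi> n v \<in> V i" if i: "i \<in> J" for i
    proof (cases "i = j")
      case True
      then show ?thesis using D unfolding decomposition_def by blast
    next
      case False
      then show ?thesis using i R(3)[of i] schur_idempotent_invariant[OF \<Psi> V(1)[OF i] V(2)[OF i]] by blast
    qed
    then have "\<Psi> n R \<in> U + (\<Inter>i\<in>J. V i)"
      unfolding R(1) schur_idempotent_add[OF \<Psi>]
      by (intro set_plus_intro schur_idempotent_invariant[OF \<Psi> U] R(2)) blast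
    then show "\<Psi> n R \<in> ?Z" using weak_closure_incl by auto
  qed
  moreover have "?S - \<Psi> n ?S \<in> ?Z"
  proof -
    have "?S - \<Psi> n ?S \<in> U"
      by (rule decomposition_complement[OF D U]) (use T j in blast)
    then have "(?S - \<Psi> n ?S) + 0 \<in> U + (\<Inter>i\<in>J. V i)"
      by (rule set_plus_intro) (use V0 in blast)
    then show ?thesis using weak_closure_incl[of "U + (\<Inter>i\<in>J. V i)"] by auto
  qed
  moreover have "complex_subspace ?Z"
    by (intro masa_bimodule_subspace masa_bimodule_weak_closure masa_bimodule_plus masa_bimodule_INT U V)
  ultimately have "(?S - \<Psi> n ?S) + \<Psi> n ?S \<in> ?Z" by (blast intro: complex_subspace_add)
  then show ?thesis by simp
qed

text \<open>Induction over proper subsets provides the case \<open>J - {j}\<close> for every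
  \<open>j\<close> at once. For empty \<open>J\<close> both intersections are \<open>UNIV\<close>,
  and the same argument covers that case.\<close>

lemma closure_plus_INT_superset:
  fixes V :: "nat \<Rightarrow> ('a::standard_measure_space l2 \<Rightarrow>\<^sub>C\<^sub>L 'b::standard_measure_space l2) set"
  assumes "finite J" and V: "\<And>i. i \<in> J \<Longrightarrow> I_decomposable (V i) \<and> masa_bimodule (V i)"
    and U: "masa_bimodule U" "weak_closed U"
  shows "(\<Inter>i\<in>J. weak_closure (U + V i)) \<subseteq> weak_closure (U + (\<Inter>i\<in>J. V i))"
  using assms(1) V
proof (induction J rule: finite_psubset_induct)
  case (psubset J)
  let ?Z = "weak_closure (U + (\<Inter>i\<in>J. V i))"
  have bim: "masa_bimodule (V i)" and cl: "weak_closed (V i)" if "i \<in> J" for i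
    using psubset.prems[OF that] by (auto simp: I_decomposable_def)
  have Zsub: "complex_subspace ?Z"
    by (intro masa_bimodule_subspace masa_bimodule_weak_closure masa_bimodule_plus masa_bimodule_INT U bim)
  have step: "\<exists>S'\<in>V j. S - S' \<in> ?Z \<and> (\<forall>D. masa_bimodule D \<longrightarrow> weak_closed D \<longrightarrow> S \<in> D \<longrightarrow> S' \<in> D)"
    if j: "j \<in> J" and S: "S \<in> (\<Inter>i\<in>J. weak_closure (U + V i))" for j S
  proof -
    obtain \<Phi> \<Psi> C where D: "decomposition (V j) \<Phi> \<Psi> C"
      using psubset.prems[OF j] I_decomposable_decomposition by blast
    have IH: "(\<Inter>i\<in>J - {j}. weak_closure (U + V i)) \<subseteq> weak_closure (U + (\<Inter>i\<in>J - {j}. V i))"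
      by (rule psubset.IH) (use j psubset.prems in auto)
    show ?thesis
      by (rule decomposition_cluster[OF D closedin_closure_of])
        (rule decomposition_closure_Int_step[OF D j bim cl U IH S])
  qed
  show ?case
  proof
    fix T assume T: "T \<in> (\<Inter>i\<in>J. weak_closure (U + V i))"
    \<comment> \<open>Besides membership in the \<open>V i\<close> treated so far, the claim retains
      membership in all the closures, because \<open>step\<close> has to be applicable to the new
      operator.\<close>
    have "\<exists>S. T - S \<in> ?Z \<and> S \<in> (\<Inter>i\<in>K. V i) \<and> S \<in> (\<Inter>i\<in>J. weak_closure (U + V i))"
      if "finite K" "K \<subseteq> J" for K
      using that
    proof (induction K rule: finite_induct)
      case empty
      have "T - T \<in> ?Z" using complex_subspace_0[OF Zsub] by simp
      then show ?case using T by blast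
    next
      case (insert j K)
      then obtain S where S: "T - S \<in> ?Z" "S \<in> (\<Inter>i\<in>K. V i)" "S \<in> (\<Inter>i\<in>J. weak_closure (U + V i))"
        by blast
      have j: "j \<in> J" using insert by blast
      obtain S' where S': "S' \<in> V j" "S - S' \<in> ?Z"
        "\<And>D. masa_bimodule D \<Longrightarrow> weak_closed D \<Longrightarrow> S \<in> D \<Longrightarrow> S' \<in> D"
        using step[OF j S(3)] by blast
      have "T - S' \<in> ?Z" using complex_subspace_add[OF Zsub S(1) S'(2)] by simp
      moreover have "S' \<in> V i" if "i \<in> insert j K" for i
      proof (cases "i = j")
        case False
        then have i: "i \<in> K" "i \<in> J" using that insert by auto
        then have "S \<in> V i" using S(2) by blast
        then show ?thesis by (rule S'(3)[OF bim[OF i(2)] cl[OF i(2)]])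
      qed (use S'(1) in simp)
      moreover have "S' \<in> weak_closure (U + V i)" if i: "i \<in> J" for i
        by (rule S'(3)[OF masa_bimodule_weak_closure[OF masa_bimodule_plus[OF U(1) bim[OF i]]] closedin_closure_of])
          (use S(3) i in blast)
      ultimately show ?case by blast
    qed
    then obtain S where S: "T - S \<in> ?Z" "S \<in> (\<Inter>i\<in>J. V i)" using psubset.hyps by blast
    have "0 \<in> U" using U(1) by (simp add: masa_bimodule_def complex_subspace_def)
    from set_plus_intro[OF this S(2)] have "S \<in> ?Z"
      using weak_closure_incl[of "U + (\<Inter>i\<in>J. V i)"] by auto
    from complex_subspace_add[OF Zsub S(1) this] show "T \<in> ?Z" by simp
  qed
qed

section \<open>Reflexivity\<close>

lemma reflexive_hull_superset: "S \<subseteq> reflexive_hull S"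
  unfolding reflexive_hull_def by (intro subsetI CollectI allI subsetD[OF closure_subset] imageI)

lemma reflexive_hull_mono: "S \<subseteq> S' \<Longrightarrow> reflexive_hull S \<subseteq> reflexive_hull S'"
  unfolding reflexive_hull_def
  by (intro Collect_mono impI allI, drule spec, erule subsetD[rotated], rule closure_mono, erule image_mono)

lemma reflexive_INT:
  assumes "\<And>j. j \<in> J \<Longrightarrow> reflexive (V j)"
  shows "reflexive (\<Inter>j\<in>J. V j)"
  unfolding reflexive_def
proof
  show "complex_subspace (\<Inter>j\<in>J. V j)"
    by (rule complex_subspace_INT) (rule assms[unfolded reflexive_def, THEN conjunct1])
  have *: "reflexive_hull (\<Inter>j\<in>J. V j) \<subseteq> V i" if i: "i \<in> J" for i
  proof -
    have "reflexive_hull (\<Inter>j\<in>J. V j) \<subseteq> reflexive_hull (V i)"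
      by (rule reflexive_hull_mono) (use i in blast)
    then show ?thesis using assms[OF i] by (simp add: reflexive_def)
  qed
  show "reflexive_hull (\<Inter>j\<in>J. V j) = (\<Inter>j\<in>J. V j)"
    by (rule equalityI[OF INT_greatest[OF *] reflexive_hull_superset])
qed

text \<open>Subtracting \<open>\<Phi> n\<close> and then \<open>\<Psi> n\<close> carries the hull of
  the closure into the hull of \<open>U\<close>, which is \<open>U\<close> itself. The part removed
  by \<open>\<Psi> n\<close> lies in \<open>V\<close>, and the part removed by
  \<open>\<Phi> n\<close> is dealt with by a cluster point in \<open>V\<close>.\<close>

lemma reflexive_closure_plus:
  fixes V :: "('a::standard_measure_space l2 \<Rightarrow>\<^sub>C\<^sub>L 'b::standard_measure_space l2) set"
  assumes V: "I_decomposable V" "masa_bimodule V" and U: "masa_bimodule U" "weak_closed U"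
    and refl: "reflexive U"
  shows "reflexive (weak_closure (U + V))"
proof -
  let ?M = "weak_closure (U + V)"
  have Mbim: "masa_bimodule ?M" by (intro masa_bimodule_weak_closure masa_bimodule_plus U V)
  then have Msub: "complex_subspace ?M" by (simp add: masa_bimodule_def)
  obtain \<Phi> \<Psi> C where D: "decomposition V \<Phi> \<Psi> C"
    using V I_decomposable_decomposition by blast
  have UV: "U + V \<subseteq> ?M" by (rule weak_closure_incl)
  have V0: "0 \<in> V" and U0: "0 \<in> U"
    by (intro complex_subspace_0 masa_bimodule_subspace V U)+
  have VM: "v \<in> ?M" if "v \<in> V" for v using set_plus_intro[OF U0 that] UV by auto
  have UM: "u \<in> ?M" if "u \<in> U" for u using set_plus_intro[OF that V0] UV by auto
  have *: "T \<in> ?M" if T: "T \<in> reflexive_hull ?M" for T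
  proof -
    have "T - \<Phi> n T \<in> ?M" for n
    proof -
      have \<Phi>: "schur_idempotent (\<Phi> n)" and \<Psi>: "schur_idempotent (\<Psi> n)"
        using D by (auto simp: decomposition_def)
      obtain \<phi> where \<phi>: "schur_map \<phi> (\<Phi> n)" "\<Phi> n \<circ> \<Phi> n = \<Phi> n" using \<Phi> by (rule schur_idempotentE)
      obtain \<psi> where \<psi>: "schur_map \<psi> (\<Psi> n)" "\<Psi> n \<circ> \<Psi> n = \<Psi> n" using \<Psi> by (rule schur_idempotentE)
      let ?N = "(\<lambda>R. R - \<Phi> n R) ` ?M"
      have z: "\<Phi> n 0 = 0" using schur_idempotent_diff[OF \<Phi>, of 0 0] by simp
      have Nadd: "R + R' \<in> ?N" if R: "R \<in> ?N" "R' \<in> ?N" for R R'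
      proof -
        obtain Q Q' where Q: "Q \<in> ?M" "Q' \<in> ?M" "R = Q - \<Phi> n Q" "R' = Q' - \<Phi> n Q'"
          using R by blast
        have "R + R' = (Q + Q') - \<Phi> n (Q + Q')" by (simp add: Q schur_idempotent_add[OF \<Phi>])
        moreover have "Q + Q' \<in> ?M" by (rule complex_subspace_add[OF Msub Q(1,2)])
        ultimately show ?thesis by blast
      qed
      have Nzero: "0 \<in> ?N"
        using complex_subspace_0[OF Msub] z by (intro image_eqI[of _ _ 0]) simp_all
      have Nproj: "cutoff F o\<^sub>C\<^sub>L R o\<^sub>C\<^sub>L cutoff E \<in> ?N"
        if R: "R \<in> ?N" and EF: "E \<in> sets std_measure" "F \<in> sets std_measure" for R E F
      proof -
        obtain Q where Q: "Q \<in> ?M" "R = Q - \<Phi> n Q" using R by blast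
        have "cutoff F o\<^sub>C\<^sub>L R o\<^sub>C\<^sub>L cutoff E = cutoff F o\<^sub>C\<^sub>L Q o\<^sub>C\<^sub>L cutoff E - \<Phi> n (cutoff F o\<^sub>C\<^sub>L Q o\<^sub>C\<^sub>L cutoff E)"
          by (simp add: Q(2) schur_map_cutoff[OF \<phi>(1) EF] cblinfun_compose_diff_left cblinfun_compose_diff_right)
        then show ?thesis using masa_bimodule_cutoff[OF Mbim Q(1) EF] by blast
      qed
      have hull: "T - \<Phi> n T \<in> reflexive_hull ?N"
        by (rule reflexive_hull_schur_map[OF \<phi> complex_subspace_add[OF Msub]
            complex_subspace_0[OF Msub] masa_bimodule_cutoff[OF Mbim] T])
      have "(T - \<Phi> n T) - \<Psi> n (T - \<Phi> n T) \<in> reflexive_hull ((\<lambda>R. R - \<Psi> n R) ` ?N)"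
        by (rule reflexive_hull_schur_map[OF \<psi> Nadd Nzero Nproj hull])
      \<comment> \<open>Elements of the transformed set come from \<open>?M\<close>, so the
        complement lemma places each of them in \<open>U\<close>.\<close>
      also have "\<dots> \<subseteq> reflexive_hull U"
        by (rule reflexive_hull_mono) (auto intro: decomposition_complement[OF D U])
      also have "\<dots> = U" using refl by (simp add: reflexive_def)
      finally have "(T - \<Phi> n T) - \<Psi> n (T - \<Phi> n T) \<in> ?M" by (rule UM)
      moreover have "\<Psi> n (T - \<Phi> n T) \<in> ?M"
        using D VM unfolding decomposition_def by blast
      ultimately have "((T - \<Phi> n T) - \<Psi> n (T - \<Phi> n T)) + \<Psi> n (T - \<Phi> n T) \<in> ?M"
        by (rule complex_subspace_add[OF Msub])
      then show ?thesis by simp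
    qed
    then obtain S where S: "S \<in> V" "T - S \<in> ?M"
      using decomposition_cluster[OF D closedin_closure_of] by blast
    then have "S \<in> ?M" by (intro VM)
    from complex_subspace_add[OF Msub S(2) this] show ?thesis by simp
  qed
  have "reflexive_hull ?M = ?M" by (rule equalityI[OF subsetI[OF *] reflexive_hull_superset])
  with Msub show ?thesis by (simp add: reflexive_def)
qed

theorem corollary3p5:
  fixes \<U> :: "('a::standard_measure_space l2 \<Rightarrow>\<^sub>C\<^sub>L 'b::standard_measure_space l2) set"
    and \<V> :: "nat \<Rightarrow> ('a l2 \<Rightarrow>\<^sub>C\<^sub>L 'b l2) set"
    and k :: nat
  assumes "k \<ge> 1"
    and "\<And>j. j \<in> {1..k} \<Longrightarrow> I_decomposable (\<V> j) \<and> masa_bimodule (\<V> j)"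
    and "masa_bimodule \<U>"
    and "closedin weak_star_topology \<U>"
  shows "weak_star_topology closure_of (\<U> + (\<Inter>j\<in>{1..k}. \<V> j)) =
           (\<Inter>j\<in>{1..k}. weak_star_topology closure_of (\<U> + \<V> j)) \<and>
         (reflexive \<U> \<longrightarrow>
           reflexive (weak_star_topology closure_of (\<U> + (\<Inter>j\<in>{1..k}. \<V> j))) \<and>
           masa_bimodule (weak_star_topology closure_of (\<U> + (\<Inter>j\<in>{1..k}. \<V> j)))) \<and>
         (reflexive \<U> \<longrightarrow> reflexive (weak_star_topology closure_of (\<U> + \<V> 1)))"
proof -
  have sub: "weak_closure (\<U> + (\<Inter>j\<in>{1..k}. \<V> j)) \<subseteq> weak_closure (\<U> + \<V> i)" if "i \<in> {1..k}" for i
    by (intro closure_of_mono set_plus_mono2 order_refl) (use that in blast)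
  have "(\<Inter>j\<in>{1..k}. weak_closure (\<U> + \<V> j)) \<subseteq> weak_closure (\<U> + (\<Inter>j\<in>{1..k}. \<V> j))"
    by (rule closure_plus_INT_superset) (use assms in auto)
  then have eq: "weak_closure (\<U> + (\<Inter>j\<in>{1..k}. \<V> j)) = (\<Inter>j\<in>{1..k}. weak_closure (\<U> + \<V> j))"
    using sub by blast
  have bim: "masa_bimodule (weak_closure (\<U> + (\<Inter>j\<in>{1..k}. \<V> j)))"
    by (intro masa_bimodule_weak_closure masa_bimodule_plus masa_bimodule_INT assms)
      (use assms(2) in blast)
  have refl: "reflexive (weak_closure (\<U> + \<V> i))" if "reflexive \<U>" "i \<in> {1..k}" for i
    using assms that by (intro reflexive_closure_plus) auto
  \<comment> \<open>The intersection formula reduces several bimodules to one, as intersections of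
    reflexive spaces are reflexive.\<close>
  have "reflexive (weak_closure (\<U> + (\<Inter>j\<in>{1..k}. \<V> j)))" if "reflexive \<U>"
    unfolding eq by (intro reflexive_INT refl that)
  moreover have "reflexive (weak_closure (\<U> + \<V> 1))" if "reflexive \<U>"
    by (rule refl[OF that]) (use assms(1) in simp)
  ultimately show ?thesis using eq bim by (intro conjI impI)
qed

end
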